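(* Let $G$ and $G'$ be finite nilpotent groups, and let $S$ be a $G$-adapted ring. Then every isomorphism of $S$-algebras $\psi\colon \mathrm{Z}(SG)\to \mathrm{Z}(SG')$ between the centers of the group rings (if there is any) is monomial and preserves the character degrees.
   Context: For a finite group $G$, an integral domain $S$ of characteristic zero is called $G$-adapted if no prime divisor of the order of $G$ is invertible in $S$. $\mathrm{Z}(SG)$ denotes the center of the group ring $SG$; it is a free $S$-module with basis the class sums (for $g\in G$, the class sum of $g$ is the sum in $SG$ of all distinct $G$-conjugates of $g$). An $S$-algebra isomorphism $\psi\colon \mathrm{Z}(SG)\to \mathrm{Z}(SG')$ forces $G$ and $G'$ to have the same number $h$ of conjugacy classes. Let $\mathscr{C}_1,\dots,\mathscr{C}_h$ and $\mathscr{C}_1',\dots,\mathscr{C}_h'$ be the class sums of $G$ and $G'$. The isomorphism $\psi$ is called monomial if there are a permutation $\pi$ of $\{1,\dots,h\}$ and roots of unity $\xi_1,\dots,\xi_h$ such that $\psi(\mathscr{C}_i)=\xi_{\pi(i)}^{-1}\mathscr{C}'_{\pi(i)}$ for $1\le i\le h$. Preservation of character degrees: embed the quotient field of $S$ in a field $K$ containing $\mathbb{C}$. For an irreducible complex character $\chi$ of $G$ let $e_\chi=\frac{\chi(1)}{|G|}\sum_{g\in G}\chi(g^{-1})g$ be the corresponding primitive central idempotent, and similarly for $G'$. The $K$-linear extension of $\psi$ to an isomorphism $\mathrm{Z}(KG)\to \mathrm{Z}(KG')$ maps the idempotents $e_\chi$ bijectively onto the idempotents $e_{\chi'}$ of $G'$,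 and so induces a bijection $\chi\mapsto\chi'$ between the irreducible complex characters of $G$ and those of $G'$. One says that $\psi$ preserves the character degrees if $\chi(1)=\chi'(1)$ for all irreducible characters $\chi$ of $G$. *)

theory Defs
  imports
    "HOL-Algebra.Algebra"
    "HOL-Computational_Algebra.Fraction_Field"
    "Jordan_Normal_Form.VS_Connect"
begin

subsection \<open>Nilpotent groups and conjugacy classes\<close>

primrec lower_central_series :: "('g, 'm) monoid_scheme \<Rightarrow> nat \<Rightarrow> 'g set" where
  "lower_central_series G 0 = carrier G"
| "lower_central_series G (Suc i) =
     generate G {x \<otimes>\<^bsub>G\<^esub> y \<otimes>\<^bsub>G\<^esub> inv\<^bsub>G\<^esub> x \<otimes>\<^bsub>G\<^esub> inv\<^bsub>G\<^esub> y | x y.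
                   x \<in> lower_central_series G i \<and> y \<in> carrier G}"

definition nilpotent_group :: "('g, 'm) monoid_scheme \<Rightarrow> bool" where
  "nilpotent_group G \<longleftrightarrow> group G \<and> (\<exists>n. lower_central_series G n = {\<one>\<^bsub>G\<^esub>})"

definition conj_class :: "('g, 'm) monoid_scheme \<Rightarrow> 'g \<Rightarrow> 'g set" where
  "conj_class G g = {x \<otimes>\<^bsub>G\<^esub> g \<otimes>\<^bsub>G\<^esub> inv\<^bsub>G\<^esub> x | x. x \<in> carrier G}"

definition conj_classes :: "('g, 'm) monoid_scheme \<Rightarrow> 'g set set" where
  "conj_classes G = conj_class G ` carrier G"


subsection \<open>The group ring of a finite group and its center\<close>

text \<open>An element of the group ring is its coefficient function, which vanishes off the
  carrier; the product is convolution.\<close>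

definition group_ring :: "('g, 'm) monoid_scheme \<Rightarrow> ('g \<Rightarrow> 's::comm_ring_1) ring" where
  "group_ring G =
    \<lparr>carrier = {a. \<forall>g. g \<notin> carrier G \<longrightarrow> a g = 0},
     monoid.mult = (\<lambda>a b g. if g \<in> carrier G
                      then \<Sum>x\<in>carrier G. a x * b (inv\<^bsub>G\<^esub> x \<otimes>\<^bsub>G\<^esub> g) else 0),
     one = (\<lambda>g. if g = \<one>\<^bsub>G\<^esub> then 1 else 0),
     ring.zero = (\<lambda>g. 0),
     add = (\<lambda>a b g. a g + b g)\<rparr>"

definition group_ring_center :: "('g, 'm) monoid_scheme \<Rightarrow> ('g \<Rightarrow> 's::comm_ring_1) ring" where
  "group_ring_center G = (group_ring G)
    \<lparr>carrier := {z \<in> carrier (group_ring G).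
       \<forall>a \<in> carrier (group_ring G). z \<otimes>\<^bsub>group_ring G\<^esub> a = a \<otimes>\<^bsub>group_ring G\<^esub> z}\<rparr>"

definition class_sum :: "'g set \<Rightarrow> 'g \<Rightarrow> 's::comm_ring_1" where
  "class_sum C = (\<lambda>g. if g \<in> C then 1 else 0)"

definition center_algebra_iso ::
    "('g, 'm) monoid_scheme \<Rightarrow> ('h, 'n) monoid_scheme
      \<Rightarrow> (('g \<Rightarrow> 's::comm_ring_1) \<Rightarrow> ('h \<Rightarrow> 's)) \<Rightarrow> bool" where
  "center_algebra_iso G G' \<psi> \<longleftrightarrow>
     \<psi> \<in> ring_iso (group_ring_center G) (group_ring_center G') \<and>
     (\<forall>s. \<forall>z \<in> carrier (group_ring_center G). \<psi> (\<lambda>g. s * z g) = (\<lambda>g. s * \<psi> z g))"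

definition adapted :: "'s::{idom, ring_char_0} itself \<Rightarrow> ('g, 'm) monoid_scheme \<Rightarrow> bool" where
  "adapted _ G \<longleftrightarrow> (\<forall>p::nat. Factorial_Ring.prime p \<and> p dvd card (carrier G) \<longrightarrow> \<not> (of_nat p :: 's) dvd 1)"

text \<open>Classes index themselves, so the permutation of \<open>{1..h}\<close> becomes a bijection between
  the sets of classes. As \<open>'s\<close> has no inversion, \<open>\<eta> D\<close> names the inverse of the root of
  unity \<open>\<xi> D\<close>.\<close>

definition monomial ::
    "('g, 'm) monoid_scheme \<Rightarrow> ('h, 'n) monoid_scheme
      \<Rightarrow> (('g \<Rightarrow> 's::comm_ring_1) \<Rightarrow> ('h \<Rightarrow> 's)) \<Rightarrow> bool" where
  "monomial G G' \<psi> \<longleftrightarrow>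
     (\<exists>\<pi> \<xi> \<eta>. bij_betw \<pi> (conj_classes G) (conj_classes G') \<and>
        (\<forall>D \<in> conj_classes G'. (\<exists>n>0. \<xi> D ^ n = 1) \<and> \<xi> D * \<eta> D = 1) \<and>
        (\<forall>C \<in> conj_classes G. \<psi> (class_sum C) = (\<lambda>g. \<eta> (\<pi> C) * class_sum (\<pi> C) g)))"


subsection \<open>Irreducible complex characters and their degrees\<close>

definition representation ::
    "('g, 'm) monoid_scheme \<Rightarrow> nat \<Rightarrow> ('g \<Rightarrow> complex mat) \<Rightarrow> bool" where
  "representation G n \<rho> \<longleftrightarrow> \<rho> \<in> hom G (units_of (ring_mat TYPE(complex) n ()))"

definition irreducible_representation ::
    "('g, 'm) monoid_scheme \<Rightarrow> nat \<Rightarrow> ('g \<Rightarrow> complex mat) \<Rightarrow> bool" where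
  "irreducible_representation G n \<rho> \<longleftrightarrow> representation G n \<rho> \<and> n > 0 \<and>
     (\<forall>W. VectorSpace.subspace class_ring W (module_vec TYPE(complex) n) \<and>
          (\<forall>g \<in> carrier G. \<forall>w \<in> W. \<rho> g *\<^sub>v w \<in> W)
        \<longrightarrow> W = {0\<^sub>v n} \<or> W = carrier_vec n)"

definition character_of ::
    "('g, 'm) monoid_scheme \<Rightarrow> nat \<Rightarrow> ('g \<Rightarrow> complex mat) \<Rightarrow> 'g \<Rightarrow> complex" where
  "character_of G n \<rho> = (\<lambda>g. if g \<in> carrier G then \<Sum>i<n. \<rho> g $$ (i, i) else 0)"

definition irr_chars :: "('g, 'm) monoid_scheme \<Rightarrow> ('g \<Rightarrow> complex) set" where
  "irr_chars G = {character_of G n \<rho> | n \<rho>. irreducible_representation G n \<rho>}"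

text \<open>Below, \<open>\<iota>\<close> embeds the complex numbers and \<open>\<kappa>\<close> the quotient field of \<open>'s\<close> into \<open>'k\<close>.\<close>

definition char_idempotent ::
    "('g, 'm) monoid_scheme \<Rightarrow> (complex \<Rightarrow> 'k::field) \<Rightarrow> ('g \<Rightarrow> complex) \<Rightarrow> 'g \<Rightarrow> 'k" where
  "char_idempotent G \<iota> \<chi> = (\<lambda>g. if g \<in> carrier G
     then \<iota> (\<chi> \<one>\<^bsub>G\<^esub> / of_nat (card (carrier G)) * \<chi> (inv\<^bsub>G\<^esub> g)) else 0)"

text \<open>The class sums form a basis of the center over \<open>'s\<close> and over \<open>'k\<close>, and the coefficient
  of a central element at a class is its common value on the members of that class.\<close>

definition center_extension ::
    "('g, 'm) monoid_scheme \<Rightarrow> ('s::idom fract \<Rightarrow> 'k::field)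
      \<Rightarrow> (('g \<Rightarrow> 's) \<Rightarrow> ('h \<Rightarrow> 's)) \<Rightarrow> ('g \<Rightarrow> 'k) \<Rightarrow> ('h \<Rightarrow> 'k)" where
  "center_extension G \<kappa> \<psi> z =
     (\<lambda>y. \<Sum>C\<in>conj_classes G. z (SOME x. x \<in> C) * \<kappa> (Fract (\<psi> (class_sum C) y) 1))"

definition preserves_character_degrees ::
    "('g, 'm) monoid_scheme \<Rightarrow> ('h, 'n) monoid_scheme \<Rightarrow> (complex \<Rightarrow> 'k::field)
      \<Rightarrow> ('s::idom fract \<Rightarrow> 'k) \<Rightarrow> (('g \<Rightarrow> 's) \<Rightarrow> ('h \<Rightarrow> 's)) \<Rightarrow> bool" where
  "preserves_character_degrees G G' \<iota> \<kappa> \<psi> \<longleftrightarrow>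
     (\<exists>f. bij_betw f (irr_chars G) (irr_chars G') \<and>
        (\<forall>\<chi> \<in> irr_chars G.
           center_extension G \<kappa> \<psi> (char_idempotent G \<iota> \<chi>) = char_idempotent G' \<iota> (f \<chi>) \<and>
           \<chi> \<one>\<^bsub>G\<^esub> = f \<chi> \<one>\<^bsub>G'\<^esub>))"

end

theory Submission
  imports Defs "HOL-Algebra.Algebraic_Closure_Type" "Jordan_Normal_Form.Char_Poly"
    "HOL-Computational_Algebra.Fundamental_Theorem_Algebra"
begin

text \<open>Let \<open>\<phi>\<close> be the inverse of the given isomorphism, extended to the algebraic closure \<open>K\<close> of
  the fraction field of the coefficient domain, and let \<open>R\<close> be the integral closure of that
  domain in \<open>K\<close>; no prime divisor of the order of \<open>G\<close> is invertible in \<open>R\<close>. Write \<open>H\<close> for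
  \<open>G'\<close>.

  Since \<open>\<phi>\<close> matches the primitive central idempotents, it matches irreducible characters. The
  principal character of \<open>H\<close> goes to a character \<open>\<chi>\<close> of \<open>G\<close> of some degree \<open>d\<close>, and comparing
  coefficients of idempotents puts \<open>|G| / (d |H|)\<close> into \<open>R\<close>. The inverse of \<open>\<phi>\<close> gives
  \<open>|H| / (e |G|) \<in> R\<close> for a degree \<open>e\<close>, so \<open>1 / (d e) \<in> R\<close>; as \<open>d\<close> divides \<open>|G|\<close>, adaptedness forces \<open>d = 1\<close>
  (\<open>augmentation_linear_char\<close>). Multiplying by the linear character \<open>\<chi>\<close> turns \<open>\<phi>\<close> into an
  isomorphism that preserves the augmentation, the sum of all coefficients. For it, class sums
  go to class sums (\<open>classes_to_classes\<close>); undoing the twist gives a monomial isomorphism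
  whose roots of unity are values of \<open>\<chi>\<close> (\<open>classes_to_class_multiples\<close>).

  Two ideas prove that class sums go to class sums. The first is arithmetic. An entry \<open>v\<close> of
  the image of the class sum of \<open>h\<close>, taken at \<open>g\<close>, is a rational polynomial in a root of unity
  \<open>\<zeta>\<close>, and its conjugate under \<open>\<zeta> \<mapsto> \<zeta>\<^sup>s\<close> is the entry at \<open>g\<^sup>s\<close> of the image of the class sum
  of \<open>h\<^sup>s\<close>. The elementary symmetric functions of the conjugates are rational, lie in \<open>R\<close> and
  have denominators dividing a power of \<open>|G|\<close>, so they are integers. Moving to the complex
  numbers, the product of the nonzero conjugates has absolute value at least 1, and \<open>ln r + (r
  - 1)\<^sup>2 \<le> r\<^sup>2 - r\<close> gives \<open>\<Sum> |v|\<^sup>2 - Re v \<ge> 0\<close> over the conjugates, with equality only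
  for \<open>v \<in> {0, 1}\<close>. So all entries are 0 or 1 as soon as their squared norm equals their sum,
  which is the length of the class. That norm is the coefficient at the identity of the image
  of a product of two class sums, so the condition holds if \<open>\<phi>\<close> keeps the coefficient at the
  unit of that product.

  The second idea supplies this by induction along the lower central series of \<open>H\<close>, upwards
  from its trivial term. Assume that \<open>\<phi>\<close> keeps the coefficient at the identity of central
  elements supported on a term \<open>N\<close>, and let \<open>h\<close> be in the preceding term \<open>M\<close>. The product of
  the class sums of \<open>h\<close> and of its inverse is supported on \<open>N\<close>, so the image of the class sum
  of \<open>h\<close> has entries 0 and 1. If \<open>h\<close> is not in \<open>N\<close>, its coset \<open>N h\<close> is a union of classes; let
  \<open>u\<close> and \<open>t\<close> be the images of the sums over \<open>N h\<close> and \<open>N\<close>. They have natural entries, norms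
  \<open>\<langle>u, u\<rangle> = \<langle>t, t\<rangle> = |N|\<close>, and \<open>\<langle>u, t\<rangle> = |N| u(1)\<close>. If \<open>u(1) > 0\<close> then \<open>u - t\<close> has norm at
  most 0, so \<open>u = t\<close> and \<open>N h = N\<close>, which is absurd. So \<open>u(1) = 0\<close>, and \<open>\<phi>\<close> keeps the
  coefficient at the identity on \<open>M\<close> as well (\<open>unit_coeff_kept_step\<close>). At the top of the
  series, images of class sums are indicator functions, disjoint for different classes, hence
  class sums.

  Finally, a monomial isomorphism and its linear extensions keep the coefficient at the
  identity (\<open>ext_at_one\<close>), and for the idempotent of \<open>\<chi>\<close> this coefficient is \<open>\<chi>(1)\<^sup>2 / |G|\<close>.
  The groups have the same order because classes go to classes of the same length, so the
  degrees agree.\<close>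

section \<open>Split subspaces and traces of idempotent matrices\<close>

lemma mat_mult_entry:
  assumes "A \<in> carrier_mat n m" "B \<in> carrier_mat m p" "i < n" "j < p"
  shows "(A * B) $$ (i,j) = (\<Sum>l<m. A $$ (i,l) * B $$ (l,j))"
  using assms by (auto simp: scalar_prod_def atLeast0LessThan intro!: sum.cong)

lemma mat_vec_entry:
  assumes "A \<in> carrier_mat n m" "v \<in> carrier_vec m" "i < n"
  shows "(A *\<^sub>v v) $ i = (\<Sum>l<m. A $$ (i,l) * v $ l)"
  using assms by (auto simp: scalar_prod_def atLeast0LessThan intro!: sum.cong)

definition mtrace :: "'a::comm_ring_1 mat \<Rightarrow> 'a" where
  "mtrace A = (\<Sum>i<dim_row A. A $$ (i,i))"

lemma mtrace_comm:
  assumes "A \<in> carrier_mat n m" "B \<in> carrier_mat m n"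
  shows "mtrace (A * B) = mtrace (B * A)"
proof -
  have "mtrace (A * B) = (\<Sum>i<n. \<Sum>l<m. A $$ (i,l) * B $$ (l,i))"
    unfolding mtrace_def using assms by (auto simp: mat_mult_entry[OF assms] simp del: index_mult_mat(1) intro!: sum.cong)
  also have "\<dots> = (\<Sum>l<m. \<Sum>i<n. B $$ (l,i) * A $$ (i,l))"
    by (subst sum.swap) (simp add: mult.commute)
  also have "\<dots> = mtrace (B * A)"
    unfolding mtrace_def using assms by (auto simp: mat_mult_entry[OF assms(2,1)] simp del: index_mult_mat(1) intro!: sum.cong)
  finally show ?thesis .
qed

lemma mtrace_one: "mtrace (1\<^sub>m n) = of_nat n"
  by (simp add: mtrace_def)

lemma mat_unit_vec_col:
  fixes A :: "'a::comm_ring_1 mat"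
  assumes "A \<in> carrier_mat n m" "j < m"
  shows "col A j = A *\<^sub>v unit_vec m j"
  using assms by (intro eq_vecI) auto

text \<open>Padding the factors with zeros to square matrices turns the one-sided inverse into a
  two-sided one, and a zero row then contradicts invertibility.\<close>

lemma left_inverse_dim:
  fixes B :: "'a::field mat"
  assumes B: "B \<in> carrier_mat N d" and B': "B' \<in> carrier_mat d N" and id: "B' * B = 1\<^sub>m d"
  shows "d \<le> N"
proof (rule ccontr)
  assume "\<not> d \<le> N"
  then have N: "N < d" by simp
  define C where "C = mat d d (\<lambda>(i,j). if i < N then B $$ (i,j) else 0)"
  define C' where "C' = mat d d (\<lambda>(i,j). if j < N then B' $$ (i,j) else 0)"
  have C: "C \<in> carrier_mat d d" and C': "C' \<in> carrier_mat d d" by (auto simp: C_def C'_def)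
  have "C' * C = 1\<^sub>m d"
  proof (rule eq_matI)
    fix i j assume "i < dim_row (1\<^sub>m d)" "j < dim_col (1\<^sub>m d)"
    then have ij: "i < d" "j < d" by auto
    have "(C' * C) $$ (i,j) = (\<Sum>l<d. C' $$ (i,l) * C $$ (l,j))"
      using mat_mult_entry[OF C' C] ij by simp
    also have "\<dots> = (\<Sum>l<N. B' $$ (i,l) * B $$ (l,j))"
      using N ij by (intro sum.mono_neutral_cong_right) (auto simp: C_def C'_def)
    also have "\<dots> = (B' * B) $$ (i,j)"
      using mat_mult_entry[OF B' B] ij by simp
    finally show "(C' * C) $$ (i,j) = 1\<^sub>m d $$ (i,j)" by (simp add: id)
  qed (use C C' in auto)
  then have "C * C' = 1\<^sub>m d" using mat_mult_left_right_inverse[OF C' C] by simp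
  then have "(C * C') $$ (N,N) = 1" using N by simp
  moreover have "(C * C') $$ (N,N) = 0"
    using mat_mult_entry[OF C C' N N] N by (simp add: C_def)
  ultimately show False by simp
qed

definition lin_subspace :: "nat \<Rightarrow> 'a::field vec set \<Rightarrow> bool" where
  "lin_subspace n W \<longleftrightarrow> W \<subseteq> carrier_vec n \<and> 0\<^sub>v n \<in> W \<and>
     (\<forall>u\<in>W. \<forall>v\<in>W. u + v \<in> W) \<and> (\<forall>c. \<forall>v\<in>W. c \<cdot>\<^sub>v v \<in> W)"

lemma lin_subspace_iff:
  "VectorSpace.subspace class_ring W (module_vec TYPE('a::field) n) \<longleftrightarrow> lin_subspace n W"
proof -
  interpret vs: vectorspace "class_ring :: 'a ring" "module_vec TYPE('a) n" by (rule vec_vs)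
  show ?thesis
    unfolding VectorSpace.subspace_def submodule_def lin_subspace_def
    using vec_vs[of n, where ?'a = 'a] vs.module_axioms
    by (auto simp: module_vec_simps class_ring_simps)
qed

text \<open>The columns of \<open>B\<close> are a basis of the subspace and \<open>B'\<close> gives the coordinates of its
  elements. In this form subrepresentations can be written as matrix representations again.\<close>

lemma subspace_split:
  fixes W :: "'a::field vec set"
  assumes W: "lin_subspace N W"
  obtains d B B' where "B \<in> carrier_mat N d" "B' \<in> carrier_mat d N" "B' * B = 1\<^sub>m d" "d \<le> N"
    "\<And>u. u \<in> carrier_vec d \<Longrightarrow> B *\<^sub>v u \<in> W" "\<And>w. w \<in> W \<Longrightarrow> B *\<^sub>v (B' *\<^sub>v w) = w"
proof -
  define P where "P d \<longleftrightarrow> (\<exists>B B'. B \<in> carrier_mat N d \<and> B' \<in> carrier_mat d N \<and> B' * B = 1\<^sub>m d \<and>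
     (\<forall>u \<in> carrier_vec d. B *\<^sub>v u \<in> W))" for d
  have W0: "0\<^sub>v N \<in> W" and Wc: "W \<subseteq> carrier_vec N"
    and Wadd: "\<And>u v. u \<in> W \<Longrightarrow> v \<in> W \<Longrightarrow> u + v \<in> W" and Wsm: "\<And>c v. v \<in> W \<Longrightarrow> c \<cdot>\<^sub>v v \<in> W"
    using W by (auto simp: lin_subspace_def)
  have P0: "P 0" unfolding P_def
  proof (intro exI conjI ballI)
    show "0\<^sub>m N 0 \<in> carrier_mat N 0" "0\<^sub>m 0 N \<in> carrier_mat 0 N" by auto
    show "0\<^sub>m 0 N * 0\<^sub>m N 0 = (1\<^sub>m 0 :: 'a mat)" by (rule eq_matI) auto
    fix u :: "'a vec" assume "u \<in> carrier_vec 0"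
    then have "0\<^sub>m N 0 *\<^sub>v u = 0\<^sub>v N" by (intro eq_vecI) (auto simp: scalar_prod_def)
    then show "0\<^sub>m N 0 *\<^sub>v u \<in> W" using W0 by simp
  qed
  have bd: "d \<le> N" if "P d" for d using that left_inverse_dim unfolding P_def by blast
  (* Maximality of d is what makes B onto W: a vector outside its image gives one more column. *)
  define d where "d = Max {d. P d}"
  have fin: "finite {d. P d}" by (rule finite_subset[of _ "{..N}"]) (use bd in auto)
  have Pd: "P d" unfolding d_def using Max_in[OF fin] P0 by auto
  have notP: "\<not> P (Suc d)" using Max_ge[OF fin, of "Suc d"] unfolding d_def by auto
  obtain B B' where B: "B \<in> carrier_mat N d" and B': "B' \<in> carrier_mat d N" and id: "B' * B = 1\<^sub>m d"
    and BW: "\<And>u. u \<in> carrier_vec d \<Longrightarrow> B *\<^sub>v u \<in> W" using Pd unfolding P_def by blast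
  have "B *\<^sub>v (B' *\<^sub>v w) = w" if w: "w \<in> W" for w
  proof (rule ccontr)
    assume ne: "B *\<^sub>v (B' *\<^sub>v w) \<noteq> w"
    define w' where "w' = w + (-1) \<cdot>\<^sub>v (B *\<^sub>v (B' *\<^sub>v w))"
    have wN: "w \<in> carrier_vec N" using w Wc by auto
    have B'w: "B' *\<^sub>v w \<in> carrier_vec d" using B' wN by auto
    have BB'w: "B *\<^sub>v (B' *\<^sub>v w) \<in> carrier_vec N" using B B'w by auto
    have w'W: "w' \<in> W" unfolding w'_def using w BW[OF B'w] Wadd Wsm by blast
    have w'N: "w' \<in> carrier_vec N" using w'W Wc by auto
    have "w' \<noteq> 0\<^sub>v N"
    proof
      assume "w' = 0\<^sub>v N"
      then have "w $ i - (B *\<^sub>v (B' *\<^sub>v w)) $ i = 0" if "i < N" for i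
      proof -
        have "w' $ i = w $ i - (B *\<^sub>v (B' *\<^sub>v w)) $ i"
          unfolding w'_def using that wN BB'w B by (simp del: index_mult_mat_vec)
        then show ?thesis using \<open>w' = 0\<^sub>v N\<close> that by simp
      qed
      then have "w = B *\<^sub>v (B' *\<^sub>v w)" by (intro eq_vecI) (use wN BB'w B in auto)
      then show False using ne by simp
    qed
    then obtain k where k: "k < N" "w' $ k \<noteq> 0" using w'N by (metis carrier_vecD eq_vecI index_zero_vec)
    have B'w': "B' *\<^sub>v w' = 0\<^sub>v d"
    proof -
      have "B' *\<^sub>v w' = B' *\<^sub>v w + (-1) \<cdot>\<^sub>v (B' *\<^sub>v (B *\<^sub>v (B' *\<^sub>v w)))"
        unfolding w'_def using B' wN BB'w by (simp add: mult_add_distrib_mat_vec mult_mat_vec)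
      also have "B' *\<^sub>v (B *\<^sub>v (B' *\<^sub>v w)) = (B' * B) *\<^sub>v (B' *\<^sub>v w)"
        using assoc_mult_mat_vec[OF B' B B'w] by simp
      also have "\<dots> = B' *\<^sub>v w" using B'w by (simp add: id)
      finally have e: "B' *\<^sub>v w' = B' *\<^sub>v w + (-1) \<cdot>\<^sub>v (B' *\<^sub>v w)" .
      show ?thesis unfolding e
        by (rule eq_vecI) (use B'w carrier_vecD[OF B'w] in \<open>simp_all del: index_mult_mat_vec dim_mult_mat_vec\<close>)
    qed
    define C where "C = mat N (Suc d) (\<lambda>(i,j). if j < d then B $$ (i,j) else w' $ i)"
    define r where "r l = ((if l = k then 1 else 0) - (B * B') $$ (k,l)) / w' $ k" for l
    define C' where "C' = mat (Suc d) N (\<lambda>(i,j). if i < d then B' $$ (i,j) else r j)"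
    have C: "C \<in> carrier_mat N (Suc d)" and C': "C' \<in> carrier_mat (Suc d) N" by (auto simp: C_def C'_def)
    have BB': "B * B' \<in> carrier_mat N N" using B B' by auto
    have rsum: "(\<Sum>l<N. r l * v $ l) = (v $ k - (B *\<^sub>v (B' *\<^sub>v v)) $ k) / w' $ k" if v: "v \<in> carrier_vec N" for v
    proof -
      have "(\<Sum>l<N. r l * v $ l) = (\<Sum>l<N. (if l = k then 1 else 0) * v $ l - (B * B') $$ (k,l) * v $ l) / w' $ k"
        unfolding sum_divide_distrib r_def by (intro sum.cong) (auto simp: algebra_simps diff_divide_distrib)
      also have "(\<Sum>l<N. (if l = k then 1 else 0) * v $ l - (B * B') $$ (k,l) * v $ l) = v $ k - ((B * B') *\<^sub>v v) $ k"
        unfolding sum_subtractf mat_vec_entry[OF BB' v k(1)] using k(1)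
        by (simp add: if_distrib[of "\<lambda>x. x * _"] sum.delta cong: if_cong)
      finally show ?thesis using assoc_mult_mat_vec[OF B B' v] by simp
    qed
    have "C' * C = 1\<^sub>m (Suc d)"
    proof (rule eq_matI)
      fix i j assume "i < dim_row (1\<^sub>m (Suc d))" "j < dim_col (1\<^sub>m (Suc d))"
      then have ij: "i < Suc d" "j < Suc d" by auto
      have e: "(C' * C) $$ (i,j) = (\<Sum>l<N. C' $$ (i,l) * C $$ (l,j))"
        using mat_mult_entry[OF C' C] ij by simp
      define c where "c = (if j < d then col B j else w')"
      have cN: "c \<in> carrier_vec N" using B w'N by (auto simp: c_def)
      have Cc: "C $$ (l,j) = c $ l" if "l < N" for l using that ij B by (auto simp: C_def c_def)
      have B'c: "B' *\<^sub>v c = (if j < d then unit_vec d j else 0\<^sub>v d)"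
      proof (cases "j < d")
        case True
        have "B' *\<^sub>v col B j = col (B' * B) j" using True B B' by (intro eq_vecI) auto
        then show ?thesis using True by (simp add: c_def id)
      qed (simp add: c_def B'w')
      show "(C' * C) $$ (i,j) = 1\<^sub>m (Suc d) $$ (i,j)"
      proof (cases "i < d")
        case True
        have "(C' * C) $$ (i,j) = (\<Sum>l<N. B' $$ (i,l) * c $ l)"
          unfolding e using True by (intro sum.cong) (auto simp: Cc C'_def)
        also have "\<dots> = (B' *\<^sub>v c) $ i" using mat_vec_entry[OF B' cN True] by simp
        finally show ?thesis using True ij by (auto simp: B'c)
      next
        case False
        then have i: "i = d" using ij by simp
        have "(C' * C) $$ (i,j) = (\<Sum>l<N. r l * c $ l)"
          unfolding e using i by (intro sum.cong) (auto simp: Cc C'_def)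
        also have "\<dots> = (c $ k - (B *\<^sub>v (B' *\<^sub>v c)) $ k) / w' $ k" by (rule rsum[OF cN])
        also have "B *\<^sub>v (B' *\<^sub>v c) = (if j < d then c else 0\<^sub>v N)"
        proof (cases "j < d")
          case True
          have "B *\<^sub>v unit_vec d j = col B j" using B True by (rule mat_unit_vec_col[symmetric])
          moreover have "c = col B j" "B' *\<^sub>v c = unit_vec d j" using True B'c by (auto simp: c_def)
          ultimately show ?thesis using True by simp
        qed (use B in \<open>auto simp: B'c intro!: eq_vecI\<close>)
        finally show ?thesis using ij i k by (cases "j < d") (auto simp: c_def)
      qed
    qed (use C C' in auto)
    moreover have "C *\<^sub>v u \<in> W" if u: "u \<in> carrier_vec (Suc d)" for u
    proof -
      define u' where "u' = vec d (\<lambda>i. u $ i)"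
      have u': "u' \<in> carrier_vec d" by (simp add: u'_def)
      have "C *\<^sub>v u = B *\<^sub>v u' + u $ d \<cdot>\<^sub>v w'"
      proof (rule eq_vecI)
        fix i assume "i < dim_vec (B *\<^sub>v u' + u $ d \<cdot>\<^sub>v w')"
        then have i: "i < N" using w'N by auto
        have "(C *\<^sub>v u) $ i = (\<Sum>l<Suc d. C $$ (i,l) * u $ l)" by (rule mat_vec_entry[OF C u i])
        also have "\<dots> = (\<Sum>l<d. B $$ (i,l) * u' $ l) + w' $ i * u $ d"
          using i by (simp add: C_def u'_def)
        also have "(\<Sum>l<d. B $$ (i,l) * u' $ l) = (B *\<^sub>v u') $ i" using mat_vec_entry[OF B u' i] by simp
        finally show "(C *\<^sub>v u) $ i = (B *\<^sub>v u' + u $ d \<cdot>\<^sub>v w') $ i" using i B w'N by simp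
      qed (use C B w'N in auto)
      then show ?thesis using Wadd Wsm BW u' w'W by simp
    qed
    ultimately have "P (Suc d)" unfolding P_def using C C' by blast
    then show False using notP by simp
  qed
  with that[OF B B' id bd[OF Pd] BW] show thesis by blast
qed

text \<open>An idempotent factors through its image as \<open>f = B (B' f)\<close> with \<open>(B' f) B = 1\<close>, so its trace
  is the trace of an identity matrix.\<close>

lemma idempotent_trace:
  fixes f :: "'a::field mat"
  assumes f: "f \<in> carrier_mat n n" and ff: "f * f = f"
  shows "\<exists>d. mtrace f = of_nat d"
proof -
  define W where "W = {f *\<^sub>v v | v. v \<in> carrier_vec n}"
  have "lin_subspace n W" unfolding lin_subspace_def
  proof (intro conjI ballI allI)
    show "W \<subseteq> carrier_vec n" using f by (auto simp: W_def)
    show "0\<^sub>v n \<in> W" unfolding W_def using f by (auto intro!: exI[of _ "0\<^sub>v n"])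
    fix u v assume "u \<in> W" "v \<in> W"
    then obtain a b where "u = f *\<^sub>v a" "v = f *\<^sub>v b" "a \<in> carrier_vec n" "b \<in> carrier_vec n" by (auto simp: W_def)
    then show "u + v \<in> W" unfolding W_def using f
      by (auto intro!: exI[of _ "a + b"] simp: mult_add_distrib_mat_vec[OF f])
  next
    fix c v assume "v \<in> W"
    then obtain b where "v = f *\<^sub>v b" "b \<in> carrier_vec n" by (auto simp: W_def)
    then show "c \<cdot>\<^sub>v v \<in> W" unfolding W_def using f
      by (auto intro!: exI[of _ "c \<cdot>\<^sub>v b"] simp: mult_mat_vec[OF f])
  qed
  then obtain d B B' where B: "B \<in> carrier_mat n d" and B': "B' \<in> carrier_mat d n" and id: "B' * B = 1\<^sub>m d"
    and BW: "\<And>u. u \<in> carrier_vec d \<Longrightarrow> B *\<^sub>v u \<in> W" and BB: "\<And>w. w \<in> W \<Longrightarrow> B *\<^sub>v (B' *\<^sub>v w) = w"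
    by (rule subspace_split) blast
  have fW: "f *\<^sub>v w = w" if w: "w \<in> W" for w
  proof -
    obtain v where "w = f *\<^sub>v v" "v \<in> carrier_vec n" using w unfolding W_def by blast
    then show ?thesis using assoc_mult_mat_vec[OF f f] ff by metis
  qed
  have "f * B = B"
  proof (rule mat_col_eqI)
    fix j assume "j < dim_col B"
    then have j: "j < d" using B by auto
    have "col (f * B) j = f *\<^sub>v col B j" using f B j by (intro eq_vecI) auto
    also have "col B j = B *\<^sub>v unit_vec d j" using B j by (rule mat_unit_vec_col)
    also have "f *\<^sub>v (B *\<^sub>v unit_vec d j) = B *\<^sub>v unit_vec d j" by (rule fW[OF BW]) simp
    also have "\<dots> = col B j" using mat_unit_vec_col[OF B j] by simp
    finally show "col (f * B) j = col B j" .
  qed (use f B in auto)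
  have B'f: "B' * f \<in> carrier_mat d n" using B' f by auto
  have "B * (B' * f) = f"
  proof (rule mat_col_eqI)
    fix j assume "j < dim_col f"
    then have j: "j < n" using f by auto
    have W: "col f j \<in> W" unfolding W_def using f j mat_unit_vec_col[OF f j] by auto
    have "col (B * (B' * f)) j = B *\<^sub>v col (B' * f) j" using B B'f j by (intro eq_vecI) auto
    also have "col (B' * f) j = B' *\<^sub>v col f j" using f B' j by (intro eq_vecI) auto
    also have "B *\<^sub>v (B' *\<^sub>v col f j) = col f j" by (rule BB[OF W])
    finally show "col (B * (B' * f)) j = col f j" .
  qed (use f B in auto)
  then have "mtrace f = mtrace ((B' * f) * B)" using mtrace_comm[OF B B'f] by simp
  also have "(B' * f) * B = B' * (f * B)" using B' f B by (rule assoc_mult_mat)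
  finally show ?thesis using \<open>f * B = B\<close> id by (auto simp: mtrace_one)
qed

section \<open>Integral elements over a subring of a field\<close>

definition is_subring :: "'k::field set \<Rightarrow> bool" where
  "is_subring R \<longleftrightarrow> 0 \<in> R \<and> 1 \<in> R \<and> (\<forall>x\<in>R. \<forall>y\<in>R. x + y \<in> R \<and> x * y \<in> R) \<and> (\<forall>x\<in>R. - x \<in> R)"

lemma is_subringD:
  assumes "is_subring R"
  shows "0 \<in> R" "1 \<in> R" "x \<in> R \<Longrightarrow> y \<in> R \<Longrightarrow> x + y \<in> R" "x \<in> R \<Longrightarrow> y \<in> R \<Longrightarrow> x * y \<in> R" "x \<in> R \<Longrightarrow> - x \<in> R"
    "x \<in> R \<Longrightarrow> y \<in> R \<Longrightarrow> x - y \<in> R"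
  using assms unfolding is_subring_def by (auto simp: diff_conv_add_uminus simp del: add_uminus_conv_diff)

lemma is_subring_sum: "is_subring R \<Longrightarrow> (\<And>x. x \<in> A \<Longrightarrow> f x \<in> R) \<Longrightarrow> sum f A \<in> R"
  by (induction A rule: infinite_finite_induct) (auto intro: is_subringD)
lemma is_subring_prod: "is_subring R \<Longrightarrow> (\<And>x. x \<in> A \<Longrightarrow> f x \<in> R) \<Longrightarrow> prod f A \<in> R"
  by (induction A rule: infinite_finite_induct) (auto intro: is_subringD)
lemma is_subring_power: "is_subring R \<Longrightarrow> x \<in> R \<Longrightarrow> x ^ n \<in> R"
  by (induction n) (auto intro: is_subringD)
lemma is_subring_of_nat: "is_subring R \<Longrightarrow> of_nat n \<in> R"
  by (induction n) (auto intro: is_subringD)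
lemma is_subring_of_int: "is_subring R \<Longrightarrow> of_int n \<in> R"
  by (cases n) (auto intro: is_subringD is_subring_of_nat simp del: of_nat_Suc)

definition integral_over :: "'k::field set \<Rightarrow> 'k \<Rightarrow> bool" where
  "integral_over R x \<longleftrightarrow> (\<exists>p. (\<forall>i. coeff p i \<in> R) \<and> lead_coeff p = 1 \<and> poly p x = 0)"

lemma coeffs_prod_in_subring:
  assumes R: "is_subring R" and "\<And>x. x \<in> A \<Longrightarrow> \<forall>i. coeff (f x) i \<in> R"
  shows "\<forall>i. coeff (prod f A) i \<in> R"
  using assms(2)
proof (induction A rule: infinite_finite_induct)
  case (insert x F)
  then show ?case by (auto simp: coeff_mult intro!: is_subring_sum[OF R] is_subringD(4)[OF R])
qed (use is_subringD(1,2)[OF R] in \<open>auto simp: one_pCons coeff_pCons split: nat.splits\<close>)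

lemma coeffs_char_poly_in_subring:
  assumes R: "is_subring R" and A: "A \<in> carrier_mat n n" and AR: "\<And>i j. i < n \<Longrightarrow> j < n \<Longrightarrow> A $$ (i,j) \<in> R"
  shows "coeff (char_poly A) k \<in> R"
proof -
  have dim: "dim_row (char_poly_matrix A) = n" "dim_col (char_poly_matrix A) = n"
    using A by (auto simp: char_poly_matrix_def)
  have ent: "\<forall>k. coeff (char_poly_matrix A $$ (i,j)) k \<in> R" if "i < n" "j < n" for i j
  proof -
    have "char_poly_matrix A $$ (i,j) = (if i = j then [:0,1:] else 0) + [:- A $$ (i,j):]"
      using that A by (auto simp: char_poly_matrix_def)
    then show ?thesis using AR[OF that] is_subringD[OF R] by (auto simp: coeff_pCons split: nat.splits)
  qed
  have "coeff (\<Prod>i = 0..<n. char_poly_matrix A $$ (i, p i)) k \<in> R" if "p permutes {0..<n}" for p k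
    using coeffs_prod_in_subring[OF R, of "{0..<n}" "\<lambda>i. char_poly_matrix A $$ (i, p i)"] ent
      permutes_in_image[OF that] by auto
  then show ?thesis unfolding char_poly_def det_def dim
    by (auto simp: coeff_sum sign_def intro!: is_subring_sum[OF R] is_subringD(5)[OF R])
qed

text \<open>An eigenvalue is a root of the characteristic polynomial, whose coefficients lie in the
  ring.\<close>

lemma integral_over_eigen:
  fixes v :: "'i \<Rightarrow> 'k::field"
  assumes R: "is_subring R" and fin: "finite I" and "i0 \<in> I" "v i0 \<noteq> 0"
    and MR: "\<And>i j. i \<in> I \<Longrightarrow> j \<in> I \<Longrightarrow> M i j \<in> R"
    and eig: "\<And>i. i \<in> I \<Longrightarrow> c * v i = (\<Sum>j\<in>I. M i j * v j)"
  shows "integral_over R c"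
proof -
  obtain e where e: "bij_betw e {0..<card I} I" using ex_bij_betw_nat_finite[OF fin] by blast
  define n where "n = card I"
  have eI: "e i \<in> I" if "i < n" for i using bij_betwE[OF e] that by (auto simp: n_def)
  define A where "A = mat n n (\<lambda>(i,j). M (e i) (e j))"
  define w where "w = vec n (\<lambda>i. v (e i))"
  have A: "A \<in> carrier_mat n n" by (simp add: A_def)
  have "i0 \<in> e ` {0..<card I}" using e assms(3) by (simp add: bij_betw_def)
  then obtain k where k: "k < n" "e k = i0" by (auto simp: n_def)
  have "eigenvector A w c" unfolding eigenvector_def
  proof (intro conjI)
    show "w \<in> carrier_vec (dim_row A)" by (simp add: w_def A_def)
    show "w \<noteq> 0\<^sub>v (dim_row A)" using k assms(4) by (auto simp: w_def A_def vec_eq_iff)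
    show "A *\<^sub>v w = c \<cdot>\<^sub>v w"
    proof (rule eq_vecI)
      fix i assume "i < dim_vec (c \<cdot>\<^sub>v w)"
      then have i: "i < n" by (simp add: w_def)
      have "(\<Sum>j\<in>I. M (e i) j * v j) = (\<Sum>j\<in>{0..<n}. M (e i) (e j) * v (e j))"
        unfolding n_def by (rule sum.reindex_bij_betw[OF e, symmetric])
      then show "(A *\<^sub>v w) $ i = (c \<cdot>\<^sub>v w) $ i"
        using i eig[OF eI[OF i]] by (simp add: A_def w_def scalar_prod_def)
    qed (simp add: A_def w_def)
  qed
  then have "poly (char_poly A) c = 0" using eigenvalue_root_char_poly[OF A] by (auto simp: eigenvalue_def)
  moreover have "coeff (char_poly A) i \<in> R" for i
    by (rule coeffs_char_poly_in_subring[OF R A]) (auto simp: A_def intro!: MR eI)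
  moreover have "lead_coeff (char_poly A) = 1" using degree_monic_char_poly[OF A] by simp
  ultimately show ?thesis unfolding integral_over_def by blast
qed

lemma integral_over_power_expansion:
  assumes R: "is_subring R" and "integral_over R x"
  obtains m c where "m > 0" "\<And>i. c i \<in> R" "x ^ m = (\<Sum>i<m. c i * x ^ i)"
proof -
  obtain p where p: "\<And>i. coeff p i \<in> R" "lead_coeff p = 1" "poly p x = 0"
    using assms(2) unfolding integral_over_def by blast
  have "degree p \<noteq> 0"
  proof
    assume "degree p = 0"
    then obtain a where "p = [:a:]" by (rule degree_eq_zeroE)
    then show False using p by simp
  qed
  moreover have "x ^ degree p = (\<Sum>i<degree p. - coeff p i * x ^ i)"
  proof -
    have "{..degree p} = insert (degree p) {..<degree p}" by auto
    then have "x ^ degree p + (\<Sum>i<degree p. coeff p i * x ^ i) = poly p x"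
      using p(2) by (simp add: poly_altdef)
    then have "x ^ degree p = - (\<Sum>i<degree p. coeff p i * x ^ i)" using p(3) eq_neg_iff_add_eq_0 by metis
    then show ?thesis by (simp add: sum_negf)
  qed
  ultimately show thesis using that[of "degree p" "\<lambda>i. - coeff p i"] p(1) is_subringD(5)[OF R] by auto
qed

lemma integral_over_base:
  assumes "is_subring R" "x \<in> R" shows "integral_over R x"
  unfolding integral_over_def using assms is_subringD[OF assms(1)]
  by (intro exI[of _ "[:-x, 1:]"]) (auto simp: coeff_pCons split: nat.splits)

text \<open>The monomials \<open>x\<^sup>i y\<^sup>j\<close> below the degrees of the two equations span a module that \<open>x\<close> and
  \<open>y\<close> map into itself, so they form an eigenvector of integral matrices for \<open>x + y\<close> and \<open>x y\<close>.\<close>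

lemma integral_over_add_mult:
  assumes R: "is_subring R" and x: "integral_over R x" and y: "integral_over R y"
  shows "integral_over R (x + y)" "integral_over R (x * y)"
proof -
  obtain m c where m: "m > 0" and c: "\<And>i. c i \<in> R" and xm: "x ^ m = (\<Sum>i<m. c i * x ^ i)"
    by (rule integral_over_power_expansion[OF R x]) blast
  obtain n d where n: "n > 0" and d: "\<And>i. d i \<in> R" and yn: "y ^ n = (\<Sum>i<n. d i * y ^ i)"
    by (rule integral_over_power_expansion[OF R y]) blast
  define I where "I = {..<m} \<times> {..<n}"
  define v where "v = (\<lambda>(i,j). x ^ i * y ^ j)"
  define cc where "cc i k = (if Suc i < m then (if k = Suc i then 1 else 0) else c k)" for i k
  define dd where "dd j l = (if Suc j < n then (if l = Suc j then 1 else 0) else d l)" for j l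
  define MX where "MX = (\<lambda>(i::nat,j::nat) (k::nat,l::nat). if j = l then cc i k else 0)"
  define MY where "MY = (\<lambda>(i::nat,j::nat) (k::nat,l::nat). if i = k then dd j l else 0)"
  have fin: "finite I" by (simp add: I_def)
  have i0: "(0,0) \<in> I" "v (0,0) \<noteq> 0" using m n by (auto simp: I_def v_def)
  have MXR: "MX a b \<in> R" for a b
    using is_subringD(1,2)[OF R] c by (auto simp: MX_def cc_def split: prod.splits)
  have MYR: "MY a b \<in> R" for a b
    using is_subringD(1,2)[OF R] d by (auto simp: MY_def dd_def split: prod.splits)
  have X: "x * v a = (\<Sum>b\<in>I. MX a b * v b)" if a: "a \<in> I" for a
  proof -
    obtain i j where ij: "a = (i,j)" "i < m" "j < n" using a unfolding I_def by blast
    have "(\<Sum>b\<in>I. MX a b * v b) = (\<Sum>k<m. \<Sum>l<n. MX (i,j) (k,l) * v (k,l))"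
      unfolding I_def ij sum.cartesian_product by (rule sum.cong) auto
    also have "\<dots> = (\<Sum>k<m. \<Sum>l<n. if l = j then cc i k * (x ^ k * y ^ j) else 0)"
      by (intro sum.cong refl) (simp add: MX_def v_def)
    also have "\<dots> = (\<Sum>k<m. cc i k * (x ^ k * y ^ j))" using ij by simp
    also have "\<dots> = x ^ Suc i * y ^ j"
    proof (cases "Suc i < m")
      case False
      then have "Suc i = m" using ij by simp
      then have "x ^ Suc i = (\<Sum>k<m. c k * x ^ k)" using xm by simp
      then show ?thesis using False by (simp add: cc_def sum_distrib_right mult.assoc)
    next
      case True
      then have "(\<Sum>k<m. cc i k * (x ^ k * y ^ j)) = (\<Sum>k<m. if k = Suc i then x ^ k * y ^ j else 0)"
        by (intro sum.cong refl) (simp add: cc_def)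
      then show ?thesis using True by simp
    qed
    finally show ?thesis unfolding ij v_def by (simp only: prod.case power_Suc mult.assoc)
  qed
  have Y: "y * v a = (\<Sum>b\<in>I. MY a b * v b)" if a: "a \<in> I" for a
  proof -
    obtain i j where ij: "a = (i,j)" "i < m" "j < n" using a unfolding I_def by blast
    have "(\<Sum>b\<in>I. MY a b * v b) = (\<Sum>k<m. \<Sum>l<n. MY (i,j) (k,l) * v (k,l))"
      unfolding I_def ij sum.cartesian_product by (rule sum.cong) auto
    also have "\<dots> = (\<Sum>l<n. \<Sum>k<m. MY (i,j) (k,l) * v (k,l))" by (rule sum.swap)
    also have "\<dots> = (\<Sum>l<n. \<Sum>k<m. if k = i then dd j l * (x ^ i * y ^ l) else 0)"
      by (intro sum.cong refl) (simp add: MY_def v_def)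
    also have "\<dots> = (\<Sum>l<n. dd j l * (x ^ i * y ^ l))" using ij by simp
    also have "\<dots> = x ^ i * y ^ Suc j"
    proof (cases "Suc j < n")
      case False
      then have "Suc j = n" using ij by simp
      then have "y ^ Suc j = (\<Sum>k<n. d k * y ^ k)" using yn by simp
      then show ?thesis using False by (simp add: dd_def sum_distrib_left mult.left_commute)
    next
      case True
      then have "(\<Sum>l<n. dd j l * (x ^ i * y ^ l)) = (\<Sum>l<n. if l = Suc j then x ^ i * y ^ l else 0)"
        by (intro sum.cong refl) (simp add: dd_def)
      then show ?thesis using True by simp
    qed
    finally show ?thesis unfolding ij v_def by (simp only: prod.case power_Suc mult.left_commute)
  qed
  note eigen = integral_over_eigen[where I = I and v = v and ?i0.0 = "(0,0)", OF R fin i0]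
  show "integral_over R (x + y)"
  proof (rule eigen[where M = "\<lambda>a b. MX a b + MY a b"])
    fix a assume a: "a \<in> I"
    show "(x + y) * v a = (\<Sum>b\<in>I. (MX a b + MY a b) * v b)"
      by (simp only: distrib_right X[OF a] Y[OF a] sum.distrib)
  qed (rule is_subringD(3)[OF R MXR MYR])
  show "integral_over R (x * y)"
  proof (rule eigen[where M = "\<lambda>a b. \<Sum>e\<in>I. MY a e * MX e b"])
    fix a assume a: "a \<in> I"
    have "x * y * v a = (\<Sum>e\<in>I. MY a e * (x * v e))"
      unfolding mult.assoc Y[OF a] sum_distrib_left by (simp only: mult.left_commute)
    also have "\<dots> = (\<Sum>e\<in>I. \<Sum>b\<in>I. MY a e * MX e b * v b)"
      by (intro sum.cong) (auto simp: X sum_distrib_left mult.assoc)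
    also have "\<dots> = (\<Sum>b\<in>I. (\<Sum>e\<in>I. MY a e * MX e b) * v b)"
      by (subst sum.swap) (simp add: sum_distrib_right)
    finally show "x * y * v a = (\<Sum>b\<in>I. (\<Sum>e\<in>I. MY a e * MX e b) * v b)" .
  qed (auto intro!: is_subring_sum[OF R] is_subringD(4)[OF R] MXR MYR)
qed

lemma is_subring_integral_closure:
  assumes "is_subring R" shows "is_subring {x. integral_over R x}"
proof -
  have "integral_over R (- x)" if "integral_over R x" for x
    using integral_over_add_mult(2)[OF assms integral_over_base[OF assms, of "-1"] that] is_subringD[OF assms] by simp
  then show ?thesis unfolding is_subring_def
    using assms integral_over_add_mult[OF assms] by (auto intro: integral_over_base is_subringD)
qed

text \<open>Multiplying the integral equation of \<open>1 / a\<close> of degree \<open>m\<close> by \<open>a\<^sup>m\<^sup>-\<^sup>1\<close> expresses \<open>1 / a\<close>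
  through elements of the ring.\<close>

lemma integral_over_inverse:
  assumes R: "is_subring R" and a: "a \<in> R" "a \<noteq> 0" and int: "integral_over R (inverse a)"
  shows "inverse a \<in> R"
proof -
  obtain m c where m: "m > 0" and c: "\<And>i. c i \<in> R" and e: "inverse a ^ m = (\<Sum>i<m. c i * inverse a ^ i)"
    by (rule integral_over_power_expansion[OF R int]) blast
  have "inverse a = a ^ (m - 1) * inverse a ^ m"
    using m a(2) by (cases m) (auto simp: field_simps)
  also have "\<dots> = (\<Sum>i<m. c i * (a ^ (m - 1) * inverse a ^ i))"
    unfolding e by (simp add: sum_distrib_left mult.left_commute)
  also have "\<dots> = (\<Sum>i<m. c i * a ^ (m - 1 - i))"
  proof (intro sum.cong refl arg_cong2[where f = "(*)"])
    fix i assume "i \<in> {..<m}"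
    then have "a ^ (m - 1) = a ^ (m - 1 - i) * a ^ i" by (simp add: power_add[symmetric])
    moreover have "a ^ i * inverse a ^ i = 1" using a(2) by (simp add: power_mult_distrib[symmetric])
    ultimately show "a ^ (m - 1) * inverse a ^ i = a ^ (m - 1 - i)" by (simp add: mult.assoc)
  qed
  also have "\<dots> \<in> R" by (intro is_subring_sum[OF R] is_subringD(4)[OF R] c is_subring_power[OF R a(1)])
  finally show ?thesis .
qed

text \<open>For \<open>u / v\<close> in lowest terms a Bezout identity puts the inverse of each prime divisor \<open>p\<close> of
  \<open>v\<close> into the ring, so \<open>p\<close> does not divide \<open>D\<close>. Then \<open>D\<^sup>k u / p\<close> is integral over \<open>\<int>\<close> in
  lowest terms, and the same argument makes \<open>1 / p\<close> an integer.\<close>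

lemma rational_denominator_in_subring:
  fixes R :: "'k::field_char_0 set"
  assumes R: "is_subring R" and x: "x \<in> \<rat>" "x \<in> R" and no: "\<And>p. Factorial_Ring.prime p \<Longrightarrow> p dvd D \<Longrightarrow> inverse (of_nat p) \<notin> R"
    and D: "D > 0" and int: "integral_over \<int> (of_nat D ^ k * x)"
  shows "x \<in> \<int>"
proof -
  obtain u v :: int where uv: "v > 0" "coprime u v" "x = of_int u / of_int v"
    using x(1) by (metis Rats_cases' coprime_commute)
  have key: "inverse (of_nat p) \<in> R'" if R': "is_subring R'" and yR: "of_int a / of_int b \<in> R'"
      and ab: "coprime a b" "b \<noteq> 0" and p: "int p dvd b" for R' :: "'k set" and a b :: int and p :: nat
  proof -
    obtain s t where st: "s * a + t * b = 1" using ab(1) by (metis bezout_int coprime_iff_gcd_eq_1 mult.commute)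
    obtain w where w: "b = int p * w" using p by blast
    have eq: "inverse (of_int b) = (of_int s * (of_int a / of_int b) + of_int t :: 'k)"
    proof -
      have "(of_int s * (of_int a / of_int b) + of_int t :: 'k) = of_int (s * a + t * b) / of_int b"
        using ab(2) by (simp add: field_simps)
      then show ?thesis using st by (simp add: divide_inverse)
    qed
    have bR: "inverse (of_int b :: 'k) \<in> R'"
      by (subst eq) (intro is_subringD(3,4)[OF R'] is_subring_of_int[OF R'] yR)
    have "int p \<noteq> 0" "w \<noteq> 0" using w ab(2) by auto
    then have "(of_nat p :: 'k) \<noteq> 0" "(of_int w :: 'k) \<noteq> 0" by auto
    then have "inverse (of_nat p) = (of_int w * inverse (of_int b) :: 'k)" unfolding w by simp
    moreover have "of_int w * inverse (of_int b) \<in> R'" by (intro is_subringD(4)[OF R'] is_subring_of_int[OF R'] bR)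
    ultimately show ?thesis by simp
  qed
  have Z: "is_subring (\<int> :: 'k set)" by (auto simp: is_subring_def)
  have "v = 1"
  proof (rule ccontr)
    assume "v \<noteq> 1"
    then have "nat v \<noteq> 1" using uv(1) by linarith
    then obtain p where p: "Factorial_Ring.prime p" "p dvd nat v" using prime_factor_nat by blast
    have pp: "Factorial_Ring.prime (int p)" using p(1) by simp
    have "int p dvd int (nat v)" using p(2) by (simp only: int_dvd_int_iff)
    then have pv: "int p dvd v" using uv(1) by simp
    have xR: "of_int u / of_int v \<in> R" "v \<noteq> 0" using uv x(2) by auto
    have "inverse (of_nat p) \<in> R" by (rule key[OF R xR(1) uv(2) xR(2) pv])
    then have "\<not> p dvd D" using no[OF p(1)] by blast
    then have "\<not> int p dvd int D" by (simp only: int_dvd_int_iff not_False_eq_True)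
    then have pD: "\<not> int p dvd int D ^ k" using prime_dvd_power[OF pp] by blast
    have npu: "\<not> int p dvd u"
    proof
      assume "int p dvd u"
      then have "is_unit (int p)" using pv uv(2) coprime_common_divisor by blast
      then show False using pp not_prime_unit by blast
    qed
    define a where "a = int D ^ k * u"
    have "\<not> int p dvd a" unfolding a_def using pD npu prime_dvd_mult_iff[OF pp] by blast
    then have "coprime (int p) a" using prime_imp_coprime[OF pp] by blast
    obtain w where w: "v = int p * w" using pv by blast
    have "of_int a / of_int (int p) = (of_int w * (of_nat D ^ k * x) :: 'k)"
    proof -
      have "w \<noteq> 0" using w xR(2) by (metis mult_zero_right)
      then have w0: "(of_int w :: 'k) \<noteq> 0" by simp
      have "of_int w * (of_nat D ^ k * x) = of_int w * (of_nat D ^ k * of_int u) / (of_int (int p) * of_int w)"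
        unfolding uv(3) w of_int_mult by (simp only: times_divide_eq_right)
      also have "\<dots> = (of_nat D ^ k * of_int u) / of_int (int p)"
        using w0 by (simp only: mult.commute[of _ "of_int w"] mult_divide_mult_cancel_left not_False_eq_True if_True)
      finally show ?thesis unfolding a_def by simp
    qed
    moreover have "integral_over \<int> (of_int w * (of_nat D ^ k * x) :: 'k)"
      using integral_over_add_mult(2)[OF Z integral_over_base[OF Z, of "of_int w"] int] by simp
    ultimately have "integral_over \<int> (of_int a / of_int (int p) :: 'k)" by (simp only:)
    then have i: "of_int a / of_int (int p) \<in> {x :: 'k. integral_over \<int> x}" by simp
    have c: "coprime a (int p)" "int p \<noteq> 0"
      using \<open>coprime (int p) a\<close> pp by (auto simp: coprime_commute)
    have "integral_over \<int> (inverse (of_nat p :: 'k))"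
      using key[OF is_subring_integral_closure[OF Z] i c dvd_refl] by (simp only: mem_Collect_eq)
    then have "inverse (of_nat p :: 'k) \<in> \<int>"
    proof (rule integral_over_inverse[OF Z Ints_of_nat, rotated])
      have "int p \<noteq> 0" using pp by auto
      then show "(of_nat p :: 'k) \<noteq> 0" by simp
    qed
    then obtain z where z: "inverse (of_nat p :: 'k) = of_int z" by (auto elim: Ints_cases)
    have "int p \<noteq> 0" using pp by auto
    then have "(of_nat p :: 'k) \<noteq> 0" by simp
    then have "(of_nat p :: 'k) * of_int z = 1" unfolding z[symmetric] by (rule right_inverse)
    then have "(of_int (int p * z) :: 'k) = of_int 1" by (simp only: of_int_mult of_int_of_nat_eq of_int_1)
    then have "int p * z = 1" by (simp only: of_int_eq_iff)
    then have "is_unit (int p)" by (metis dvd_triv_left)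
    then show False using pp not_prime_unit by blast
  qed
  then show ?thesis using uv by simp
qed

lemma integral_over_mono: "integral_over R x \<Longrightarrow> R \<subseteq> S \<Longrightarrow> integral_over S x"
  unfolding integral_over_def by blast

lemma Ints_subset_subring: "is_subring R \<Longrightarrow> \<int> \<subseteq> R"
  by (auto elim!: Ints_cases intro: is_subring_of_int)

lemma is_subring_Ints: "is_subring \<int>"
  by (auto simp: is_subring_def)

lemma rational_integral_is_integer:
  fixes x :: "'k::field_char_0"
  assumes "x \<in> \<rat>" "integral_over \<int> x" shows "x \<in> \<int>"
proof (rule rational_denominator_in_subring[where D = 1 and k = 0, OF is_subring_integral_closure[OF is_subring_Ints]])
qed (use assms in auto)

section \<open>Roots of unity and Ramanujan sums\<close>

definition primroot :: "nat \<Rightarrow> 'k::field \<Rightarrow> bool" where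
  "primroot n z \<longleftrightarrow> n > 0 \<and> (\<forall>k. z ^ k = 1 \<longleftrightarrow> n dvd k)"

lemma power_gcd_eq_1:
  fixes z :: "'k::field"
  assumes "z ^ a = 1" "z ^ b = 1" shows "z ^ gcd a b = 1"
proof (cases "a = 0")
  case False
  then obtain x y where "a * x = b * y + gcd a b" using bezout_nat[of a b] by blast
  then have "(z ^ a) ^ x = (z ^ b) ^ y * z ^ gcd a b" by (metis power_add power_mult)
  then show ?thesis using assms by simp
qed (use assms in auto)

text \<open>A \<open>p\<^sup>a\<close>-th root of a root of \<open>1 + X + \<dots> + X\<^sup>p\<^sup>-\<^sup>1\<close> has exact order \<open>p\<^sup>a\<^sup>+\<^sup>1\<close>: otherwise the
  root would be 1, where this polynomial takes the value \<open>p\<close>, which is nonzero in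
  characteristic zero.\<close>

lemma primroot_prime_power:
  fixes p :: nat
  assumes p: "Factorial_Ring.prime p"
  shows "\<exists>z :: 'k::{alg_closed_field, field_char_0}. primroot (p ^ Suc a) z"
proof -
  (* The cyclotomic polynomial of p. *)
  define P :: "'k poly" where "P = (\<Sum>i<p. monom 1 i)"
  have p1: "p > 1" using p prime_gt_1_nat by blast
  have "coeff P 1 = 1" using p1 by (simp add: P_def coeff_sum)
  then have "degree P > 0" using le_degree[of P 1] by (simp add: Suc_le_eq)
  then obtain w where w: "poly P w = 0" using alg_closed_imp_poly_has_root by blast
  then have sw: "(\<Sum>i<p. w ^ i) = 0" by (simp add: P_def poly_sum poly_monom)
  have w1: "w \<noteq> 1" using sw p1 by auto
  have wp: "w ^ p = 1" using sw w1 geometric_sum[OF w1, of p] by simp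
  obtain z where z: "z ^ (p ^ a) = w" using nth_root_exists[of "p ^ a" w] p1 by auto
  have zp: "z ^ (p ^ Suc a) = 1" unfolding power_Suc2 power_mult z by (rule wp)
  have "z ^ k = 1 \<longleftrightarrow> p ^ Suc a dvd k" for k
  proof
    assume k: "z ^ k = 1"
    have g: "z ^ gcd k (p ^ Suc a) = 1" by (rule power_gcd_eq_1[OF k zp])
    obtain b where b: "b \<le> Suc a" "gcd k (p ^ Suc a) = p ^ b"
      using divides_primepow_nat[OF p, of "gcd k (p ^ Suc a)" "Suc a"] by auto
    show "p ^ Suc a dvd k"
    proof (cases "b = Suc a")
      case True
      then show ?thesis using b gcd_dvd1 by metis
    next
      case False
      then have "p ^ b dvd p ^ a" using b by (intro le_imp_power_dvd) simp
      then obtain e where "p ^ a = p ^ b * e" by blast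
      then have "w = 1" using z g b by (simp add: power_mult)
      then show ?thesis using w1 by simp
    qed
  next
    assume "p ^ Suc a dvd k"
    then obtain e where "k = p ^ Suc a * e" by blast
    then show "z ^ k = 1" using zp by (simp only: power_mult power_one)
  qed
  then show ?thesis unfolding primroot_def using p1 by (intro exI[of _ z]) auto
qed

lemma primroot_mult:
  assumes u: "primroot u x" and v: "primroot v y" and cop: "coprime u v"
  shows "primroot (u * v) (x * y)"
proof -
  have xu: "x ^ k = 1 \<longleftrightarrow> u dvd k" and yv: "y ^ k = 1 \<longleftrightarrow> v dvd k" for k using u v by (auto simp: primroot_def)
  have "(x * y) ^ k = 1 \<longleftrightarrow> u * v dvd k" for k
  proof
    assume k: "(x * y) ^ k = 1"
    have "x ^ (k * v) * y ^ (k * v) = 1" using k by (simp add: power_mult power_mult_distrib[symmetric])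
    moreover have "y ^ (k * v) = 1" by (simp add: yv)
    ultimately have "u dvd k * v" by (simp add: xu[symmetric])
    then have 1: "u dvd k" using cop coprime_dvd_mult_left_iff by blast
    have "x ^ (k * u) * y ^ (k * u) = 1" using k by (simp add: power_mult power_mult_distrib[symmetric])
    moreover have "x ^ (k * u) = 1" by (simp add: xu)
    ultimately have "v dvd k * u" by (simp add: yv[symmetric])
    then have "v dvd k" using cop coprime_dvd_mult_left_iff coprime_commute by blast
    with 1 show "u * v dvd k" using cop by (simp add: divides_mult)
  next
    assume "u * v dvd k"
    then have "u dvd k" "v dvd k" by (auto elim: dvd_mult_left dvd_mult_right)
    then show "(x * y) ^ k = 1" by (simp add: power_mult_distrib xu[symmetric] yv[symmetric])
  qed
  then show ?thesis using u v by (auto simp: primroot_def)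
qed

lemma exists_primroot:
  assumes "n > 0" shows "\<exists>z :: 'k::{alg_closed_field, field_char_0}. primroot n z"
  using assms
proof (induction n rule: less_induct)
  case (less n)
  show ?case
  proof (cases "n = 1")
    case True
    then show ?thesis by (intro exI[of _ 1]) (simp add: primroot_def)
  next
    case False
    then obtain p where p: "Factorial_Ring.prime p" "p dvd n" using prime_factor_nat by blast
    obtain m where m: "n = p ^ multiplicity p n * m" "\<not> p dvd m"
      using multiplicity_decompose'[of n p] less.prems p by (metis bot_nat_0.not_eq_extremum not_prime_unit)
    have "multiplicity p n > 0" using p less.prems prime_multiplicity_gt_zero_iff by (metis not_gr0 prime_imp_prime_elem prime_elem_multiplicity_eq_zero_iff)
    then obtain a where a: "multiplicity p n = Suc a" by (cases "multiplicity p n") auto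
    have m0: "m > 0" using m(1) less.prems by (cases m) auto
    have "p ^ Suc a > 1" using p prime_gt_1_nat by (metis one_less_power zero_less_Suc)
    then have "m < n" using m(1) m0 a by (metis One_nat_def mult.commute n_less_m_mult_n)
    then obtain y :: 'k where y: "primroot m y" using less.IH m0 by blast
    obtain x :: 'k where x: "primroot (p ^ Suc a) x" using primroot_prime_power[OF p(1)] by blast
    have "coprime (p ^ Suc a) m" using p(1) m(2) prime_imp_coprime by (metis coprime_power_left_iff)
    from primroot_mult[OF x y this] show ?thesis using m(1) a by auto
  qed
qed

lemma primroot_sum:
  assumes z: "primroot n z"
  shows "(\<Sum>t<n. z ^ (t * m)) = (if n dvd m then of_nat n else 0)"
proof (cases "n dvd m")
  case True
  then have "z ^ (t * m) = 1" for t using z by (simp add: primroot_def)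
  then show ?thesis using True by simp
next
  case False
  then have "z ^ m \<noteq> 1" using z by (simp add: primroot_def)
  then have "(\<Sum>t<n. (z ^ m) ^ t) = ((z ^ m) ^ n - 1) / (z ^ m - 1)" by (rule geometric_sum)
  also have "(z ^ m) ^ n = 1" using z by (simp add: primroot_def power_mult[symmetric])
  finally show ?thesis using False by (simp add: power_mult[symmetric] mult.commute)
qed

definition units_mod :: "nat \<Rightarrow> nat set" where "units_mod n = {t. t < n \<and> coprime t n}"

lemma finite_units_mod [simp]: "finite (units_mod n)" by (simp add: units_mod_def)

lemma gcd_fibre:
  assumes "n > 0" "d dvd n"
  shows "{t. t < n \<and> gcd t n = d} = (*) d ` units_mod (n div d)"
proof -
  obtain e where e: "n = d * e" using assms(2) by blast
  have d0: "d > 0" using e assms(1) by (cases d) auto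
  then have ne: "n div d = e" using e by simp
  show ?thesis unfolding ne
  proof (intro equalityI subsetI)
    fix t assume "t \<in> {t. t < n \<and> gcd t n = d}"
    then have t: "t < n" "gcd t n = d" by auto
    then obtain s where s: "t = d * s" by (metis gcd_dvd1 dvdE)
    have "d * gcd s e = d" using t(2) unfolding s e by (simp add: gcd_mult_distrib_nat)
    then have "coprime s e" using d0 by (simp add: coprime_iff_gcd_eq_1)
    then show "t \<in> (*) d ` units_mod e" using t(1) d0 by (auto simp: s e units_mod_def)
  next
    fix t assume "t \<in> (*) d ` units_mod e"
    then obtain s where s: "t = d * s" "s < e" "coprime s e" by (auto simp: units_mod_def)
    then have "gcd t n = d" unfolding e s(1) by (metis coprime_iff_gcd_eq_1 gcd_mult_distrib_nat mult.right_neutral)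
    then show "t \<in> {t. t < n \<and> gcd t n = d}" using s d0 by (simp add: e)
  qed
qed

text \<open>Sorting the full sum over all residues by their gcd with \<open>n\<close> leaves, apart from the sum in
  question, Ramanujan sums for proper divisors of \<open>n\<close>.\<close>

lemma ramanujan_sum_Ints:
  fixes z :: "'k::field"
  assumes "primroot n z" shows "(\<Sum>t\<in>units_mod n. z ^ (t * m)) \<in> \<int>"
  using assms
proof (induction n arbitrary: z rule: less_induct)
  case (less n)
  have n0: "n > 0" using less.prems by (simp add: primroot_def)
  define S where "S d = (\<Sum>t\<in>{t. t < n \<and> gcd t n = d}. z ^ (t * m))" for d
  have "(\<Sum>t<n. z ^ (t * m)) = (\<Sum>d\<in>{d. d dvd n}. S d)"
    unfolding S_def using n0 by (subst sum.group[of "{..<n}" "{d. d dvd n}" "\<lambda>t. gcd t n", symmetric]) auto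
  also have "\<dots> = S 1 + (\<Sum>d\<in>{d. d dvd n} - {1}. S d)"
    using n0 by (intro sum.remove) auto
  finally have "S 1 = (\<Sum>t<n. z ^ (t * m)) - (\<Sum>d\<in>{d. d dvd n} - {1}. S d)" by simp
  moreover have "S d \<in> \<int>" if d: "d \<in> {d. d dvd n} - {1}" for d
  proof -
    obtain e where e: "n = d * e" using d by blast
    have d0: "d > 1" using e d n0 by (cases "d = 0") auto
    then have ne: "n div d = e" and en: "e < n" using e n0 by auto
    have "S d = (\<Sum>s\<in>units_mod e. z ^ (d * s * m))"
      unfolding S_def gcd_fibre[OF n0 conjunct1[OF d[unfolded Diff_iff mem_Collect_eq]]] ne
      using d0 by (subst sum.reindex) (auto simp: inj_on_def)
    also have "\<dots> = (\<Sum>s\<in>units_mod e. (z ^ d) ^ (s * m))" by (simp add: power_mult[symmetric] mult.assoc)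
    also have "primroot e (z ^ d)" using less.prems d0 unfolding primroot_def e by (auto simp: power_mult[symmetric])
    then have "(\<Sum>s\<in>units_mod e. (z ^ d) ^ (s * m)) \<in> \<int>" by (rule less.IH[OF en])
    finally show ?thesis .
  qed
  ultimately have "S 1 \<in> \<int>" by (auto simp: primroot_sum[OF less.prems] intro!: Ints_diff Ints_sum)
  then show ?case by (simp add: S_def units_mod_def coprime_iff_gcd_eq_1 conj_commute)
qed

section \<open>Rational polynomials at roots of unity\<close>

text \<open>Relations that hold at a root of unity in an arbitrary field of characteristic zero are
  moved to the complex numbers through rational polynomials, which can be evaluated in both.\<close>

definition rpoly :: "rat poly \<Rightarrow> 'k::field_char_0 \<Rightarrow> 'k" where
  "rpoly q x = poly (map_poly of_rat q) x"

lemma rpoly_altdef: "rpoly q x = (\<Sum>i\<le>degree q. of_rat (coeff q i) * x ^ i)"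
  by (simp add: rpoly_def poly_altdef degree_map_poly coeff_map_poly)

lemma map_poly_of_rat_mult:
  "map_poly of_rat (p * q) = (map_poly of_rat p * map_poly of_rat q :: 'k::field_char_0 poly)"
  by (rule poly_eqI) (simp add: coeff_map_poly coeff_mult of_rat_sum of_rat_mult)

lemma rpoly_const [simp]: "rpoly [:c:] x = of_rat c" by (simp add: rpoly_altdef)
lemma rpoly_monom: "rpoly (monom c n) x = of_rat c * x ^ n" by (simp add: rpoly_def map_poly_monom poly_monom)
lemma rpoly_0 [simp]: "rpoly 0 x = 0" by (simp add: rpoly_def)
lemma rpoly_1 [simp]: "rpoly 1 x = 1" using rpoly_const[of 1 x] by (simp add: one_pCons)
lemma rpoly_add [simp]: "rpoly (p + q) x = rpoly p x + rpoly q x"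
  unfolding rpoly_def poly_add[symmetric] by (rule arg_cong[where f = "\<lambda>p. poly p x"], rule poly_eqI) (simp add: coeff_map_poly of_rat_add)
lemma rpoly_minus [simp]: "rpoly (- p) x = - rpoly p x"
  using rpoly_add[of p "- p" x] by (simp add: eq_neg_iff_add_eq_0 add.commute)
lemma rpoly_diff [simp]: "rpoly (p - q) x = rpoly p x - rpoly q x"
  using rpoly_add[of p "- q" x] by simp
lemma rpoly_mult [simp]: "rpoly (p * q) x = rpoly p x * rpoly q x"
  unfolding rpoly_def by (simp add: map_poly_of_rat_mult)
lemma rpoly_sum: "rpoly (\<Sum>i\<in>A. f i) x = (\<Sum>i\<in>A. rpoly (f i) x)"
  by (induction A rule: infinite_finite_induct) auto
lemma rpoly_prod: "rpoly (\<Prod>i\<in>A. f i) x = (\<Prod>i\<in>A. rpoly (f i) x)"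
  by (induction A rule: infinite_finite_induct) auto
lemma rpoly_pCons: "rpoly (pCons a p) x = of_rat a + x * rpoly p x"
  by (cases "a = 0 \<and> p = 0") (auto simp: rpoly_def map_poly_pCons)
lemma rpoly_pcompose: "rpoly (pcompose p q) x = rpoly p (rpoly q x)"
  by (induction p) (auto simp: pcompose_pCons rpoly_pCons)
lemma cnj_of_rat: "cnj (of_rat r) = of_rat r"
  by (cases r) (simp add: of_rat_rat)

lemma rpoly_cnj: "rpoly q (cnj x) = cnj (rpoly q x)"
  by (simp add: rpoly_altdef)
     (rule sum.cong, simp_all add: cnj_of_rat)

lemma minimal_rational_poly:
  fixes x :: "'k::field_char_0"
  assumes "P \<noteq> 0" "rpoly P x = 0"
  obtains f where "f \<noteq> 0" "degree f > 0" "\<And>q. rpoly q x = 0 \<longleftrightarrow> f dvd q"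
proof -
  define d where "d = (LEAST d. \<exists>f. f \<noteq> 0 \<and> rpoly f x = 0 \<and> degree f = d)"
  have "\<exists>f. f \<noteq> 0 \<and> rpoly f x = 0 \<and> degree f = d" unfolding d_def by (rule LeastI_ex) (use assms in blast)
  then obtain f where f: "f \<noteq> 0" "rpoly f x = 0" "degree f = d" by blast
  have min: "d \<le> degree g" if "g \<noteq> 0" "rpoly g x = 0" for g unfolding d_def by (rule Least_le) (use that in blast)
  have "degree f > 0"
  proof (rule ccontr)
    assume "\<not> 0 < degree f"
    then obtain c where "f = [:c:]" by (auto elim: degree_eq_zeroE)
    then show False using f by simp
  qed
  moreover have "rpoly q x = 0 \<longleftrightarrow> f dvd q" for q
  proof
    assume q: "rpoly q x = 0"
    have "rpoly (q mod f) x = 0" using q f by (simp add: minus_div_mult_eq_mod[symmetric])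
    then have "q mod f = 0" using min[of "q mod f"] degree_mod_less[OF f(1), of q] f(3) by force
    then show "f dvd q" by (simp add: dvd_eq_mod_eq_0)
  qed (use f in \<open>auto elim!: dvdE\<close>)
  ultimately show thesis using that f by blast
qed

text \<open>A complex root of the minimal polynomial of \<open>x\<close>. This replaces an embedding of \<open>\<rat>(x)\<close> into
  the complex numbers.\<close>

lemma complex_conjugate_point:
  fixes x :: "'k::field_char_0"
  assumes "P \<noteq> 0" "rpoly P x = 0"
  obtains y :: complex where "\<And>q. rpoly q x = 0 \<longleftrightarrow> rpoly q y = 0"
proof -
  obtain f where f: "f \<noteq> 0" "degree f > 0" "\<And>q. rpoly q x = 0 \<longleftrightarrow> f dvd q"
    using minimal_rational_poly[OF assms] by metis
  have "degree (map_poly of_rat f :: complex poly) > 0" using f(2) by (simp add: degree_map_poly)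
  then obtain y :: complex where y: "rpoly f y = 0"
    unfolding rpoly_def using alg_closed_imp_poly_has_root by blast
  obtain h where h: "h \<noteq> 0" "degree h > 0" "\<And>q. rpoly q y = 0 \<longleftrightarrow> h dvd q"
    using minimal_rational_poly[OF f(1) y] by metis
  obtain e where e: "f = h * e" using h(3) y by (auto elim: dvdE)
  then have e0: "e \<noteq> 0" and "degree e < degree f" using f(1) h by (auto simp: degree_mult_eq)
  then have "\<not> f dvd e" using dvd_imp_degree_le by (metis not_le)
  moreover have "rpoly h x * rpoly e x = 0" using f(3)[of f] e by (metis dvd_refl rpoly_mult)
  ultimately have "f dvd h" using f(3) by (metis mult_eq_0_iff)
  then show thesis using that[of y] f(3) h(3) e by (metis dvd_trans dvd_triv_left)
qed

text \<open>The product of the nonzero \<open>V s\<close> is one of the elementary symmetric functions, hence a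
  nonzero integer, so the logarithms of their absolute values have a nonnegative sum. With \<open>r
  = |V s|\<close>, each term is at least \<open>r\<^sup>2 - r \<ge> ln r + (r - 1)\<^sup>2\<close>, so a vanishing sum forces \<open>r =
  1\<close> and real part 1.\<close>

lemma integral_symmetric_functions_bound:
  fixes V :: "nat \<Rightarrow> complex"
  assumes fin: "finite T" and e: "\<And>k. (\<Sum>A\<in>{A. A \<subseteq> T \<and> card A = k}. \<Prod>s\<in>A. V s) \<in> \<int>"
  shows "(\<Sum>s\<in>T. (cmod (V s))\<^sup>2 - Re (V s)) \<ge> 0"
    and "(\<Sum>s\<in>T. (cmod (V s))\<^sup>2 - Re (V s)) = 0 \<Longrightarrow> s \<in> T \<Longrightarrow> V s \<in> {0, 1}"
proof -
  define N where "N = {s \<in> T. V s \<noteq> 0}"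
  have finN: "finite N" using fin by (simp add: N_def)
  have "(\<Sum>A\<in>{A. A \<subseteq> T \<and> card A = card N}. \<Prod>s\<in>A. V s) = (\<Sum>A\<in>{N}. \<Prod>s\<in>A. V s)"
  proof (rule sum.mono_neutral_right)
    show "\<forall>A\<in>{A. A \<subseteq> T \<and> card A = card N} - {N}. (\<Prod>s\<in>A. V s) = 0"
    proof
      fix A assume A: "A \<in> {A. A \<subseteq> T \<and> card A = card N} - {N}"
      then have "\<not> A \<subseteq> N" using card_subset_eq[OF finN] by blast
      then obtain s where "s \<in> A" "V s = 0" using A by (auto simp: N_def)
      moreover have "finite A" using A fin finite_subset by auto
      ultimately show "(\<Prod>s\<in>A. V s) = 0" by (metis prod_zero)
    qed
  qed (use fin in \<open>auto simp: N_def\<close>)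
  then have "(\<Prod>s\<in>N. V s) \<in> \<int>" using e[of "card N"] by simp
  then obtain z :: int where z: "(\<Prod>s\<in>N. V s) = of_int z" by (auto elim: Ints_cases)
  moreover have "(\<Prod>s\<in>N. V s) \<noteq> 0" using finN by (auto simp: N_def)
  ultimately have "z \<noteq> 0" by auto
  then have "1 \<le> cmod (\<Prod>s\<in>N. V s)" unfolding z by simp
  then have "0 \<le> ln (\<Prod>s\<in>N. cmod (V s))" by (simp add: prod_norm)
  also have "ln (\<Prod>s\<in>N. cmod (V s)) = (\<Sum>s\<in>N. ln (cmod (V s)))"
    by (rule ln_prod[OF finN]) (auto simp: N_def)
  finally have ln: "0 \<le> (\<Sum>s\<in>N. ln (cmod (V s)))" .
  have pt: "ln (cmod (V s)) + (cmod (V s) - 1)\<^sup>2 \<le> (cmod (V s))\<^sup>2 - Re (V s)" if "s \<in> N" for s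
  proof -
    have "ln (cmod (V s)) \<le> cmod (V s) - 1" using that by (intro ln_le_minus_one) (simp add: N_def)
    moreover have "Re (V s) \<le> cmod (V s)" by (rule complex_Re_le_cmod)
    ultimately show ?thesis by (simp add: power2_eq_square algebra_simps)
  qed
  have NT: "(\<Sum>s\<in>T. (cmod (V s))\<^sup>2 - Re (V s)) = (\<Sum>s\<in>N. (cmod (V s))\<^sup>2 - Re (V s))"
    using fin by (intro sum.mono_neutral_right) (auto simp: N_def)
  have le: "(\<Sum>s\<in>N. (cmod (V s) - 1)\<^sup>2) \<le> (\<Sum>s\<in>T. (cmod (V s))\<^sup>2 - Re (V s))"
    using ln sum_mono[OF pt, of N "\<lambda>s. s"] unfolding NT by (simp add: sum.distrib)
  then show "(\<Sum>s\<in>T. (cmod (V s))\<^sup>2 - Re (V s)) \<ge> 0"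
    using sum_nonneg[of N "\<lambda>s. (cmod (V s) - 1)\<^sup>2"] by simp
  show "V s \<in> {0, 1}" if z: "(\<Sum>s\<in>T. (cmod (V s))\<^sup>2 - Re (V s)) = 0" and s: "s \<in> T" for s
  proof (cases "s \<in> N")
    case True
    have "(\<Sum>s\<in>N. (cmod (V s) - 1)\<^sup>2) = 0" using le z sum_nonneg[of N "\<lambda>s. (cmod (V s) - 1)\<^sup>2"] by simp
    then have one: "cmod (V s) = 1" if "s \<in> N" for s
      using that finN by (subst (asm) sum_nonneg_eq_0_iff) auto
    have "(\<Sum>s\<in>N. 1 - Re (V s)) = 0" using z unfolding NT by (simp add: one)
    moreover have "0 \<le> 1 - Re (V s)" if "s \<in> N" for s using complex_Re_le_cmod[of "V s"] one[OF that] by simp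
    ultimately have "Re (V s) = 1" using True finN by (subst (asm) sum_nonneg_eq_0_iff) auto
    then have "V s = 1" using one[OF True] by (simp add: complex_eq_iff cmod_def)
    then show ?thesis by simp
  qed (use s in \<open>auto simp: N_def\<close>)
qed

lemma one_in_units_mod: "n > 1 \<Longrightarrow> 1 \<in> units_mod n" by (simp add: units_mod_def)

text \<open>The average over all conjugates is a rational combination of Ramanujan sums.\<close>

lemma invariant_value_rational:
  fixes \<zeta> :: "'k::field_char_0"
  assumes z: "primroot n \<zeta>" and n: "n > 1" and inv: "\<And>t. t \<in> units_mod n \<Longrightarrow> rpoly P (\<zeta> ^ t) = c"
  shows "c \<in> \<rat>"
proof -
  have "of_nat (card (units_mod n)) * c = (\<Sum>t\<in>units_mod n. rpoly P (\<zeta> ^ t))" by (simp add: inv)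
  also have "\<dots> = (\<Sum>t\<in>units_mod n. \<Sum>i\<le>degree P. of_rat (coeff P i) * \<zeta> ^ (t * i))"
    by (simp add: rpoly_altdef power_mult[symmetric])
  also have "\<dots> = (\<Sum>i\<le>degree P. of_rat (coeff P i) * (\<Sum>t\<in>units_mod n. \<zeta> ^ (t * i)))"
    by (subst sum.swap) (simp add: sum_distrib_left)
  also have "\<dots> \<in> \<rat>"
    by (rule Rats_sum, rule Rats_mult, simp, rule subsetD[OF Ints_subset_Rats ramanujan_sum_Ints[OF z]])
  finally have r: "of_nat (card (units_mod n)) * c \<in> \<rat>" .
  have "card (units_mod n) \<noteq> 0" using one_in_units_mod[OF n] finite_units_mod[of n] by (auto simp: card_eq_0_iff)
  then have "c = of_nat (card (units_mod n)) * c / of_nat (card (units_mod n))" by simp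
  then show ?thesis using r by (metis Rats_divide Rats_of_nat)
qed

lemma bij_units_mod_mult:
  assumes n: "n > 1" and t: "t \<in> units_mod n"
  shows "bij_betw (\<lambda>s. (t * s) mod n) (units_mod n) (units_mod n)"
proof -
  have cop: "coprime t n" using t by (simp add: units_mod_def)
  have inj: "inj_on (\<lambda>s. (t * s) mod n) (units_mod n)"
  proof (rule inj_onI)
    fix a b assume ab: "a \<in> units_mod n" "b \<in> units_mod n" and e: "(t * a) mod n = (t * b) mod n"
    have key: "a = b" if "a \<le> b" "b < n" "(t * a) mod n = (t * b) mod n" for a b
    proof -
      have "n dvd t * b - t * a" using that by (subst (asm) eq_commute, subst (asm) mod_eq_dvd_iff_nat) auto
      then have "n dvd t * (b - a)" by (simp add: diff_mult_distrib2)
      then have "n dvd b - a" using cop by (simp add: coprime_dvd_mult_right_iff coprime_commute)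
      then show ?thesis using that dvd_imp_le[of n "b - a"] by (cases "b - a = 0") auto
    qed
    have lt: "a < n" "b < n" using ab by (simp_all add: units_mod_def)
    show "a = b"
    proof (cases "a \<le> b")
      case True
      show ?thesis by (rule key[OF True lt(2) e])
    next
      case False
      then have "b \<le> a" by simp
      from key[OF this lt(1) e[symmetric]] show ?thesis by simp
    qed
  qed
  moreover have "(\<lambda>s. (t * s) mod n) ` units_mod n \<subseteq> units_mod n"
    using cop n by (auto simp: units_mod_def)
  ultimately show ?thesis using endo_inj_surj[OF finite_units_mod] by (simp add: bij_betw_def)
qed

lemma elementary_symmetric_reindex:
  assumes bij: "bij_betw p T T"
  shows "(\<Sum>A\<in>{A. A \<subseteq> T \<and> card A = k}. \<Prod>s\<in>A. v (p s)) = (\<Sum>A\<in>{A. A \<subseteq> T \<and> card A = k}. \<Prod>s\<in>A. v s)"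
proof -
  let ?S = "{A. A \<subseteq> T \<and> card A = k}"
  have inj: "inj_on p T" and im: "p ` T = T" using bij by (auto simp: bij_betw_def)
  have "bij_betw ((`) p) (Pow T) (Pow T)" using bij by (rule bij_betw_Pow)
  then have ij: "inj_on ((`) p) (Pow T)" and imp: "(`) p ` Pow T = Pow T" by (auto simp: bij_betw_def)
  have card: "card (p ` A) = card A" if "A \<subseteq> T" for A using card_image inj_on_subset[OF inj that] by blast
  have "bij_betw ((`) p) ?S ?S" unfolding bij_betw_def
  proof
    show "inj_on ((`) p) ?S" by (rule inj_on_subset[OF ij]) auto
    show "(`) p ` ?S = ?S"
    proof (intro equalityI subsetI)
      fix B assume B: "B \<in> ?S"
      then have "B \<in> (`) p ` Pow T" unfolding imp by simp
      then obtain A where A: "A \<in> Pow T" "B = p ` A" by (elim imageE)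
      then have "A \<in> ?S" using B card[of A] by simp
      then show "B \<in> (`) p ` ?S" unfolding A(2) by (rule imageI)
    next
      fix B assume "B \<in> (`) p ` ?S"
      then obtain A where A: "A \<in> ?S" "B = p ` A" by (elim imageE)
      then have "A \<subseteq> T" "card A = k" by simp_all
      then show "B \<in> ?S" unfolding A(2) using card[of A] image_mono[of A T p] unfolding im by simp
    qed
  qed
  then have "(\<Sum>A\<in>?S. \<Prod>s\<in>A. v s) = (\<Sum>A\<in>?S. \<Prod>s\<in>p ` A. v s)"
    by (rule sum.reindex_bij_betw[symmetric])
  also have "\<dots> = (\<Sum>A\<in>?S. \<Prod>s\<in>A. v (p s))"
  proof (rule sum.cong[OF refl])
    fix A assume "A \<in> ?S"
    then have "inj_on p A" using inj_on_subset[OF inj] by blast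
    then show "(\<Prod>s\<in>p ` A. v s) = (\<Prod>s\<in>A. v (p s))" by (simp add: prod.reindex)
  qed
  finally show ?thesis by simp
qed

text \<open>The polynomials \<open>Q g\<close> stand for the entries of a vector indexed by \<open>I\<close> whose squared norm
  and sum of entries agree, together with all Galois conjugates of this vector. Elementary
  symmetric functions of the conjugates of an entry are integers, so the bound above applies
  to each entry; the bounds add up to zero, hence each of them is attained.\<close>

lemma rational_family_01:
  fixes \<zeta> :: "'k::{alg_closed_field, field_char_0}" and Q :: "'i \<Rightarrow> rat poly"
  assumes z: "primroot n \<zeta>" and n: "n > 1" and R: "is_subring R" and D: "D > 0"
    and no: "\<And>p. Factorial_Ring.prime p \<Longrightarrow> p dvd D \<Longrightarrow> inverse (of_nat p) \<notin> R"
    and fin: "finite I"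
    and inR: "\<And>g s. g \<in> I \<Longrightarrow> s \<in> units_mod n \<Longrightarrow> rpoly (Q g) (\<zeta> ^ s) \<in> R"
    and int: "\<And>g s. g \<in> I \<Longrightarrow> s \<in> units_mod n \<Longrightarrow> integral_over \<int> (of_nat D * rpoly (Q g) (\<zeta> ^ s))"
    and eq: "\<And>s. s \<in> units_mod n \<Longrightarrow>
       (\<Sum>g\<in>I. rpoly (Q g) (\<zeta> ^ s) * rpoly (Q g) (\<zeta> ^ (s * (n - 1)))) = (\<Sum>g\<in>I. rpoly (Q g) (\<zeta> ^ s))"
    and g: "g \<in> I"
  shows "rpoly (Q g) \<zeta> \<in> {0, 1}" "rpoly (Q g) (\<zeta> ^ (n - 1)) = rpoly (Q g) \<zeta>"
proof -
  have zn: "\<zeta> ^ n = 1" using z by (simp add: primroot_def)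
  have zmod: "\<zeta> ^ (k mod n) = \<zeta> ^ k" for k
  proof -
    have "\<zeta> ^ k = \<zeta> ^ (n * (k div n) + k mod n)" by simp
    then show ?thesis by (simp only: power_add power_mult zn power_one mult_1)
  qed
  define P :: "rat poly" where "P = monom 1 n - 1"
  have "coeff P n = 1" using n by (simp add: P_def coeff_1)
  then have P0: "P \<noteq> 0" by auto
  have "rpoly P \<zeta> = 0" using zn by (simp add: P_def rpoly_monom)
  (* The counterpart y of \<zeta> has absolute value 1, so that its power n - 1, its inverse, is its
     complex conjugate. *)
  then obtain y :: complex where y: "\<And>q. rpoly q \<zeta> = 0 \<longleftrightarrow> rpoly q y = 0"
    by (rule complex_conjugate_point[OF P0]) blast
  have "rpoly P y = 0" using y \<open>rpoly P \<zeta> = 0\<close> by blast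
  then have yn: "y ^ n = 1" by (simp add: P_def rpoly_monom)
  have y0: "y \<noteq> 0"
  proof
    assume "y = 0"
    then have "y ^ n = 0" using n by (simp add: power_0_left)
    then show False using yn by simp
  qed
  have "cmod y ^ n = 1" using yn by (metis norm_one norm_power)
  then have "cmod y = 1" using n power_eq_1_iff[of "cmod y" n] by simp
  then have "y * cnj y = 1" by (simp add: complex_norm_square[symmetric])
  moreover have "Suc (n - 1) = n" using n by simp
  then have "y * y ^ (n - 1) = 1" using yn by (metis power_Suc)
  ultimately have "y * y ^ (n - 1) = y * cnj y" by simp
  then have cy: "y ^ (n - 1) = cnj y" using y0 by (simp only: mult_cancel_left) simp
  define pw where "pw q s = pcompose q (monom (1::rat) s)" for q s
  have rpw: "rpoly (pw q s) x = rpoly q (x ^ s)" for q s and x :: "'a::field_char_0"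
    by (simp add: pw_def rpoly_pcompose rpoly_monom)
  define V where "V g s = rpoly (Q g) (y ^ s)" for g s
  have cV: "rpoly (Q g) (y ^ (s * (n - 1))) = cnj (V g s)" for g s
  proof -
    have "y ^ (s * (n - 1)) = cnj y ^ s" by (simp only: cy[symmetric] power_mult[symmetric] mult.commute)
    then show ?thesis by (simp add: V_def rpoly_cnj[symmetric])
  qed
  have esym: "(\<Sum>A\<in>{A. A \<subseteq> units_mod n \<and> card A = k}. \<Prod>s\<in>A. V g s) \<in> \<int>" if g: "g \<in> I" for g k
  proof -
    let ?S = "{A. A \<subseteq> units_mod n \<and> card A = k}"
    (* The elementary symmetric function of the conjugates; multiplication by a unit permutes the
       exponents and so fixes its value. *)
    define E where "E = (\<Sum>A\<in>?S. \<Prod>s\<in>A. pw (Q g) s)"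
    have rE: "rpoly E x = (\<Sum>A\<in>?S. \<Prod>s\<in>A. rpoly (Q g) (x ^ s))" for x :: "'a::field_char_0"
      by (simp add: E_def rpoly_sum rpoly_prod rpw)
    have "rpoly E (\<zeta> ^ t) = rpoly E \<zeta>" if t: "t \<in> units_mod n" for t
    proof -
      have "rpoly E (\<zeta> ^ t) = (\<Sum>A\<in>?S. \<Prod>s\<in>A. rpoly (Q g) (\<zeta> ^ ((t * s) mod n)))"
        unfolding rE zmod power_mult ..
      also have "\<dots> = rpoly E \<zeta>" unfolding rE
        by (rule elementary_symmetric_reindex[OF bij_units_mod_mult[OF n t], where v = "\<lambda>s. rpoly (Q g) (\<zeta> ^ s)"])
      finally show ?thesis .
    qed
    then have rat: "rpoly E \<zeta> \<in> \<rat>" by (rule invariant_value_rational[OF z n])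
    have ER: "rpoly E \<zeta> \<in> R" unfolding rE
      by (intro is_subring_sum[OF R] is_subring_prod[OF R]) (use inR[OF g] in auto)
    have Z: "is_subring (\<int> :: 'k set)" by (auto simp: is_subring_def)
    note ZZ = is_subring_integral_closure[OF Z]
    have "of_nat D ^ k * rpoly E \<zeta> = (\<Sum>A\<in>?S. \<Prod>s\<in>A. of_nat D * rpoly (Q g) (\<zeta> ^ s))"
      unfolding rE sum_distrib_left by (intro sum.cong refl) (auto simp: prod.distrib)
    also have "\<dots> \<in> {x. integral_over \<int> x}"
      by (intro is_subring_sum[OF ZZ] is_subring_prod[OF ZZ]) (use int[OF g] in auto)
    finally have "integral_over \<int> (of_nat D ^ k * rpoly E \<zeta>)" by simp
    then have "rpoly E \<zeta> \<in> \<int>" using rational_denominator_in_subring[OF R rat ER no D] by blast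
    then obtain m where "rpoly E \<zeta> = of_int m" by (auto elim: Ints_cases)
    then have "rpoly (E - [:of_int m:]) \<zeta> = 0" by simp
    then have "rpoly (E - [:of_int m:]) y = 0" using y by blast
    then have "rpoly E y = of_int m" by simp
    then show ?thesis unfolding rE V_def by simp
  qed
  have sums: "(\<Sum>g\<in>I. (cmod (V g s))\<^sup>2 - Re (V g s)) = 0" if s: "s \<in> units_mod n" for s
  proof -
    define W where "W = (\<Sum>g\<in>I. pw (Q g) s * pw (Q g) (s * (n - 1))) - (\<Sum>g\<in>I. pw (Q g) s)"
    have "rpoly W \<zeta> = 0" using eq[OF s] by (simp add: W_def rpoly_sum rpw)
    then have "rpoly W y = 0" using y by blast
    then have "(\<Sum>g\<in>I. V g s * cnj (V g s)) - (\<Sum>g\<in>I. V g s) = 0"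
      unfolding W_def rpoly_diff rpoly_sum rpoly_mult rpw cV V_def .
    then have "Re ((\<Sum>g\<in>I. of_real ((cmod (V g s))\<^sup>2)) - (\<Sum>g\<in>I. V g s)) = 0"
      unfolding complex_norm_square[symmetric] by simp
    then show ?thesis unfolding minus_complex.simps Re_sum Re_complex_of_real sum_subtractf .
  qed
  have nonneg: "0 \<le> (\<Sum>s\<in>units_mod n. (cmod (V g s))\<^sup>2 - Re (V g s))" if "g \<in> I" for g
    by (rule integral_symmetric_functions_bound(1)[OF finite_units_mod esym[OF that]])
  have "(\<Sum>g\<in>I. \<Sum>s\<in>units_mod n. (cmod (V g s))\<^sup>2 - Re (V g s)) = 0"
    by (subst sum.swap) (simp add: sums)
  then have "(\<Sum>s\<in>units_mod n. (cmod (V g s))\<^sup>2 - Re (V g s)) = 0"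
    using g fin nonneg by (subst (asm) sum_nonneg_eq_0_iff) auto
  then have V1: "V g 1 \<in> {0, 1}"
    by (rule integral_symmetric_functions_bound(2)[OF finite_units_mod esym[OF g] _ one_in_units_mod[OF n]])
  then obtain c :: int where c: "c \<in> {0, 1}" "V g 1 = of_int c" by fastforce
  have "rpoly (Q g - [:of_int c:]) y = 0" using c(2) by (simp add: V_def)
  then have "rpoly (Q g - [:of_int c:]) \<zeta> = 0" using y by blast
  then have 1: "rpoly (Q g) \<zeta> = of_int c" by simp
  have "rpoly (pw (Q g) (1 * (n - 1)) - [:of_int c:]) y = 0"
    unfolding rpoly_diff rpw cV c(2) by simp
  then have "rpoly (pw (Q g) (1 * (n - 1)) - [:of_int c:]) \<zeta> = 0" using y by blast
  then have 2: "rpoly (Q g) (\<zeta> ^ (n - 1)) = of_int c" by (simp add: rpw)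
  show "rpoly (Q g) \<zeta> \<in> {0, 1}" "rpoly (Q g) (\<zeta> ^ (n - 1)) = rpoly (Q g) \<zeta>"
    using 1 2 c(1) by auto
qed

section \<open>Class functions and matrix representations\<close>

locale fin_group = group G for G :: "('g, 'm) monoid_scheme" (structure) +
  assumes fin: "finite (carrier G)"

definition conv :: "('g, 'm) monoid_scheme \<Rightarrow> ('g \<Rightarrow> 'a::comm_ring_1) \<Rightarrow> ('g \<Rightarrow> 'a) \<Rightarrow> 'g \<Rightarrow> 'a" where
  "conv G a b = (\<lambda>g. if g \<in> carrier G then \<Sum>x\<in>carrier G. a x * b (inv\<^bsub>G\<^esub> x \<otimes>\<^bsub>G\<^esub> g) else 0)"

definition class_fun :: "('g, 'm) monoid_scheme \<Rightarrow> ('g \<Rightarrow> 'a::comm_ring_1) \<Rightarrow> bool" where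
  "class_fun G z \<longleftrightarrow> (\<forall>g. g \<notin> carrier G \<longrightarrow> z g = 0) \<and>
     (\<forall>x\<in>carrier G. \<forall>g\<in>carrier G. z (x \<otimes>\<^bsub>G\<^esub> g \<otimes>\<^bsub>G\<^esub> inv\<^bsub>G\<^esub> x) = z g)"

definition delta1 :: "('g, 'm) monoid_scheme \<Rightarrow> 'g \<Rightarrow> 'a::comm_ring_1" where
  "delta1 G = (\<lambda>g. if g = \<one>\<^bsub>G\<^esub> then 1 else 0)"

definition mat_rep :: "('g, 'm) monoid_scheme \<Rightarrow> nat \<Rightarrow> ('g \<Rightarrow> 'k::field mat) \<Rightarrow> bool" where
  "mat_rep G n \<rho> \<longleftrightarrow> (\<forall>g\<in>carrier G. \<rho> g \<in> carrier_mat n n) \<and>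
     (\<forall>g\<in>carrier G. \<forall>h\<in>carrier G. \<rho> (g \<otimes>\<^bsub>G\<^esub> h) = \<rho> g * \<rho> h) \<and> \<rho> \<one>\<^bsub>G\<^esub> = 1\<^sub>m n"

definition irr_rep :: "('g, 'm) monoid_scheme \<Rightarrow> nat \<Rightarrow> ('g \<Rightarrow> 'k::field mat) \<Rightarrow> bool" where
  "irr_rep G n \<rho> \<longleftrightarrow> mat_rep G n \<rho> \<and> n > 0 \<and>
     (\<forall>W. lin_subspace n W \<and> (\<forall>g\<in>carrier G. \<forall>w\<in>W. \<rho> g *\<^sub>v w \<in> W) \<longrightarrow> W = {0\<^sub>v n} \<or> W = carrier_vec n)"

definition rep_char :: "('g, 'm) monoid_scheme \<Rightarrow> nat \<Rightarrow> ('g \<Rightarrow> 'k::field mat) \<Rightarrow> 'g \<Rightarrow> 'k" where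
  "rep_char G n \<rho> = (\<lambda>g. if g \<in> carrier G then \<Sum>i<n. \<rho> g $$ (i, i) else 0)"

definition Irr :: "('g, 'm) monoid_scheme \<Rightarrow> ('g \<Rightarrow> 'k::field) set" where
  "Irr G = {rep_char G n \<rho> | n \<rho>. irr_rep G n \<rho>}"

text \<open>The linear extension of a representation to the group algebra.\<close>

definition rep_ext :: "('g, 'm) monoid_scheme \<Rightarrow> nat \<Rightarrow> ('g \<Rightarrow> 'k::field mat) \<Rightarrow> ('g \<Rightarrow> 'k) \<Rightarrow> 'k mat" where
  "rep_ext G n \<rho> z = mat n n (\<lambda>(i,j). \<Sum>g\<in>carrier G. z g * \<rho> g $$ (i,j))"

text \<open>The central character of \<open>\<chi>\<close>: the scalar by which a central element acts on the
  representation.\<close>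

definition omega :: "('g, 'm) monoid_scheme \<Rightarrow> ('g \<Rightarrow> 'k::field) \<Rightarrow> ('g \<Rightarrow> 'k) \<Rightarrow> 'k" where
  "omega G \<chi> z = (\<Sum>g\<in>carrier G. z g * \<chi> g) / \<chi> \<one>\<^bsub>G\<^esub>"

text \<open>The primitive central idempotent of \<open>\<chi>\<close>.\<close>

definition eidem :: "('g, 'm) monoid_scheme \<Rightarrow> ('g \<Rightarrow> 'k::field) \<Rightarrow> 'g \<Rightarrow> 'k" where
  "eidem G \<chi> = (\<lambda>g. if g \<in> carrier G then \<chi> \<one>\<^bsub>G\<^esub> / of_nat (card (carrier G)) * \<chi> (inv\<^bsub>G\<^esub> g) else 0)"

lemma mat_eq_by_vec:
  fixes A :: "'k::field mat"
  assumes A: "A \<in> carrier_mat n m" and B: "B \<in> carrier_mat n m" and eq: "\<And>v. v \<in> carrier_vec m \<Longrightarrow> A *\<^sub>v v = B *\<^sub>v v"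
  shows "A = B"
proof (rule mat_col_eqI)
  fix j assume "j < dim_col B"
  then have j: "j < m" using B by auto
  show "col A j = col B j" unfolding mat_unit_vec_col[OF A j] mat_unit_vec_col[OF B j] by (rule eq) simp
qed (use A B in auto)

context fin_group begin

lemma card_pos: "card (carrier G) > 0" using fin one_closed card_gt_0_iff by blast

lemma sum_translate_left:
  assumes "x \<in> carrier G"
  shows "(\<Sum>g\<in>carrier G. f g) = (\<Sum>y\<in>carrier G. f (x \<otimes> y))"
proof (rule sum.reindex_bij_witness[of _ "\<lambda>y. x \<otimes> y" "\<lambda>g. inv x \<otimes> g"])
qed (use assms in \<open>auto simp: m_assoc[symmetric]\<close>)

lemma sum_translate_right:
  assumes "x \<in> carrier G"
  shows "(\<Sum>g\<in>carrier G. f g) = (\<Sum>y\<in>carrier G. f (y \<otimes> x))"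
proof (rule sum.reindex_bij_witness[of _ "\<lambda>y. y \<otimes> x" "\<lambda>g. g \<otimes> inv x"])
qed (use assms in \<open>auto simp: m_assoc\<close>)

lemma class_fun_swap:
  assumes "class_fun G z" "x \<in> carrier G" "y \<in> carrier G"
  shows "z (x \<otimes> y) = z (y \<otimes> x)"
proof -
  have "z (x \<otimes> (y \<otimes> x) \<otimes> inv x) = z (y \<otimes> x)" using assms by (simp add: class_fun_def)
  moreover have "x \<otimes> (y \<otimes> x) \<otimes> inv x = x \<otimes> y" using assms by (simp add: m_assoc)
  ultimately show ?thesis by simp
qed

lemma conv_delta1: "class_fun G z \<Longrightarrow> conv G z (delta1 G) = z"
proof (rule ext)
  fix g assume z: "class_fun G z"
  show "conv G z (delta1 G) g = z g"
  proof (cases "g \<in> carrier G")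
    case True
    have "inv x \<otimes> g = \<one> \<longleftrightarrow> x = g" if "x \<in> carrier G" for x
      using that True by (metis inv_solve_left r_one one_closed)
    then have "(\<Sum>x\<in>carrier G. z x * delta1 G (inv x \<otimes> g)) = (\<Sum>x\<in>carrier G. if x = g then z x else 0)"
      by (intro sum.cong refl) (simp add: delta1_def)
    then show ?thesis using True fin by (simp add: conv_def)
  qed (use z in \<open>auto simp: conv_def class_fun_def\<close>)
qed

lemma conv_sum_right: "conv G z (\<lambda>g. \<Sum>i\<in>I. f i g) = (\<lambda>g. \<Sum>i\<in>I. conv G z (f i) g)"
  by (rule ext) (auto simp: conv_def sum_distrib_left intro: sum.swap)

lemma conv_diff_right: "conv G z (\<lambda>g. a g - b g) = (\<lambda>g. conv G z a g - conv G z b g)"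
  by (rule ext) (auto simp: conv_def right_diff_distrib sum_subtractf)

lemma mat_repD:
  assumes "mat_rep G n \<rho>"
  shows "g \<in> carrier G \<Longrightarrow> \<rho> g \<in> carrier_mat n n"
    "g \<in> carrier G \<Longrightarrow> h \<in> carrier G \<Longrightarrow> \<rho> (g \<otimes> h) = \<rho> g * \<rho> h" "\<rho> \<one> = 1\<^sub>m n"
  using assms by (auto simp: mat_rep_def)

lemma mat_rep_entry:
  assumes "mat_rep G n \<rho>" "g \<in> carrier G" "h \<in> carrier G" "i < n" "j < n"
  shows "\<rho> (g \<otimes> h) $$ (i,j) = (\<Sum>l<n. \<rho> g $$ (i,l) * \<rho> h $$ (l,j))"
  unfolding mat_repD(2)[OF assms(1-3)] by (rule mat_mult_entry) (use assms mat_repD in auto)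

lemma rep_ext_carrier [simp]: "rep_ext G n \<rho> z \<in> carrier_mat n n" by (simp add: rep_ext_def)

lemma rep_ext_entry: "i < n \<Longrightarrow> j < n \<Longrightarrow> rep_ext G n \<rho> z $$ (i,j) = (\<Sum>g\<in>carrier G. z g * \<rho> g $$ (i,j))"
  by (simp add: rep_ext_def)

lemma rep_ext_translate:
  assumes r: "mat_rep G n \<rho>" and h: "h \<in> carrier G" and ij: "i < n" "j < n"
  shows "(\<rho> h * rep_ext G n \<rho> z) $$ (i,j) = (\<Sum>g\<in>carrier G. z g * \<rho> (h \<otimes> g) $$ (i,j))"
    and "(rep_ext G n \<rho> z * \<rho> h) $$ (i,j) = (\<Sum>g\<in>carrier G. z g * \<rho> (g \<otimes> h) $$ (i,j))"
proof -
  have "(\<rho> h * rep_ext G n \<rho> z) $$ (i,j) = (\<Sum>l<n. \<rho> h $$ (i,l) * rep_ext G n \<rho> z $$ (l,j))"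
    by (rule mat_mult_entry) (use ij h mat_repD[OF r] in auto)
  also have "\<dots> = (\<Sum>l<n. \<Sum>g\<in>carrier G. z g * (\<rho> h $$ (i,l) * \<rho> g $$ (l,j)))"
    using ij by (intro sum.cong refl) (simp add: rep_ext_entry sum_distrib_left mult.left_commute)
  also have "\<dots> = (\<Sum>g\<in>carrier G. \<Sum>l<n. z g * (\<rho> h $$ (i,l) * \<rho> g $$ (l,j)))" by (rule sum.swap)
  also have "\<dots> = (\<Sum>g\<in>carrier G. z g * \<rho> (h \<otimes> g) $$ (i,j))"
    by (intro sum.cong refl) (simp add: mat_rep_entry[OF r h _ ij] sum_distrib_left)
  finally show "(\<rho> h * rep_ext G n \<rho> z) $$ (i,j) = (\<Sum>g\<in>carrier G. z g * \<rho> (h \<otimes> g) $$ (i,j))" .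
  have "(rep_ext G n \<rho> z * \<rho> h) $$ (i,j) = (\<Sum>l<n. rep_ext G n \<rho> z $$ (i,l) * \<rho> h $$ (l,j))"
    by (rule mat_mult_entry) (use ij h mat_repD[OF r] in auto)
  also have "\<dots> = (\<Sum>l<n. \<Sum>g\<in>carrier G. z g * (\<rho> g $$ (i,l) * \<rho> h $$ (l,j)))"
    using ij by (intro sum.cong refl) (simp add: rep_ext_entry sum_distrib_right mult.assoc)
  also have "\<dots> = (\<Sum>g\<in>carrier G. \<Sum>l<n. z g * (\<rho> g $$ (i,l) * \<rho> h $$ (l,j)))" by (rule sum.swap)
  also have "\<dots> = (\<Sum>g\<in>carrier G. z g * \<rho> (g \<otimes> h) $$ (i,j))"
    by (intro sum.cong refl) (simp add: mat_rep_entry[OF r _ h ij] sum_distrib_left)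
  finally show "(rep_ext G n \<rho> z * \<rho> h) $$ (i,j) = (\<Sum>g\<in>carrier G. z g * \<rho> (g \<otimes> h) $$ (i,j))" .
qed

lemma rep_ext_central:
  assumes r: "mat_rep G n \<rho>" and z: "class_fun G z" and h: "h \<in> carrier G"
  shows "\<rho> h * rep_ext G n \<rho> z = rep_ext G n \<rho> z * \<rho> h"
proof (rule eq_matI)
  fix i j assume "i < dim_row (rep_ext G n \<rho> z * \<rho> h)" "j < dim_col (rep_ext G n \<rho> z * \<rho> h)"
  then have ij: "i < n" "j < n" using mat_repD(1)[OF r h] by (auto simp: rep_ext_def)
  have "(\<Sum>g\<in>carrier G. z g * \<rho> (h \<otimes> g) $$ (i,j)) = (\<Sum>g\<in>carrier G. z (inv h \<otimes> g) * \<rho> g $$ (i,j))"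
    unfolding sum_translate_left[OF h, of "\<lambda>g. z (inv h \<otimes> g) * \<rho> g $$ (i,j)"]
    using h by (intro sum.cong refl) (simp add: m_assoc[symmetric])
  also have "\<dots> = (\<Sum>g\<in>carrier G. z (g \<otimes> inv h) * \<rho> g $$ (i,j))"
    using h by (intro sum.cong refl) (simp add: class_fun_swap[OF z])
  also have "\<dots> = (\<Sum>g\<in>carrier G. z g * \<rho> (g \<otimes> h) $$ (i,j))"
    unfolding sum_translate_right[OF h, of "\<lambda>g. z (g \<otimes> inv h) * \<rho> g $$ (i,j)"]
    using h by (intro sum.cong refl) (simp add: m_assoc)
  finally show "(\<rho> h * rep_ext G n \<rho> z) $$ (i,j) = (rep_ext G n \<rho> z * \<rho> h) $$ (i,j)"
    by (simp only: rep_ext_translate[OF r h ij])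
qed (use mat_repD(1)[OF r h] in \<open>auto simp: rep_ext_def\<close>)

lemma irr_repD:
  assumes "irr_rep G n \<rho>"
  shows "mat_rep G n \<rho>" "n > 0"
    "lin_subspace n W \<Longrightarrow> (\<And>g w. g \<in> carrier G \<Longrightarrow> w \<in> W \<Longrightarrow> \<rho> g *\<^sub>v w \<in> W) \<Longrightarrow> W = {0\<^sub>v n} \<or> W = carrier_vec n"
proof -
  have a: "mat_rep G n \<rho>" and b: "n > 0" and c: "\<forall>W. lin_subspace n W \<and> (\<forall>g\<in>carrier G. \<forall>w\<in>W. \<rho> g *\<^sub>v w \<in> W) \<longrightarrow> W = {0\<^sub>v n} \<or> W = carrier_vec n"
    using assms unfolding irr_rep_def by blast+
  show "mat_rep G n \<rho>" by (rule a)
  show "n > 0" by (rule b)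
  show "W = {0\<^sub>v n} \<or> W = carrier_vec n"
    if "lin_subspace n W" "\<And>g w. g \<in> carrier G \<Longrightarrow> w \<in> W \<Longrightarrow> \<rho> g *\<^sub>v w \<in> W"
    using c that by blast
qed

end

section \<open>Schur's lemma and the orthogonality of characters\<close>

context fin_group begin

text \<open>The kernel and the image of an intertwiner are invariant, so by irreducibility the kernel is
  zero and the image is the whole space.\<close>

lemma schur_invertible:
  fixes \<rho> \<tau> :: "'g \<Rightarrow> 'k::field mat"
  assumes r: "irr_rep G n \<rho>" and s: "irr_rep G m \<tau>" and E: "E \<in> carrier_mat n m" "E \<noteq> 0\<^sub>m n m"
    and eq: "\<And>g. g \<in> carrier G \<Longrightarrow> \<rho> g * E = E * \<tau> g"
  shows "\<exists>Y. Y \<in> carrier_mat m n \<and> E * Y = 1\<^sub>m n \<and> Y * E = 1\<^sub>m m"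
proof -
  note rm = mat_repD(1)[OF irr_repD(1)[OF r]] and sm = mat_repD(1)[OF irr_repD(1)[OF s]]
  have comm: "E *\<^sub>v (\<tau> g *\<^sub>v v) = \<rho> g *\<^sub>v (E *\<^sub>v v)" if "g \<in> carrier G" "v \<in> carrier_vec m" for g v
    unfolding assoc_mult_mat_vec[OF E(1) sm[OF that(1)] that(2), symmetric] eq[OF that(1), symmetric]
    by (rule assoc_mult_mat_vec[OF rm[OF that(1)] E(1) that(2)])
  have E0: "E = 0\<^sub>m n m" if "\<And>v. v \<in> carrier_vec m \<Longrightarrow> E *\<^sub>v v = 0\<^sub>v n"
    by (rule mat_eq_by_vec[OF E(1)]) (use that in auto)
  define K where "K = {v \<in> carrier_vec m. E *\<^sub>v v = 0\<^sub>v n}"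
  have "lin_subspace m K" unfolding lin_subspace_def K_def using E(1)
    by (auto simp: mult_add_distrib_mat_vec[OF E(1)] mult_mat_vec[OF E(1)])
  moreover have "\<tau> g *\<^sub>v v \<in> K" if "g \<in> carrier G" "v \<in> K" for g v
    using that comm[of g v] rm[OF that(1)] sm[OF that(1)] by (auto simp: K_def)
  ultimately have "K = {0\<^sub>v m} \<or> K = carrier_vec m" by (rule irr_repD(3)[OF s])
  then have K: "K = {0\<^sub>v m}" using E0 E(2) unfolding K_def by blast
  define I where "I = {E *\<^sub>v v | v. v \<in> carrier_vec m}"
  have "lin_subspace n I" unfolding lin_subspace_def
  proof (intro conjI ballI allI)
    show "I \<subseteq> carrier_vec n" using E by (auto simp: I_def)
    show "0\<^sub>v n \<in> I" unfolding I_def using E by (auto intro!: exI[of _ "0\<^sub>v m"])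
    fix u v assume "u \<in> I" "v \<in> I"
    then obtain a b where "u = E *\<^sub>v a" "v = E *\<^sub>v b" "a \<in> carrier_vec m" "b \<in> carrier_vec m" unfolding I_def by blast
    then show "u + v \<in> I" unfolding I_def
      by (auto intro!: exI[of _ "a + b"] simp: mult_add_distrib_mat_vec[OF E(1)])
  next
    fix c v assume "v \<in> I"
    then obtain b where "v = E *\<^sub>v b" "b \<in> carrier_vec m" unfolding I_def by blast
    then show "c \<cdot>\<^sub>v v \<in> I" unfolding I_def
      by (auto intro!: exI[of _ "c \<cdot>\<^sub>v b"] simp: mult_mat_vec[OF E(1)])
  qed
  moreover have "\<rho> g *\<^sub>v w \<in> I" if g: "g \<in> carrier G" and w: "w \<in> I" for g w
  proof -
    obtain v where "w = E *\<^sub>v v" "v \<in> carrier_vec m" using w unfolding I_def by blast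
    then show ?thesis using comm[OF g] sm[OF g] unfolding I_def by (auto intro!: exI[of _ "\<tau> g *\<^sub>v v"])
  qed
  ultimately have "I = {0\<^sub>v n} \<or> I = carrier_vec n" by (rule irr_repD(3)[OF r])
  then have I: "I = carrier_vec n" using E0 E(2) unfolding I_def by blast
  have "\<exists>u. u \<in> carrier_vec m \<and> E *\<^sub>v u = unit_vec n j" for j
  proof -
    have "unit_vec n j \<in> I" by (simp add: I)
    then show ?thesis unfolding I_def by force
  qed
  then obtain u where u: "\<And>j. u j \<in> carrier_vec m" "\<And>j. E *\<^sub>v u j = unit_vec n j" by metis
  define Y where "Y = mat m n (\<lambda>(i,j). vec_index (u j) i)"
  have Y: "Y \<in> carrier_mat m n" by (simp add: Y_def)
  have colY: "col Y j = u j" if "j < n" for j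
    by (rule eq_vecI) (use that u(1)[of j] in \<open>auto simp: Y_def\<close>)
  have EY: "E * Y = 1\<^sub>m n"
  proof (rule mat_col_eqI)
    fix j assume "j < dim_col (1\<^sub>m n)"
    then have j: "j < n" by simp
    have "col (E * Y) j = E *\<^sub>v col Y j" using E Y j by (intro eq_vecI) auto
    then show "col (E * Y) j = col (1\<^sub>m n) j" using j by (simp add: colY u)
  qed (use E Y in auto)
  have "Y * E = 1\<^sub>m m"
  proof (rule mat_eq_by_vec)
    fix v :: "'k vec" assume v: "v \<in> carrier_vec m"
    have Ev: "E *\<^sub>v v \<in> carrier_vec n" using E v by auto
    have YEv: "Y *\<^sub>v (E *\<^sub>v v) \<in> carrier_vec m" using Y Ev by auto
    define d where "d = Y *\<^sub>v (E *\<^sub>v v) + (-1) \<cdot>\<^sub>v v"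
    have "E *\<^sub>v (Y *\<^sub>v (E *\<^sub>v v)) = E *\<^sub>v v"
      unfolding assoc_mult_mat_vec[OF E(1) Y Ev, symmetric] EY by (rule one_mult_mat_vec[OF Ev])
    then have "E *\<^sub>v d = E *\<^sub>v v + (-1) \<cdot>\<^sub>v (E *\<^sub>v v)"
      unfolding d_def using v YEv by (simp add: mult_add_distrib_mat_vec[OF E(1)] mult_mat_vec[OF E(1)])
    also have "\<dots> = 0\<^sub>v n" by (rule eq_vecI) (use Ev carrier_vecD[OF Ev] in \<open>simp_all del: index_mult_mat_vec dim_mult_mat_vec\<close>)
    finally have "d \<in> K" unfolding K_def d_def using v YEv by auto
    then have d0: "d = 0\<^sub>v m" by (simp add: K)
    have "Y *\<^sub>v (E *\<^sub>v v) = v"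
    proof (rule eq_vecI)
      fix i assume "i < dim_vec v"
      then have i: "i < m" using v by auto
      have "d $ i = (Y *\<^sub>v (E *\<^sub>v v)) $ i - v $ i"
        unfolding d_def using i v YEv by (simp del: index_mult_mat_vec)
      then show "(Y *\<^sub>v (E *\<^sub>v v)) $ i = v $ i" using d0 i by simp
    qed (use v Y in auto)
    then show "(Y * E) *\<^sub>v v = 1\<^sub>m m *\<^sub>v v"
      unfolding assoc_mult_mat_vec[OF Y E(1) v] one_mult_mat_vec[OF v] .
  qed (use E Y in auto)
  then show ?thesis using Y EY by blast
qed

text \<open>Subtracting an eigenvalue from an endomorphism gives a singular endomorphism, which vanishes
  because nonzero ones are invertible.\<close>

lemma schur_scalar:
  fixes \<rho> :: "'g \<Rightarrow> 'k::alg_closed_field mat"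
  assumes r: "irr_rep G n \<rho>" and E: "E \<in> carrier_mat n n" and eq: "\<And>g. g \<in> carrier G \<Longrightarrow> \<rho> g * E = E * \<rho> g"
  shows "\<exists>c. E = c \<cdot>\<^sub>m 1\<^sub>m n"
proof -
  note rm = mat_repD(1)[OF irr_repD(1)[OF r]]
  have "degree (char_poly E) > 0" using degree_monic_char_poly[OF E] irr_repD(2)[OF r] by simp
  then obtain c where "poly (char_poly E) c = 0" using alg_closed_imp_poly_has_root by blast
  then have "eigenvalue E c" using eigenvalue_root_char_poly[OF E] by simp
  then obtain v where v: "v \<in> carrier_vec n" "v \<noteq> 0\<^sub>v n" "E *\<^sub>v v = c \<cdot>\<^sub>v v"
    using E unfolding eigenvalue_def eigenvector_def by auto
  define K where "K = {v \<in> carrier_vec n. E *\<^sub>v v = c \<cdot>\<^sub>v v}"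
  have "lin_subspace n K" unfolding lin_subspace_def K_def using E
    by (auto simp: mult_add_distrib_mat_vec[OF E] mult_mat_vec[OF E] smult_add_distrib_vec smult_smult_assoc mult.commute)
  moreover have "\<rho> g *\<^sub>v w \<in> K" if g: "g \<in> carrier G" and w: "w \<in> K" for g w
  proof -
    have wc: "w \<in> carrier_vec n" "E *\<^sub>v w = c \<cdot>\<^sub>v w" using w by (auto simp: K_def)
    have "E *\<^sub>v (\<rho> g *\<^sub>v w) = \<rho> g *\<^sub>v (E *\<^sub>v w)"
      unfolding assoc_mult_mat_vec[OF E rm[OF g] wc(1), symmetric] eq[OF g, symmetric]
      by (rule assoc_mult_mat_vec[OF rm[OF g] E wc(1)])
    also have "\<dots> = c \<cdot>\<^sub>v (\<rho> g *\<^sub>v w)" unfolding wc(2) by (rule mult_mat_vec[OF rm[OF g] wc(1)])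
    finally show ?thesis using rm[OF g] wc by (auto simp: K_def)
  qed
  ultimately have "K = {0\<^sub>v n} \<or> K = carrier_vec n" by (rule irr_repD(3)[OF r])
  then have K: "K = carrier_vec n" using v by (auto simp: K_def)
  have "E = c \<cdot>\<^sub>m 1\<^sub>m n"
  proof (rule mat_eq_by_vec[OF E])
    fix w :: "'k vec" assume w: "w \<in> carrier_vec n"
    then have "E *\<^sub>v w = c \<cdot>\<^sub>v w" using K by (auto simp: K_def)
    also have "\<dots> = (c \<cdot>\<^sub>m 1\<^sub>m n) *\<^sub>v w" using w by (intro eq_vecI) auto
    finally show "E *\<^sub>v w = (c \<cdot>\<^sub>m 1\<^sub>m n) *\<^sub>v w" .
  qed simp
  then show ?thesis by blast
qed

lemma rep_char_one: "mat_rep G n \<rho> \<Longrightarrow> rep_char G n \<rho> \<one> = of_nat n"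
  by (simp add: rep_char_def mat_repD(3))

lemma rep_char_trace: "mat_rep G n \<rho> \<Longrightarrow> g \<in> carrier G \<Longrightarrow> rep_char G n \<rho> g = mtrace (\<rho> g)"
  using mat_repD(1)[of n \<rho> g] by (auto simp: rep_char_def mtrace_def)

lemma rep_ext_irr:
  fixes \<rho> :: "'g \<Rightarrow> 'k::{alg_closed_field, field_char_0} mat"
  assumes r: "irr_rep G n \<rho>" and z: "class_fun G z"
  shows "rep_ext G n \<rho> z = omega G (rep_char G n \<rho>) z \<cdot>\<^sub>m 1\<^sub>m n"
proof -
  note m = irr_repD(1)[OF r]
  obtain c where c: "rep_ext G n \<rho> z = c \<cdot>\<^sub>m 1\<^sub>m n"
    using schur_scalar[OF r rep_ext_carrier] rep_ext_central[OF m z] by blast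
  have "(\<Sum>g\<in>carrier G. z g * rep_char G n \<rho> g) = (\<Sum>g\<in>carrier G. \<Sum>i<n. z g * \<rho> g $$ (i,i))"
    by (intro sum.cong refl) (simp add: rep_char_def sum_distrib_left)
  also have "\<dots> = (\<Sum>i<n. rep_ext G n \<rho> z $$ (i,i))"
    by (subst sum.swap) (simp add: rep_ext_entry)
  also have "\<dots> = of_nat n * c" by (simp add: c)
  finally have "omega G (rep_char G n \<rho>) z = c"
    using irr_repD(2)[OF r] by (simp add: omega_def rep_char_one[OF m])
  then show ?thesis using c by simp
qed

lemma smult_one_eqD:
  assumes "(a::'k::field) \<cdot>\<^sub>m 1\<^sub>m n = b \<cdot>\<^sub>m 1\<^sub>m n" "n > 0" shows "a = b"
proof -
  have "(a \<cdot>\<^sub>m 1\<^sub>m n) $$ (0,0) = (b \<cdot>\<^sub>m 1\<^sub>m n) $$ (0,0)" using assms(1) by simp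
  then show ?thesis using assms(2) by simp
qed

lemma IrrE:
  assumes "\<chi> \<in> Irr G"
  obtains n \<rho> where "irr_rep G n \<rho>" "\<chi> = rep_char G n \<rho>" "\<chi> \<one> = of_nat n" "n > 0"
proof -
  obtain n \<rho> where "irr_rep G n \<rho>" "\<chi> = rep_char G n \<rho>" using assms unfolding Irr_def by blast
  then show thesis using that[of n \<rho>] rep_char_one irr_repD(1,2) by metis
qed

lemma rep_char_class_fun:
  assumes r: "mat_rep G n \<rho>" shows "class_fun G (rep_char G n \<rho>)"
  unfolding class_fun_def
proof (intro conjI allI impI ballI)
  fix x g assume x: "x \<in> carrier G" and g: "g \<in> carrier G"
  note m = mat_repD(1)[OF r]
  have "\<rho> (x \<otimes> g \<otimes> inv x) = \<rho> (x \<otimes> g) * \<rho> (inv x)" using x g by (intro mat_repD(2)[OF r]) auto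
  then have "rep_char G n \<rho> (x \<otimes> g \<otimes> inv x) = mtrace (\<rho> (x \<otimes> g) * \<rho> (inv x))"
    using rep_char_trace[OF r, of "x \<otimes> g \<otimes> inv x"] x g by simp
  also have "\<dots> = mtrace (\<rho> (inv x) * \<rho> (x \<otimes> g))" by (rule mtrace_comm[where n = n and m = n]) (use m x g in auto)
  also have "\<rho> (inv x) * \<rho> (x \<otimes> g) = \<rho> (inv x \<otimes> (x \<otimes> g))" using x g by (intro mat_repD(2)[OF r, symmetric]) auto
  also have "inv x \<otimes> (x \<otimes> g) = g" using x g by (simp add: m_assoc[symmetric])
  finally show "rep_char G n \<rho> (x \<otimes> g \<otimes> inv x) = rep_char G n \<rho> g" using rep_char_trace[OF r g] by simp
qed (simp add: rep_char_def)

lemma Irr_class_fun: "\<chi> \<in> Irr G \<Longrightarrow> class_fun G \<chi>"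
  using rep_char_class_fun irr_repD(1) unfolding Irr_def by blast

lemma eidem_class_fun:
  assumes "class_fun G \<chi>" shows "class_fun G (eidem G \<chi>)"
  unfolding class_fun_def
proof (intro conjI allI impI ballI)
  fix x g assume x: "x \<in> carrier G" and g: "g \<in> carrier G"
  have "inv (x \<otimes> g \<otimes> inv x) = x \<otimes> inv g \<otimes> inv x" using x g by (simp add: inv_mult_group m_assoc)
  then show "eidem G \<chi> (x \<otimes> g \<otimes> inv x) = eidem G \<chi> g" using assms x g by (simp add: eidem_def class_fun_def)
qed (simp add: eidem_def)

text \<open>Averaging an elementary matrix over the group gives an intertwiner; Schur's lemma for these
  intertwiners is the orthogonality of characters.\<close>

lemma intertwiner:
  assumes r: "mat_rep G n \<rho>" and s: "mat_rep G m \<tau>" and a: "a < n" and b: "b < m" and h: "h \<in> carrier G"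
    and T: "T = mat n m (\<lambda>(i,j). \<Sum>g\<in>carrier G. \<rho> g $$ (i,a) * \<tau> (inv g) $$ (b,j))"
  shows "\<rho> h * T = T * \<tau> h"
proof (rule eq_matI)
  have Tc: "T \<in> carrier_mat n m" by (simp add: T)
  fix i j assume "i < dim_row (T * \<tau> h)" "j < dim_col (T * \<tau> h)"
  then have ij: "i < n" "j < m" using Tc mat_repD(1)[OF s h] by auto
  have "(\<rho> h * T) $$ (i,j) = (\<Sum>k<n. \<rho> h $$ (i,k) * T $$ (k,j))"
    by (rule mat_mult_entry) (use ij Tc mat_repD(1)[OF r h] in auto)
  also have "\<dots> = (\<Sum>k<n. \<Sum>g\<in>carrier G. (\<rho> h $$ (i,k) * \<rho> g $$ (k,a)) * \<tau> (inv g) $$ (b,j))"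
    using ij by (intro sum.cong refl) (simp add: T sum_distrib_left mult.assoc)
  also have "\<dots> = (\<Sum>g\<in>carrier G. \<Sum>k<n. (\<rho> h $$ (i,k) * \<rho> g $$ (k,a)) * \<tau> (inv g) $$ (b,j))" by (rule sum.swap)
  also have "\<dots> = (\<Sum>g\<in>carrier G. \<rho> (h \<otimes> g) $$ (i,a) * \<tau> (inv g) $$ (b,j))"
    by (intro sum.cong refl) (simp add: mat_rep_entry[OF r h _ ij(1) a] sum_distrib_right)
  also have "\<dots> = (\<Sum>g\<in>carrier G. \<rho> g $$ (i,a) * \<tau> (inv g \<otimes> h) $$ (b,j))"
    unfolding sum_translate_left[OF h, of "\<lambda>g. \<rho> g $$ (i,a) * \<tau> (inv g \<otimes> h) $$ (b,j)"]
    using h by (intro sum.cong refl) (simp add: inv_mult_group m_assoc)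
  also have "\<dots> = (\<Sum>g\<in>carrier G. \<Sum>l<m. \<rho> g $$ (i,a) * \<tau> (inv g) $$ (b,l) * \<tau> h $$ (l,j))"
    using ij by (intro sum.cong refl) (simp add: mat_rep_entry[OF s _ h b ij(2)] sum_distrib_left mult.assoc)
  also have "\<dots> = (\<Sum>l<m. \<Sum>g\<in>carrier G. \<rho> g $$ (i,a) * \<tau> (inv g) $$ (b,l) * \<tau> h $$ (l,j))" by (rule sum.swap)
  also have "\<dots> = (\<Sum>l<m. T $$ (i,l) * \<tau> h $$ (l,j))"
    using ij by (intro sum.cong refl) (simp add: T sum_distrib_right)
  also have "\<dots> = (T * \<tau> h) $$ (i,j)"
    by (rule mat_mult_entry[symmetric]) (use ij Tc mat_repD(1)[OF s h] in auto)
  finally show "(\<rho> h * T) $$ (i,j) = (T * \<tau> h) $$ (i,j)" .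
qed (use mat_repD(1)[OF r h] mat_repD(1)[OF s h] T in auto)

lemma char_product_sum:
  assumes "mat_rep G n \<rho>" "mat_rep G m \<tau>"
  shows "(\<Sum>g\<in>carrier G. rep_char G n \<rho> g * rep_char G m \<tau> (inv g)) =
    (\<Sum>i<n. \<Sum>j<m. \<Sum>g\<in>carrier G. \<rho> g $$ (i,i) * \<tau> (inv g) $$ (j,j))"
proof -
  have "(\<Sum>g\<in>carrier G. rep_char G n \<rho> g * rep_char G m \<tau> (inv g)) =
     (\<Sum>g\<in>carrier G. \<Sum>i<n. \<Sum>j<m. \<rho> g $$ (i,i) * \<tau> (inv g) $$ (j,j))"
    by (intro sum.cong refl) (simp add: rep_char_def sum_product)
  also have "\<dots> = (\<Sum>i<n. \<Sum>g\<in>carrier G. \<Sum>j<m. \<rho> g $$ (i,i) * \<tau> (inv g) $$ (j,j))" by (rule sum.swap)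
  also have "\<dots> = (\<Sum>i<n. \<Sum>j<m. \<Sum>g\<in>carrier G. \<rho> g $$ (i,i) * \<tau> (inv g) $$ (j,j))"
    by (intro sum.cong refl) (rule sum.swap)
  finally show ?thesis .
qed

lemma char_orthogonal:
  fixes \<rho> \<tau> :: "'g \<Rightarrow> 'k::{alg_closed_field, field_char_0} mat"
  assumes r: "irr_rep G n \<rho>" and s: "irr_rep G m \<tau>" and ne: "rep_char G n \<rho> \<noteq> rep_char G m \<tau>"
  shows "(\<Sum>g\<in>carrier G. rep_char G n \<rho> g * rep_char G m \<tau> (inv g)) = 0"
proof -
  note rm = irr_repD(1)[OF r] and sm = irr_repD(1)[OF s]
  have zero: "(\<Sum>g\<in>carrier G. \<rho> g $$ (i,a) * \<tau> (inv g) $$ (b,j)) = 0" if ij: "i < n" "j < m" "a < n" "b < m" for i j a b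
  proof (rule ccontr)
    assume nz: "\<not> ?thesis"
    define T where "T = mat n m (\<lambda>(i,j). \<Sum>g\<in>carrier G. \<rho> g $$ (i,a) * \<tau> (inv g) $$ (b,j))"
    have Tc: "T \<in> carrier_mat n m" by (simp add: T_def)
    have "T $$ (i,j) \<noteq> 0" using nz ij by (simp add: T_def)
    then have "T \<noteq> 0\<^sub>m n m" using ij by auto
    then obtain Y where Y: "Y \<in> carrier_mat m n" "T * Y = 1\<^sub>m n" "Y * T = 1\<^sub>m m"
      using schur_invertible[OF r s Tc] intertwiner[OF rm sm ij(3,4) _ T_def] by blast
    have "rep_char G n \<rho> g = rep_char G m \<tau> g" for g
    proof (cases "g \<in> carrier G")
      case True
      have R: "\<rho> g \<in> carrier_mat n n" and S: "\<tau> g \<in> carrier_mat m m" using mat_repD(1)[OF rm True] mat_repD(1)[OF sm True] by auto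
      have "\<rho> g = \<rho> g * (T * Y)" unfolding Y(2) by (rule right_mult_one_mat[OF R, symmetric])
      also have "\<dots> = (\<rho> g * T) * Y" by (rule assoc_mult_mat[OF R Tc Y(1), symmetric])
      also have "\<rho> g * T = T * \<tau> g" by (rule intertwiner[OF rm sm ij(3,4) True T_def])
      also have "T * \<tau> g * Y = T * (\<tau> g * Y)" by (rule assoc_mult_mat[OF Tc S Y(1)])
      finally have "mtrace (\<rho> g) = mtrace (T * (\<tau> g * Y))" by (rule arg_cong)
      also have "\<dots> = mtrace (\<tau> g * Y * T)" by (rule mtrace_comm) (use S Tc Y in auto)
      also have "\<tau> g * Y * T = \<tau> g * (Y * T)" by (rule assoc_mult_mat[OF S Y(1) Tc])
      also have "\<dots> = \<tau> g" unfolding Y(3) by (rule right_mult_one_mat[OF S])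
      finally show ?thesis using rep_char_trace[OF rm True] rep_char_trace[OF sm True] by simp
    qed (simp add: rep_char_def)
    then show False using ne by blast
  qed
  show ?thesis unfolding char_product_sum[OF rm sm] by (simp add: zero)
qed

lemma char_norm:
  fixes \<rho> :: "'g \<Rightarrow> 'k::{alg_closed_field, field_char_0} mat"
  assumes r: "irr_rep G n \<rho>"
  shows "(\<Sum>g\<in>carrier G. rep_char G n \<rho> g * rep_char G n \<rho> (inv g)) = of_nat (card (carrier G))"
proof -
  note rm = irr_repD(1)[OF r]
  have n0: "(of_nat n :: 'k) \<noteq> 0" using irr_repD(2)[OF r] by simp
  have ent: "(\<Sum>g\<in>carrier G. \<rho> g $$ (i,i) * \<rho> (inv g) $$ (j,j)) = (if i = j then of_nat (card (carrier G)) / of_nat n else 0)"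
    if ij: "i < n" "j < n" for i j
  proof -
    define T where "T = mat n n (\<lambda>(i',j'). \<Sum>g\<in>carrier G. \<rho> g $$ (i',i) * \<rho> (inv g) $$ (j,j'))"
    obtain c where c: "T = c \<cdot>\<^sub>m 1\<^sub>m n"
      using schur_scalar[OF r, of T] intertwiner[OF rm rm ij _ T_def] by (auto simp: T_def)
    have "of_nat n * c = (\<Sum>k<n. T $$ (k,k))" by (simp add: c)
    also have "\<dots> = (\<Sum>k<n. \<Sum>g\<in>carrier G. \<rho> (inv g) $$ (j,k) * \<rho> g $$ (k,i))" by (simp add: T_def mult.commute)
    also have "\<dots> = (\<Sum>g\<in>carrier G. \<Sum>k<n. \<rho> (inv g) $$ (j,k) * \<rho> g $$ (k,i))" by (rule sum.swap)
    also have "\<dots> = (\<Sum>g\<in>carrier G. \<rho> (inv g \<otimes> g) $$ (j,i))"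
      by (intro sum.cong refl mat_rep_entry[OF rm, symmetric]) (use ij in auto)
    also have "\<dots> = (\<Sum>g\<in>carrier G. 1\<^sub>m n $$ (j,i))"
      by (intro sum.cong refl) (simp add: mat_repD(3)[OF rm])
    also have "\<dots> = (if i = j then of_nat (card (carrier G)) else 0)" using ij by simp
    finally have cc: "c = (if i = j then of_nat (card (carrier G)) / of_nat n else 0)"
      using n0 by (auto simp: field_simps split: if_splits)
    have "(\<Sum>g\<in>carrier G. \<rho> g $$ (i,i) * \<rho> (inv g) $$ (j,j)) = T $$ (i,j)" using ij by (simp add: T_def)
    also have "\<dots> = (if i = j then c else 0)" using ij by (simp add: c)
    finally show ?thesis using cc by simp
  qed
  have "(\<Sum>i<n. \<Sum>j<n. \<Sum>g\<in>carrier G. \<rho> g $$ (i,i) * \<rho> (inv g) $$ (j,j)) =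
     (\<Sum>i<n. \<Sum>j<n. if i = j then of_nat (card (carrier G)) / of_nat n else 0)"
    by (intro sum.cong refl) (simp add: ent)
  also have "\<dots> = of_nat (card (carrier G))" using n0 by simp
  finally show ?thesis unfolding char_product_sum[OF rm rm] .
qed

lemma Irr_orthogonal:
  fixes \<chi> \<eta> :: "'g \<Rightarrow> 'k::{alg_closed_field, field_char_0}"
  assumes "\<chi> \<in> Irr G" "\<eta> \<in> Irr G"
  shows "(\<Sum>g\<in>carrier G. \<chi> g * \<eta> (inv g)) = (if \<chi> = \<eta> then of_nat (card (carrier G)) else 0)"
proof -
  obtain n \<rho> where 1: "irr_rep G n \<rho>" "\<chi> = rep_char G n \<rho>" by (rule IrrE[OF assms(1)])
  obtain m \<tau> where 2: "irr_rep G m \<tau>" "\<eta> = rep_char G m \<tau>" by (rule IrrE[OF assms(2)])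
  show ?thesis using char_norm[OF 1(1)] char_orthogonal[OF 1(1) 2(1)] 1(2) 2(2) by auto
qed

end

section \<open>Completeness of the irreducible characters\<close>

context fin_group begin

text \<open>Restriction to an invariant subspace. The element \<open>z\<close> is carried along because irreducible
  constituents are sought on which a given idempotent still acts as the identity.\<close>

lemma sub_rep:
  fixes \<rho> :: "'g \<Rightarrow> 'k::field mat"
  assumes r: "mat_rep G n \<rho>" and W: "lin_subspace n W" and inv: "\<And>g w. g \<in> carrier G \<Longrightarrow> w \<in> W \<Longrightarrow> \<rho> g *\<^sub>v w \<in> W"
    and fx: "\<And>w. w \<in> W \<Longrightarrow> rep_ext G n \<rho> z *\<^sub>v w = w" and W0: "W \<noteq> {0\<^sub>v n}"
  obtains d \<tau> where "mat_rep G d \<tau>" "rep_ext G d \<tau> z = 1\<^sub>m d" "0 < d" "d \<le> n" "d = n \<longrightarrow> W = carrier_vec n"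
proof -
  obtain d B B' where B: "B \<in> carrier_mat n d" and B': "B' \<in> carrier_mat d n" and id: "B' * B = 1\<^sub>m d" and dn: "d \<le> n"
    and BW: "\<And>u. u \<in> carrier_vec d \<Longrightarrow> B *\<^sub>v u \<in> W" and BB: "\<And>w. w \<in> W \<Longrightarrow> B *\<^sub>v (B' *\<^sub>v w) = w"
    by (rule subspace_split[OF W]) blast
  have Wc: "w \<in> W \<Longrightarrow> w \<in> carrier_vec n" for w using W by (auto simp: lin_subspace_def)
  define \<tau> where "\<tau> g = B' * (\<rho> g * B)" for g
  note m = mat_repD(1)[OF r]
  have tc: "\<tau> g \<in> carrier_mat d d" if "g \<in> carrier G" for g unfolding \<tau>_def using B' m[OF that] B by auto
  have tv: "\<tau> g *\<^sub>v u = B' *\<^sub>v (\<rho> g *\<^sub>v (B *\<^sub>v u))" if g: "g \<in> carrier G" and u: "u \<in> carrier_vec d" for g u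
  proof -
    have rB: "\<rho> g * B \<in> carrier_mat n d" using m[OF g] B by auto
    show ?thesis unfolding \<tau>_def assoc_mult_mat_vec[OF B' rB u] assoc_mult_mat_vec[OF m[OF g] B u] ..
  qed
  have Btv: "B *\<^sub>v (\<tau> g *\<^sub>v u) = \<rho> g *\<^sub>v (B *\<^sub>v u)" if g: "g \<in> carrier G" and u: "u \<in> carrier_vec d" for g u
    unfolding tv[OF g u] by (rule BB[OF inv[OF g BW[OF u]]])
  have "mat_rep G d \<tau>" unfolding mat_rep_def
  proof (intro conjI ballI)
    fix g h assume g: "g \<in> carrier G" and h: "h \<in> carrier G"
    show "\<tau> (g \<otimes> h) = \<tau> g * \<tau> h"
    proof (rule mat_eq_by_vec[of _ d d])
      fix u :: "'k vec" assume u: "u \<in> carrier_vec d"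
      have Bu: "B *\<^sub>v u \<in> carrier_vec n" using B u by auto
      have tu: "\<tau> h *\<^sub>v u \<in> carrier_vec d" using tc[OF h] u by auto
      have "\<tau> (g \<otimes> h) *\<^sub>v u = B' *\<^sub>v (\<rho> g *\<^sub>v (\<rho> h *\<^sub>v (B *\<^sub>v u)))"
        unfolding tv[OF m_closed[OF g h] u] mat_repD(2)[OF r g h] assoc_mult_mat_vec[OF m[OF g] m[OF h] Bu] ..
      also have "\<dots> = \<tau> g *\<^sub>v (\<tau> h *\<^sub>v u)" unfolding tv[OF g tu] Btv[OF h u] ..
      also have "\<dots> = (\<tau> g * \<tau> h) *\<^sub>v u" using assoc_mult_mat_vec[OF tc[OF g] tc[OF h] u] by simp
      finally show "\<tau> (g \<otimes> h) *\<^sub>v u = (\<tau> g * \<tau> h) *\<^sub>v u" .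
    qed (use tc[OF g] tc[OF h] tc[OF m_closed[OF g h]] in auto)
  next
    have "1\<^sub>m n * B = B" using B by simp
    then show "\<tau> \<one> = 1\<^sub>m d" unfolding \<tau>_def mat_repD(3)[OF r] by (simp add: id)
  qed (rule tc)
  moreover have "rep_ext G d \<tau> z = 1\<^sub>m d"
  proof -
    let ?Z = "rep_ext G n \<rho> z"
    have ZB: "?Z * B \<in> carrier_mat n d" by (rule mult_carrier_mat[OF rep_ext_carrier B])
    have "rep_ext G d \<tau> z = B' * (?Z * B)"
    proof (rule eq_matI)
      fix i j assume "i < dim_row (B' * (?Z * B))" "j < dim_col (B' * (?Z * B))"
      then have ij: "i < d" "j < d" using B B' by auto
      have "\<tau> g $$ (i,j) = (\<Sum>k<n. \<Sum>l<n. B' $$ (i,k) * \<rho> g $$ (k,l) * B $$ (l,j))" if g: "g \<in> carrier G" for g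
      proof -
        have rB: "\<rho> g * B \<in> carrier_mat n d" using m[OF g] B by auto
        show ?thesis unfolding \<tau>_def mat_mult_entry[OF B' rB ij]
          by (intro sum.cong refl) (simp only: lessThan_iff mat_mult_entry[OF m[OF g] B _ ij(2)] sum_distrib_left mult.assoc)
      qed
      then have "rep_ext G d \<tau> z $$ (i,j) = (\<Sum>g\<in>carrier G. \<Sum>k<n. \<Sum>l<n. B' $$ (i,k) * (z g * \<rho> g $$ (k,l)) * B $$ (l,j))"
        unfolding rep_ext_entry[OF ij] by (intro sum.cong refl) (simp add: sum_distrib_left mult_ac)
      also have "\<dots> = (\<Sum>k<n. \<Sum>g\<in>carrier G. \<Sum>l<n. B' $$ (i,k) * (z g * \<rho> g $$ (k,l)) * B $$ (l,j))" by (rule sum.swap)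
      also have "\<dots> = (\<Sum>k<n. \<Sum>l<n. \<Sum>g\<in>carrier G. B' $$ (i,k) * (z g * \<rho> g $$ (k,l)) * B $$ (l,j))"
        by (intro sum.cong refl) (rule sum.swap)
      also have "\<dots> = (\<Sum>k<n. \<Sum>l<n. B' $$ (i,k) * ?Z $$ (k,l) * B $$ (l,j))"
        by (intro sum.cong refl) (simp add: rep_ext_entry sum_distrib_left sum_distrib_right)
      also have "\<dots> = (\<Sum>k<n. B' $$ (i,k) * (?Z * B) $$ (k,j))"
        by (intro sum.cong refl) (simp only: lessThan_iff mat_mult_entry[OF rep_ext_carrier B _ ij(2)] sum_distrib_left mult.assoc)
      also have "\<dots> = (B' * (?Z * B)) $$ (i,j)" by (rule mat_mult_entry[OF B' ZB ij, symmetric])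
      finally show "rep_ext G d \<tau> z $$ (i,j) = (B' * (?Z * B)) $$ (i,j)" .
    qed (use B B' in \<open>auto simp: rep_ext_def\<close>)
    also have "?Z * B = B"
    proof (rule mat_eq_by_vec[OF ZB B])
      fix u :: "'k vec" assume u: "u \<in> carrier_vec d"
      show "?Z * B *\<^sub>v u = B *\<^sub>v u" unfolding assoc_mult_mat_vec[OF rep_ext_carrier B u] by (rule fx[OF BW[OF u]])
    qed
    finally show ?thesis using id by simp
  qed
  moreover have "0 < d"
  proof (rule ccontr)
    assume "\<not> 0 < d"
    then have d: "d = 0" by simp
    have "w = 0\<^sub>v n" if w: "w \<in> W" for w
    proof -
      have u: "B' *\<^sub>v w \<in> carrier_vec 0" using B' Wc[OF w] d by auto
      have "B *\<^sub>v u = 0\<^sub>v n" if "u \<in> carrier_vec 0" for u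
        using B d that by (intro eq_vecI) (auto simp: scalar_prod_def)
      from this[OF u] show ?thesis using BB[OF w] by simp
    qed
    then show False using W0 W unfolding lin_subspace_def by blast
  qed
  moreover have "d = n \<longrightarrow> W = carrier_vec n"
  proof
    assume d: "d = n"
    have Bn: "B \<in> carrier_mat n n" "B' \<in> carrier_mat n n" "B' * B = 1\<^sub>m n" using B B' id d by auto
    have "B * B' = 1\<^sub>m n" by (rule mat_mult_left_right_inverse[OF Bn(2,1,3)])
    then have "v \<in> W" if v: "v \<in> carrier_vec n" for v
      using BW[of "B' *\<^sub>v v"] B' v d assoc_mult_mat_vec[OF B B' v] by simp
    then show "W = carrier_vec n" using Wc by blast
  qed
  ultimately show thesis using that dn by blast
qed

lemma irr_sub_rep:
  fixes \<rho> :: "'g \<Rightarrow> 'k::field mat"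
  assumes "mat_rep G n \<rho>" "rep_ext G n \<rho> z = 1\<^sub>m n" "0 < n"
  shows "\<exists>d \<tau>. irr_rep G d (\<tau> :: 'g \<Rightarrow> 'k mat) \<and> rep_ext G d \<tau> z = 1\<^sub>m d"
  using assms
proof (induction n arbitrary: \<rho> rule: less_induct)
  case (less n)
  show ?case
  proof (cases "irr_rep G n \<rho>")
    case True
    then show ?thesis using less.prems by blast
  next
    case False
    then obtain W where W: "lin_subspace n W" "\<And>g w. g \<in> carrier G \<Longrightarrow> w \<in> W \<Longrightarrow> \<rho> g *\<^sub>v w \<in> W"
      "W \<noteq> {0\<^sub>v n}" "W \<noteq> carrier_vec n"
      using less.prems unfolding irr_rep_def by blast
    have fx: "rep_ext G n \<rho> z *\<^sub>v w = w" if "w \<in> W" for w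
      using that W(1) unfolding lin_subspace_def less.prems(2) by auto
    obtain d \<tau> where d: "mat_rep G d \<tau>" "rep_ext G d \<tau> z = 1\<^sub>m d" "0 < d" "d \<le> n" "d = n \<longrightarrow> W = carrier_vec n"
      by (rule sub_rep[OF less.prems(1) W(1,2) fx W(3)]) blast
    then have "d < n" using W(4) by linarith
    then show ?thesis using less.IH[of d \<tau>] d by blast
  qed
qed

text \<open>In the regular representation the idempotent fixes itself, so its fixed space is a nonzero
  invariant subspace, and it acts as the identity on an irreducible constituent of it.\<close>

lemma central_idempotent_irr:
  fixes f :: "'g \<Rightarrow> 'k::{alg_closed_field, field_char_0}"
  assumes f: "class_fun G f" and ff: "conv G f f = f" and f0: "f \<noteq> (\<lambda>_. 0)"
  shows "\<exists>\<chi> \<in> Irr G. omega G \<chi> f = 1"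
proof -
  define N where "N = card (carrier G)"
  obtain e where e: "bij_betw e {..<N} (carrier G)"
    using ex_bij_betw_nat_finite[OF fin] unfolding N_def atLeast0LessThan by blast
  have eG: "e i \<in> carrier G" if "i < N" for i using bij_betwE[OF e] that by blast
  have einj: "e i = e j \<longleftrightarrow> i = j" if "i < N" "j < N" for i j
    using e that by (auto simp: bij_betw_def inj_on_def)
  have sum_e: "(\<Sum>i<N. h (e i)) = (\<Sum>g\<in>carrier G. h g)" for h :: "'g \<Rightarrow> 'k"
    by (rule sum.reindex_bij_betw[OF e])
  (* The left regular representation. *)
  define \<rho> where "\<rho> g = mat N N (\<lambda>(i,j). if e i = g \<otimes> e j then 1 else (0::'k))" for g
  have rc: "\<rho> g \<in> carrier_mat N N" for g by (simp add: \<rho>_def)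
  have r: "mat_rep G N \<rho>" unfolding mat_rep_def
  proof (intro conjI ballI)
    fix g h assume g: "g \<in> carrier G" and h: "h \<in> carrier G"
    show "\<rho> (g \<otimes> h) = \<rho> g * \<rho> h"
    proof (rule eq_matI)
      fix i j assume "i < dim_row (\<rho> g * \<rho> h)" "j < dim_col (\<rho> g * \<rho> h)"
      then have ij: "i < N" "j < N" by (auto simp: \<rho>_def)
      have "(\<rho> g * \<rho> h) $$ (i,j) = (\<Sum>l<N. \<rho> g $$ (i,l) * \<rho> h $$ (l,j))" by (rule mat_mult_entry[OF rc rc ij])
      also have "\<dots> = (\<Sum>l<N. (if e i = g \<otimes> e l then 1 else 0) * (if e l = h \<otimes> e j then 1 else 0))"
        using ij by (intro sum.cong refl) (simp add: \<rho>_def)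
      also have "\<dots> = (\<Sum>x\<in>carrier G. (if e i = g \<otimes> x then 1 else 0) * (if x = h \<otimes> e j then 1 else 0))"
        by (rule sum_e)
      also have "\<dots> = (\<Sum>x\<in>carrier G. if x = h \<otimes> e j then (if e i = g \<otimes> (h \<otimes> e j) then 1 else 0) else 0)"
        by (intro sum.cong refl) simp
      also have "\<dots> = (if e i = g \<otimes> (h \<otimes> e j) then 1 else 0)" using fin h eG[OF ij(2)] by simp
      also have "\<dots> = \<rho> (g \<otimes> h) $$ (i,j)" using ij g h eG[OF ij(2)] by (simp add: \<rho>_def m_assoc)
      finally show "\<rho> (g \<otimes> h) $$ (i,j) = (\<rho> g * \<rho> h) $$ (i,j)" by simp
    qed (auto simp: \<rho>_def)
  next
    show "\<rho> \<one> = 1\<^sub>m N" by (rule eq_matI) (auto simp: \<rho>_def eG einj)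
  qed (rule rc)
  define F where "F = rep_ext G N \<rho> f"
  have Fc: "F \<in> carrier_mat N N" by (simp add: F_def)
  (* The idempotent itself, as a vector of the regular representation. *)
  define v where "v = vec N (\<lambda>i. f (e i))"
  have v: "v \<in> carrier_vec N" by (simp add: v_def)
  have Fe: "F $$ (i,j) = f (e i \<otimes> inv (e j))" if ij: "i < N" "j < N" for i j
  proof -
    have "F $$ (i,j) = (\<Sum>g\<in>carrier G. f g * \<rho> g $$ (i,j))" unfolding F_def by (rule rep_ext_entry[OF ij])
    also have "\<dots> = (\<Sum>g\<in>carrier G. if g = e i \<otimes> inv (e j) then f g else 0)"
    proof (intro sum.cong refl)
      fix g assume g: "g \<in> carrier G"
      have "e i = g \<otimes> e j \<longleftrightarrow> g = e i \<otimes> inv (e j)" using g eG[OF ij(1)] eG[OF ij(2)] by (metis inv_solve_right)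
      then show "f g * \<rho> g $$ (i,j) = (if g = e i \<otimes> inv (e j) then f g else 0)" using ij by (simp add: \<rho>_def)
    qed
    also have "\<dots> = f (e i \<otimes> inv (e j))" using fin eG[OF ij(1)] eG[OF ij(2)] by simp
    finally show ?thesis .
  qed
  have Fv: "F *\<^sub>v v = v"
  proof (rule eq_vecI)
    fix i assume "i < dim_vec v"
    then have i: "i < N" by (simp add: v_def)
    note gi = eG[OF i]
    have "(F *\<^sub>v v) $ i = (\<Sum>l<N. F $$ (i,l) * v $ l)" by (rule mat_vec_entry[OF Fc v i])
    also have "\<dots> = (\<Sum>l<N. f (e i \<otimes> inv (e l)) * f (e l))"
      using i by (intro sum.cong refl) (simp add: Fe v_def)
    also have "\<dots> = (\<Sum>x\<in>carrier G. f (e i \<otimes> inv x) * f x)" by (rule sum_e)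
    also have "\<dots> = (\<Sum>x\<in>carrier G. f x * f (inv x \<otimes> e i))"
      by (intro sum.cong refl) (simp add: class_fun_swap[OF f gi] mult.commute)
    also have "\<dots> = conv G f f (e i)" using gi by (simp add: conv_def)
    finally show "(F *\<^sub>v v) $ i = v $ i" using i by (simp add: ff v_def)
  qed (use Fc v in auto)
  define W where "W = {w \<in> carrier_vec N. F *\<^sub>v w = w}"
  have W: "lin_subspace N W" unfolding lin_subspace_def W_def using Fc
    by (auto simp: mult_add_distrib_mat_vec[OF Fc] mult_mat_vec[OF Fc])
  have Winv: "\<rho> g *\<^sub>v w \<in> W" if g: "g \<in> carrier G" and w: "w \<in> W" for g w
  proof -
    have wc: "w \<in> carrier_vec N" "F *\<^sub>v w = w" using w by (auto simp: W_def)
    have "F *\<^sub>v (\<rho> g *\<^sub>v w) = \<rho> g *\<^sub>v (F *\<^sub>v w)"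
      unfolding assoc_mult_mat_vec[OF Fc rc wc(1), symmetric] rep_ext_central[OF r f g, folded F_def, symmetric]
      by (rule assoc_mult_mat_vec[OF rc Fc wc(1)])
    then show ?thesis using mult_mat_vec_carrier[OF rc wc(1), of g] wc by (simp add: W_def)
  qed
  obtain x where "f x \<noteq> 0" using f0 by auto
  then have "x \<in> carrier G" using f by (auto simp: class_fun_def)
  moreover have "carrier G = e ` {..<N}" using e by (simp add: bij_betw_def)
  ultimately have "x \<in> e ` {..<N}" by simp
  then obtain i where i: "i < N" "e i = x" by (elim imageE) simp
  have "v \<noteq> 0\<^sub>v N"
  proof
    assume "v = 0\<^sub>v N"
    then have "v $ i = 0" using i by simp
    then show False using i \<open>f x \<noteq> 0\<close> by (simp add: v_def)
  qed
  moreover have "v \<in> W" using v Fv by (simp add: W_def)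
  ultimately have W0: "W \<noteq> {0\<^sub>v N}" by blast
  have fixW: "rep_ext G N \<rho> f *\<^sub>v w = w" if "w \<in> W" for w using that by (simp add: W_def F_def)
  obtain d \<tau> where "mat_rep G d \<tau>" "rep_ext G d \<tau> f = 1\<^sub>m d" "0 < d"
    by (rule sub_rep[OF r W Winv fixW W0]) blast
  then obtain d \<tau> where t: "irr_rep G d (\<tau> :: 'g \<Rightarrow> 'k mat)" "rep_ext G d \<tau> f = 1\<^sub>m d" using irr_sub_rep by blast
  have "omega G (rep_char G d \<tau>) f \<cdot>\<^sub>m 1\<^sub>m d = 1 \<cdot>\<^sub>m 1\<^sub>m d"
    unfolding rep_ext_irr[OF t(1) f, symmetric] t(2) by (rule eq_matI) auto
  then have "omega G (rep_char G d \<tau>) f = 1" using smult_one_eqD irr_repD(2)[OF t(1)] by blast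
  then show ?thesis using t(1) unfolding Irr_def by blast
qed

lemma conv_eidem:
  fixes \<chi> :: "'g \<Rightarrow> 'k::{alg_closed_field, field_char_0}"
  assumes x: "\<chi> \<in> Irr G" and z: "class_fun G z"
  shows "conv G z (eidem G \<chi>) = (\<lambda>g. omega G \<chi> z * eidem G \<chi> g)"
proof (rule ext)
  fix g
  obtain n \<rho> where r: "irr_rep G n \<rho>" and c: "\<chi> = rep_char G n \<rho>" and n: "\<chi> \<one> = of_nat n" "n > 0" by (rule IrrE[OF x])
  note m = irr_repD(1)[OF r]
  show "conv G z (eidem G \<chi>) g = omega G \<chi> z * eidem G \<chi> g"
  proof (cases "g \<in> carrier G")
    case True
    have "(\<Sum>y\<in>carrier G. z y * \<chi> (inv g \<otimes> y)) = (\<Sum>y\<in>carrier G. \<Sum>i<n. z y * \<rho> (inv g \<otimes> y) $$ (i,i))"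
      using True by (intro sum.cong refl) (simp add: c rep_char_def sum_distrib_left)
    also have "\<dots> = (\<Sum>i<n. \<Sum>y\<in>carrier G. z y * \<rho> (inv g \<otimes> y) $$ (i,i))" by (rule sum.swap)
    also have "\<dots> = (\<Sum>i<n. (\<rho> (inv g) * rep_ext G n \<rho> z) $$ (i,i))"
      using True by (intro sum.cong refl) (simp add: rep_ext_translate(1)[OF m])
    also have "\<rho> (inv g) * rep_ext G n \<rho> z = omega G \<chi> z \<cdot>\<^sub>m \<rho> (inv g)"
    proof -
      have R: "\<rho> (inv g) \<in> carrier_mat n n" using mat_repD(1)[OF m, of "inv g"] True by simp
      show ?thesis unfolding rep_ext_irr[OF r z] c mult_smult_distrib[OF R one_carrier_mat] right_mult_one_mat[OF R] ..
    qed
    also have "(\<Sum>i<n. (omega G \<chi> z \<cdot>\<^sub>m \<rho> (inv g)) $$ (i,i)) = omega G \<chi> z * \<chi> (inv g)"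
      using mat_repD(1)[OF m, of "inv g"] True by (simp add: c rep_char_def sum_distrib_left)
    finally have key: "(\<Sum>y\<in>carrier G. z y * \<chi> (inv g \<otimes> y)) = omega G \<chi> z * \<chi> (inv g)" .
    have "conv G z (eidem G \<chi>) g = (\<Sum>y\<in>carrier G. \<chi> \<one> / of_nat (card (carrier G)) * (z y * \<chi> (inv g \<otimes> y)))"
      using True by (auto simp: conv_def eidem_def inv_mult_group intro!: sum.cong)
    also have "\<dots> = omega G \<chi> z * eidem G \<chi> g" unfolding sum_distrib_left[symmetric] key using True by (simp add: eidem_def)
    finally show ?thesis .
  qed (simp add: conv_def eidem_def)
qed

lemma omega_eidem:
  fixes \<chi> \<eta> :: "'g \<Rightarrow> 'k::{alg_closed_field, field_char_0}"
  assumes x: "\<chi> \<in> Irr G" and y: "\<eta> \<in> Irr G"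
  shows "omega G \<chi> (eidem G \<eta>) = (if \<chi> = \<eta> then 1 else 0)"
proof -
  obtain n where n: "\<chi> \<one> = of_nat n" "n > 0" by (rule IrrE[OF x])
  have "(\<Sum>g\<in>carrier G. eidem G \<eta> g * \<chi> g) = (\<Sum>g\<in>carrier G. \<eta> \<one> / of_nat (card (carrier G)) * (\<chi> g * \<eta> (inv g)))"
    by (intro sum.cong refl) (simp add: eidem_def)
  also have "\<dots> = (if \<chi> = \<eta> then \<eta> \<one> else 0)"
    unfolding sum_distrib_left[symmetric] Irr_orthogonal[OF x y] using card_pos by simp
  finally show ?thesis using n by (cases "\<chi> = \<eta>") (auto simp: omega_def)
qed

text \<open>The orthogonality relations give the matrix of values of finitely many characters a left
  inverse, so their number is at most the order of the group.\<close>

lemma finite_Irr: "finite (Irr G :: ('g \<Rightarrow> 'k::{alg_closed_field, field_char_0}) set)"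
proof -
  have "card F \<le> card (carrier G)" if F: "F \<subseteq> Irr G" "finite F" for F :: "('g \<Rightarrow> 'k) set"
  proof -
    define N where "N = card (carrier G)"
    have N0: "(of_nat N :: 'k) \<noteq> 0" using card_pos by (simp add: N_def)
    obtain e where e: "bij_betw e {..<N} (carrier G)"
      using ex_bij_betw_nat_finite[OF fin] unfolding N_def atLeast0LessThan by blast
    obtain c where c: "bij_betw c {..<card F} F"
      using ex_bij_betw_nat_finite[OF F(2)] unfolding atLeast0LessThan by blast
    have cI: "c i \<in> Irr G" if "i < card F" for i using bij_betwE[OF c] that F(1) by blast
    have cinj: "c i = c j \<longleftrightarrow> i = j" if "i < card F" "j < card F" for i j
      using c that by (auto simp: bij_betw_def inj_on_def)
    define B where "B = mat N (card F) (\<lambda>(i,k). c k (e i))"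
    define B' where "B' = mat (card F) N (\<lambda>(k,i). c k (inv (e i)) / of_nat N)"
    have B: "B \<in> carrier_mat N (card F)" and B': "B' \<in> carrier_mat (card F) N" by (auto simp: B_def B'_def)
    have "B' * B = 1\<^sub>m (card F)"
    proof (rule eq_matI)
      fix i j assume "i < dim_row (1\<^sub>m (card F))" "j < dim_col (1\<^sub>m (card F))"
      then have ij: "i < card F" "j < card F" by auto
      have "(B' * B) $$ (i,j) = (\<Sum>l<N. B' $$ (i,l) * B $$ (l,j))" by (rule mat_mult_entry[OF B' B ij])
      also have "\<dots> = (\<Sum>l<N. c j (e l) * c i (inv (e l)) / of_nat N)"
        using ij by (intro sum.cong refl) (simp add: B_def B'_def)
      also have "\<dots> = (\<Sum>g\<in>carrier G. c j g * c i (inv g) / of_nat N)" by (rule sum.reindex_bij_betw[OF e])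
      also have "\<dots> = (if i = j then 1 else 0)"
        unfolding sum_divide_distrib[symmetric] Irr_orthogonal[OF cI[OF ij(2)] cI[OF ij(1)]]
        using N0 ij by (auto simp: cinj N_def)
      finally show "(B' * B) $$ (i,j) = 1\<^sub>m (card F) $$ (i,j)" using ij by simp
    qed (use B B' in auto)
    then show ?thesis using left_inverse_dim[OF B B'] by (simp add: N_def)
  qed
  then show ?thesis using finite_if_finite_subsets_card_bdd by blast
qed

lemma class_fun_sum: "(\<And>i. i \<in> I \<Longrightarrow> class_fun G (f i)) \<Longrightarrow> class_fun G (\<lambda>g. \<Sum>i\<in>I. f i g)"
  by (auto simp: class_fun_def)

lemma class_fun_diff: "class_fun G a \<Longrightarrow> class_fun G b \<Longrightarrow> class_fun G (\<lambda>g. a g - b g)"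
  by (auto simp: class_fun_def)

lemma class_fun_smult: "class_fun G a \<Longrightarrow> class_fun G (\<lambda>g. c * a g)"
  by (auto simp: class_fun_def)

lemma class_fun_delta1: "class_fun G (delta1 G)"
proof -
  have "x \<otimes> g \<otimes> inv x = \<one> \<longleftrightarrow> g = \<one>" if "x \<in> carrier G" "g \<in> carrier G" for x g
    using that by (metis inv_solve_right' inv_closed l_cancel_one m_closed one_closed r_cancel_one r_inv r_one)
  then show ?thesis by (auto simp: class_fun_def delta1_def)
qed

lemma omega_diff: "omega G \<chi> (\<lambda>g. a g - b g) = omega G \<chi> a - omega G \<chi> b"
  by (simp add: omega_def left_diff_distrib sum_subtractf diff_divide_distrib)

lemma omega_sum: "omega G \<chi> (\<lambda>g. \<Sum>i\<in>I. f i g) = (\<Sum>i\<in>I. omega G \<chi> (f i))"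
  unfolding omega_def sum_divide_distrib[symmetric] sum_distrib_right by (subst sum.swap) simp

lemma omega_delta1:
  assumes "\<chi> \<in> Irr G" shows "omega G (\<chi> :: 'g \<Rightarrow> 'k::field_char_0) (delta1 G) = 1"
proof -
  obtain n where n: "\<chi> \<one> = of_nat n" "n > 0" by (rule IrrE[OF assms])
  have "(\<Sum>g\<in>carrier G. delta1 G g * \<chi> g) = (\<Sum>g\<in>carrier G. if g = \<one> then \<chi> g else 0)"
    by (intro sum.cong refl) (simp add: delta1_def)
  then show ?thesis using n fin by (simp add: omega_def)
qed

text \<open>The difference of the two sides is a central idempotent killed by every central character,
  so it is zero.\<close>

lemma sum_eidem: "(\<lambda>g. \<Sum>\<chi>\<in>Irr G. eidem G \<chi> g) = (delta1 G :: 'g \<Rightarrow> 'k::{alg_closed_field, field_char_0})"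
proof -
  let ?I = "Irr G :: ('g \<Rightarrow> 'k) set"
  define f where "f = (\<lambda>g. delta1 G g - (\<Sum>\<chi>\<in>?I. eidem G \<chi> g))"
  have ce: "class_fun G (\<lambda>g. \<Sum>\<chi>\<in>?I. eidem G \<chi> g)" by (intro class_fun_sum eidem_class_fun Irr_class_fun)
  have cf: "class_fun G f" unfolding f_def by (intro class_fun_diff class_fun_delta1 ce)
  have om: "omega G \<chi> f = 0" if x: "\<chi> \<in> ?I" for \<chi>
  proof -
    have "(\<Sum>\<eta>\<in>?I. omega G \<chi> (eidem G \<eta>)) = (\<Sum>\<eta>\<in>?I. if \<chi> = \<eta> then 1 else 0)"
      by (intro sum.cong refl) (simp add: omega_eidem[OF x])
    also have "\<dots> = 1" using finite_Irr x by (subst sum.delta') auto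
    finally show ?thesis unfolding f_def omega_diff omega_sum omega_delta1[OF x] by simp
  qed
  have "conv G f f = (\<lambda>g. conv G f (delta1 G) g - (\<Sum>\<chi>\<in>?I. conv G f (eidem G \<chi>) g))"
    unfolding conv_sum_right[symmetric, THEN fun_cong] conv_diff_right[symmetric] by (simp add: f_def)
  also have "\<dots> = f" by (simp add: conv_delta1[OF cf] conv_eidem[OF _ cf] om)
  finally have "f = (\<lambda>_. 0)" using central_idempotent_irr[OF cf] om by fastforce
  then show ?thesis unfolding f_def by (metis (no_types, lifting) eq_iff_diff_eq_0 ext)
qed

lemma class_fun_expand:
  fixes z :: "'g \<Rightarrow> 'k::{alg_closed_field, field_char_0}"
  assumes z: "class_fun G z"
  shows "z = (\<lambda>g. \<Sum>\<chi>\<in>Irr G. omega G \<chi> z * eidem G \<chi> g)"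
proof -
  have "z = conv G z (\<lambda>g. \<Sum>\<chi>\<in>Irr G. eidem G \<chi> g)" unfolding sum_eidem by (rule conv_delta1[OF z, symmetric])
  also have "\<dots> = (\<lambda>g. \<Sum>\<chi>\<in>Irr G. omega G \<chi> z * eidem G \<chi> g)"
    unfolding conv_sum_right by (rule ext, rule sum.cong[OF refl]) (simp add: conv_eidem[OF _ z])
  finally show ?thesis .
qed

lemma periodic_sum_shift:
  fixes F :: "nat \<Rightarrow> 'a::comm_ring_1"
  assumes "\<And>j. F (j + n) = F j"
  shows "(\<Sum>l<n. F (k + l)) = (\<Sum>l<n. F l)"
proof (induction k)
  case (Suc k)
  have "(\<Sum>l<n. F (Suc k + l)) + F k = F (k + n) + (\<Sum>l<n. F (k + l))"
    using sum.lessThan_Suc_shift[of "\<lambda>l. F (k + l)" n] by (simp add: add.commute)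
  then show ?case using assms[of k] Suc by simp
qed simp

lemma char_power_values:
  fixes \<chi> :: "'g \<Rightarrow> 'k::{alg_closed_field, field_char_0}"
  assumes x: "\<chi> \<in> Irr G" and g: "g \<in> carrier G" and z: "primroot n \<zeta>" and gn: "g [^] n = \<one>"
  obtains t :: "nat \<Rightarrow> nat" where "\<And>s. \<chi> (g [^] s) = (\<Sum>m<n. of_nat (t m) * \<zeta> ^ (m * s))"
proof -
  obtain d \<rho> where r: "irr_rep G d \<rho>" and c: "\<chi> = rep_char G d \<rho>" by (rule IrrE[OF x])
  note rm = irr_repD(1)[OF r]
  have n0: "n > 0" and z1: "\<And>k. \<zeta> ^ k = 1 \<longleftrightarrow> n dvd k" using z by (auto simp: primroot_def)
  have nn: "(of_nat n :: 'k) \<noteq> 0" using n0 by simp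
  (* The averages f m below project to the eigenspace of \<rho> g for the eigenvalue \<zeta>\<^sup>m, so t m is its
     multiplicity. The exponent (n - 1) * m * k stands for -m * k. *)
  define F where "F m k = \<zeta> ^ ((n - 1) * m * k) \<cdot>\<^sub>m \<rho> (g [^] k)" for m k :: nat
  have rc: "\<rho> (g [^] k) \<in> carrier_mat d d" for k :: nat using mat_repD(1)[OF rm] g by simp
  have Fe: "F m k $$ (i,j) = \<zeta> ^ ((n - 1) * m * k) * \<rho> (g [^] k) $$ (i,j)" if "i < d" "j < d" for m k i j
    using rc[of k] that by (auto simp: F_def)
  have Fper: "F m (k + n) $$ (i,j) = F m k $$ (i,j)" if ij: "i < d" "j < d" for m k i j
  proof -
    have "\<zeta> ^ ((n - 1) * m * (k + n)) = \<zeta> ^ ((n - 1) * m * k) * \<zeta> ^ (n * ((n - 1) * m))"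
      unfolding power_add[symmetric] by (rule arg_cong[where f = "\<lambda>e. \<zeta> ^ e"]) (simp only: distrib_left mult_ac)
    also have "\<zeta> ^ (n * ((n - 1) * m)) = 1" by (simp only: z1) simp
    finally have "\<zeta> ^ ((n - 1) * m * (k + n)) = \<zeta> ^ ((n - 1) * m * k)" by simp
    moreover have "g [^] (k + n) = g [^] k" using g gn by (simp add: nat_pow_mult[symmetric])
    ultimately show ?thesis unfolding Fe[OF ij] by simp
  qed
  have Fmul: "(\<Sum>l<d. F m k $$ (i,l) * F m k' $$ (l,j)) = F m (k + k') $$ (i,j)" if ij: "i < d" "j < d" for m k k' i j
  proof -
    have "(\<Sum>l<d. F m k $$ (i,l) * F m k' $$ (l,j)) =
      (\<Sum>l<d. \<zeta> ^ ((n - 1) * m * (k + k')) * (\<rho> (g [^] k) $$ (i,l) * \<rho> (g [^] k') $$ (l,j)))"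
      using ij by (intro sum.cong refl) (simp only: lessThan_iff Fe distrib_left power_add mult_ac)
    also have "\<dots> = \<zeta> ^ ((n - 1) * m * (k + k')) * \<rho> (g [^] k \<otimes> g [^] k') $$ (i,j)"
      unfolding sum_distrib_left[symmetric] by (subst mat_rep_entry[OF rm _ _ ij]) (use g in auto)
    finally show ?thesis using ij g by (simp add: Fe nat_pow_mult)
  qed
  define f where "f m = mat d d (\<lambda>(i,j). (\<Sum>k<n. F m k $$ (i,j)) / of_nat n)" for m
  have fc: "f m \<in> carrier_mat d d" for m by (simp add: f_def)
  have "f m * f m = f m" for m
  proof (rule eq_matI)
    fix i j assume "i < dim_row (f m)" "j < dim_col (f m)"
    then have ij: "i < d" "j < d" by (auto simp: f_def)
    have "(f m * f m) $$ (i,j) = (\<Sum>l<d. f m $$ (i,l) * f m $$ (l,j))" by (rule mat_mult_entry[OF fc fc ij])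
    also have "\<dots> = (\<Sum>l<d. (\<Sum>k<n. \<Sum>k'<n. F m k $$ (i,l) * F m k' $$ (l,j)) / (of_nat n * of_nat n))"
      using ij by (intro sum.cong refl) (simp add: f_def sum_product)
    also have "\<dots> = (\<Sum>l<d. \<Sum>k<n. \<Sum>k'<n. F m k $$ (i,l) * F m k' $$ (l,j)) / (of_nat n * of_nat n)"
      by (simp add: sum_divide_distrib)
    also have "(\<Sum>l<d. \<Sum>k<n. \<Sum>k'<n. F m k $$ (i,l) * F m k' $$ (l,j)) = (\<Sum>k<n. \<Sum>l<d. \<Sum>k'<n. F m k $$ (i,l) * F m k' $$ (l,j))"
      by (rule sum.swap)
    also have "\<dots> = (\<Sum>k<n. \<Sum>k'<n. \<Sum>l<d. F m k $$ (i,l) * F m k' $$ (l,j))"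
      by (rule sum.cong[OF refl], rule sum.swap)
    also have "\<dots> = (\<Sum>k<n. \<Sum>k'<n. F m (k + k') $$ (i,j))" by (simp only: Fmul[OF ij])
    also have "\<dots> = (\<Sum>k<n. \<Sum>k'<n. F m k' $$ (i,j))"
      by (intro sum.cong refl periodic_sum_shift[where F = "\<lambda>k. F m k $$ (i,j)"] Fper[OF ij])
    also have "\<dots> = of_nat n * (\<Sum>k'<n. F m k' $$ (i,j))" by simp
    finally show "(f m * f m) $$ (i,j) = f m $$ (i,j)" using ij nn by (simp add: f_def)
  qed (auto simp: f_def)
  then have "\<exists>t. mtrace (f m) = of_nat t" for m using idempotent_trace[OF fc] by blast
  then obtain t where t: "\<And>m. mtrace (f m) = of_nat (t m)" by metis
  have tm: "of_nat (t m) = (\<Sum>k<n. \<zeta> ^ ((n - 1) * m * k) * \<chi> (g [^] k)) / of_nat n" for m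
  proof -
    have "mtrace (f m) = (\<Sum>i<d. \<Sum>k<n. F m k $$ (i,i)) / of_nat n"
      by (simp add: mtrace_def f_def sum_divide_distrib)
    also have "(\<Sum>i<d. \<Sum>k<n. F m k $$ (i,i)) = (\<Sum>k<n. \<Sum>i<d. F m k $$ (i,i))" by (rule sum.swap)
    also have "\<dots> = (\<Sum>k<n. \<zeta> ^ ((n - 1) * m * k) * \<chi> (g [^] k))"
      using g by (intro sum.cong refl) (simp add: Fe c rep_char_def sum_distrib_left)
    finally show ?thesis using t by simp
  qed
  have "\<chi> (g [^] s) = (\<Sum>m<n. of_nat (t m) * \<zeta> ^ (m * s))" for s
  proof -
    have "(\<Sum>m<n. of_nat (t m) * \<zeta> ^ (m * s)) =
       (\<Sum>m<n. \<Sum>k<n. \<chi> (g [^] k) * \<zeta> ^ (m * (s + (n - 1) * k))) / of_nat n"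
      unfolding tm sum_divide_distrib sum_distrib_right
      by (intro sum.cong refl) (simp only: distrib_left power_add times_divide_eq_left times_divide_eq_right mult_ac)
    also have "(\<Sum>m<n. \<Sum>k<n. \<chi> (g [^] k) * \<zeta> ^ (m * (s + (n - 1) * k))) =
       (\<Sum>k<n. \<chi> (g [^] k) * (\<Sum>m<n. \<zeta> ^ (m * (s + (n - 1) * k))))"
      by (subst sum.swap) (simp add: sum_distrib_left)
    also have "\<dots> = (\<Sum>k<n. if k = s mod n then of_nat n * \<chi> (g [^] k) else 0)"
    proof (intro sum.cong refl)
      fix k assume "k \<in> {..<n}"
      then have k: "k < n" by simp
      have "s + (n - 1) * k + k = s + n * k" using n0 by (cases n) auto
      then have "(s + (n - 1) * k + k) mod n = s mod n" by (simp only: mod_mult_self2)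
      then have e: "(s + (n - 1) * k + k) mod n = k mod n \<longleftrightarrow> s mod n = k" using k by simp
      have "n dvd s + (n - 1) * k \<longleftrightarrow> k = s mod n"
      proof
        assume "n dvd s + (n - 1) * k"
        then obtain w where "s + (n - 1) * k = n * w" by blast
        then have "(s + (n - 1) * k + k) mod n = k mod n" by (simp only: mod_mult_self4)
        then show "k = s mod n" using e by simp
      next
        assume "k = s mod n"
        then have "(s + (n - 1) * k + k) mod n = k mod n" using e by simp
        then have "n dvd (s + (n - 1) * k + k) - k" by (subst (asm) mod_eq_dvd_iff_nat) auto
        then show "n dvd s + (n - 1) * k" by simp
      qed
      then show "\<chi> (g [^] k) * (\<Sum>m<n. \<zeta> ^ (m * (s + (n - 1) * k))) = (if k = s mod n then of_nat n * \<chi> (g [^] k) else 0)"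
        unfolding primroot_sum[OF z] by simp
    qed
    also have "\<dots> = of_nat n * \<chi> (g [^] (s mod n))" using n0 by simp
    also have "g [^] (s mod n) = g [^] s"
    proof -
      have "g [^] s = g [^] (n * (s div n) + s mod n)" by simp
      also have "\<dots> = g [^] (n * (s div n)) \<otimes> g [^] (s mod n)" using g by (simp only: nat_pow_mult)
      also have "g [^] (n * (s div n)) = \<one>" using g gn by (simp add: nat_pow_pow[symmetric])
      finally show ?thesis using g by simp
    qed
    finally show ?thesis using nn by simp
  qed
  then show thesis by (rule that)
qed

end

section \<open>Conjugacy classes and central characters\<close>

context fin_group begin

lemma inv_cancel:
  assumes "x \<in> carrier G" "y \<in> carrier G"
  shows "x \<otimes> (inv x \<otimes> y) = y" "inv x \<otimes> (x \<otimes> y) = y" "y \<otimes> x \<otimes> inv x = y" "y \<otimes> inv x \<otimes> x = y"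
  using assms by (simp_all add: m_assoc[symmetric]) (simp_all add: m_assoc)

lemma conj_class_subset: "g \<in> carrier G \<Longrightarrow> conj_class G g \<subseteq> carrier G"
  by (auto simp: conj_class_def)

lemma conj_class_self: "g \<in> carrier G \<Longrightarrow> g \<in> conj_class G g"
  by (auto simp: conj_class_def intro!: exI[of _ \<one>])

lemma conj_comp:
  assumes "x \<in> carrier G" "y \<in> carrier G" "g \<in> carrier G"
  shows "x \<otimes> (y \<otimes> g \<otimes> inv y) \<otimes> inv x = (x \<otimes> y) \<otimes> g \<otimes> inv (x \<otimes> y)"
  using assms by (simp add: m_assoc inv_mult_group)

lemma conj_inv_cancel:
  assumes "y \<in> carrier G" "g \<in> carrier G"
  shows "inv y \<otimes> (y \<otimes> g \<otimes> inv y) \<otimes> inv (inv y) = g"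
  unfolding conj_comp[OF inv_closed[OF assms(1)] assms] using assms by (simp add: inv_mult_group)

lemma conj_class_conj:
  assumes "y \<in> carrier G" "g \<in> carrier G"
  shows "conj_class G (y \<otimes> g \<otimes> inv y) = conj_class G g"
proof (intro equalityI subsetI)
  fix u assume "u \<in> conj_class G (y \<otimes> g \<otimes> inv y)"
  then obtain x where "x \<in> carrier G" "u = x \<otimes> (y \<otimes> g \<otimes> inv y) \<otimes> inv x" by (auto simp: conj_class_def)
  then show "u \<in> conj_class G g" using assms conj_comp[of x y g] unfolding conj_class_def by blast
next
  fix u assume "u \<in> conj_class G g"
  then obtain x where x: "x \<in> carrier G" "u = x \<otimes> g \<otimes> inv x" by (auto simp: conj_class_def)
  have "x \<otimes> inv y \<otimes> (y \<otimes> g \<otimes> inv y) \<otimes> inv (x \<otimes> inv y) = x \<otimes> (inv y \<otimes> (y \<otimes> g \<otimes> inv y) \<otimes> inv (inv y)) \<otimes> inv x"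
    using assms x by (intro conj_comp[symmetric]) auto
  also have "\<dots> = u" unfolding conj_inv_cancel[OF assms] x(2) ..
  finally show "u \<in> conj_class G (y \<otimes> g \<otimes> inv y)" using assms x unfolding conj_class_def
    by (intro CollectI exI[of _ "x \<otimes> inv y"]) auto
qed

lemma conj_class_eq: "g \<in> carrier G \<Longrightarrow> h \<in> conj_class G g \<Longrightarrow> conj_class G h = conj_class G g"
  using conj_class_conj by (auto simp: conj_class_def[of G g])

lemma conj_classesE:
  assumes "C \<in> conj_classes G" obtains g where "g \<in> carrier G" "C = conj_class G g"
  using assms by (auto simp: conj_classes_def)

lemma conj_class_eqI: "C \<in> conj_classes G \<Longrightarrow> g \<in> C \<Longrightarrow> C = conj_class G g"
  using conj_class_eq by (auto elim!: conj_classesE)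

lemma conj_class_carrier: "C \<in> conj_classes G \<Longrightarrow> g \<in> C \<Longrightarrow> g \<in> carrier G"
  using conj_class_subset by (auto elim!: conj_classesE)

lemma conj_class_in: "g \<in> carrier G \<Longrightarrow> conj_class G g \<in> conj_classes G"
  by (simp add: conj_classes_def)

lemma finite_conj_classes: "finite (conj_classes G)" using fin by (simp add: conj_classes_def)

lemma conj_class_one: "conj_class G \<one> = {\<one>}"
  by (auto simp: conj_class_def intro!: exI[of _ \<one>])

definition crep :: "'g set \<Rightarrow> 'g" where "crep C = (SOME x. x \<in> C)"

lemma crep_in: "C \<in> conj_classes G \<Longrightarrow> crep C \<in> C"
  unfolding crep_def by (rule someI_ex) (use conj_class_self in \<open>auto elim!: conj_classesE\<close>)

lemma class_fun_conj_class:
  assumes "class_fun G z" "g \<in> carrier G" "h \<in> conj_class G g" shows "z h = z g"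
  using assms by (auto simp: class_fun_def conj_class_def)

lemma class_sum_class_fun:
  assumes "U \<subseteq> carrier G" "\<And>x u. x \<in> carrier G \<Longrightarrow> u \<in> U \<Longrightarrow> x \<otimes> u \<otimes> inv x \<in> U"
  shows "class_fun G (class_sum U)"
proof -
  have "x \<otimes> g \<otimes> inv x \<in> U \<longleftrightarrow> g \<in> U" if "x \<in> carrier G" "g \<in> carrier G" for x g
    using assms(2)[of "inv x" "x \<otimes> g \<otimes> inv x"] assms(2)[of x g] that conj_inv_cancel[OF that] by auto
  then show ?thesis using assms(1) by (auto simp: class_fun_def class_sum_def)
qed

lemma conj_class_closed:
  assumes "g \<in> carrier G" "x \<in> carrier G" "u \<in> conj_class G g" shows "x \<otimes> u \<otimes> inv x \<in> conj_class G g"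
proof -
  have "u \<in> carrier G" using assms conj_class_subset by blast
  then have "conj_class G (x \<otimes> u \<otimes> inv x) = conj_class G g" using conj_class_conj conj_class_eq assms by metis
  then show ?thesis using conj_class_self[of "x \<otimes> u \<otimes> inv x"] \<open>u \<in> carrier G\<close> assms(2) by simp
qed

lemma class_fun_class: "C \<in> conj_classes G \<Longrightarrow> class_fun G (class_sum C)"
  by (auto elim!: conj_classesE intro!: class_sum_class_fun conj_class_closed dest: conj_class_subset)

lemma sum_over_classes:
  "(\<Sum>g\<in>carrier G. f g) = (\<Sum>C\<in>conj_classes G. \<Sum>g\<in>C. f g)"
proof -
  have "(\<Sum>C\<in>conj_classes G. \<Sum>g\<in>{g \<in> carrier G. conj_class G g = C}. f g) = (\<Sum>g\<in>carrier G. f g)"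
    by (rule sum.group) (auto simp: fin finite_conj_classes conj_class_in)
  moreover have "{g \<in> carrier G. conj_class G g = C} = C" if "C \<in> conj_classes G" for C
    using that conj_class_eqI[OF that] conj_class_carrier[OF that] conj_class_self by blast
  ultimately show ?thesis by simp
qed

lemma class_fun_decomp:
  fixes z :: "'g \<Rightarrow> 'a::comm_ring_1"
  assumes z: "class_fun G z"
  shows "z = (\<lambda>g. \<Sum>C\<in>conj_classes G. z (crep C) * class_sum C g)"
proof (rule ext)
  fix g
  show "z g = (\<Sum>C\<in>conj_classes G. z (crep C) * class_sum C g)"
  proof (cases "g \<in> carrier G")
    case True
    have "(\<Sum>C\<in>conj_classes G. z (crep C) * class_sum C g) = (\<Sum>C\<in>conj_classes G. if C = conj_class G g then z g else 0)"
    proof (intro sum.cong refl)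
      fix C assume C: "C \<in> conj_classes G"
      show "z (crep C) * class_sum C g = (if C = conj_class G g then z g else 0)"
      proof (cases "g \<in> C")
        case True
        then have "z (crep C) = z g"
          using class_fun_conj_class[OF z, of g "crep C"] conj_class_eqI[OF C True] crep_in[OF C] \<open>g \<in> carrier G\<close> by metis
        then show ?thesis using True conj_class_eqI[OF C True] by (simp add: class_sum_def)
      qed (use conj_class_self[OF \<open>g \<in> carrier G\<close>] in \<open>auto simp: class_sum_def\<close>)
    qed
    also have "\<dots> = z g" using finite_conj_classes conj_class_in[OF True] by simp
    finally show ?thesis by simp
  next
    case False
    then have "z g = 0" using z by (simp add: class_fun_def)
    moreover have "class_sum C g = (0::'a)" if "C \<in> conj_classes G" for C
      using that False conj_class_carrier by (auto simp: class_sum_def)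
    then have "(\<Sum>C\<in>conj_classes G. z (crep C) * class_sum C g) = 0" by (intro sum.neutral) simp
    ultimately show ?thesis by simp
  qed
qed

lemma conv_at_one: "conv G a b \<one> = (\<Sum>x\<in>carrier G. a x * b (inv x))"
  by (simp add: conv_def)

lemma conv_class_fun:
  assumes a: "class_fun G a" and b: "class_fun G b" shows "class_fun G (conv G a b)"
  unfolding class_fun_def
proof (intro conjI allI impI ballI)
  fix x g assume x: "x \<in> carrier G" and g: "g \<in> carrier G"
  have "conv G a b (x \<otimes> g \<otimes> inv x) = (\<Sum>y\<in>carrier G. a y * b (inv y \<otimes> (x \<otimes> g \<otimes> inv x)))"
    using x g by (simp add: conv_def)
  also have "\<dots> = (\<Sum>y\<in>carrier G. a (x \<otimes> y \<otimes> inv x) * b (inv (x \<otimes> y \<otimes> inv x) \<otimes> (x \<otimes> g \<otimes> inv x)))"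
    by (rule sum.reindex_bij_witness[of _ "\<lambda>y. x \<otimes> y \<otimes> inv x" "\<lambda>y. inv x \<otimes> y \<otimes> x"])
      (use x in \<open>simp_all add: m_assoc inv_cancel\<close>)
  also have "\<dots> = (\<Sum>y\<in>carrier G. a y * b (inv y \<otimes> g))"
  proof (intro sum.cong refl)
    fix y assume y: "y \<in> carrier G"
    have "inv (x \<otimes> y \<otimes> inv x) \<otimes> (x \<otimes> g \<otimes> inv x) = x \<otimes> (inv y \<otimes> g) \<otimes> inv x"
    proof -
      have "inv (x \<otimes> y \<otimes> inv x) = x \<otimes> inv y \<otimes> inv x" using x y by (simp add: inv_mult_group m_assoc)
      moreover have "x \<otimes> inv y \<otimes> inv x \<otimes> (x \<otimes> g \<otimes> inv x) = x \<otimes> inv y \<otimes> (inv x \<otimes> x) \<otimes> g \<otimes> inv x"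
        using x y g by (simp only: m_assoc m_closed inv_closed)
      ultimately show ?thesis using x y g by (simp add: m_assoc)
    qed
    then show "a (x \<otimes> y \<otimes> inv x) * b (inv (x \<otimes> y \<otimes> inv x) \<otimes> (x \<otimes> g \<otimes> inv x)) = a y * b (inv y \<otimes> g)"
      using a b x y g by (simp add: class_fun_def)
  qed
  also have "\<dots> = conv G a b g" using g by (simp add: conv_def)
  finally show "conv G a b (x \<otimes> g \<otimes> inv x) = conv G a b g" .
qed (simp add: conv_def)

lemma conv_commute:
  assumes a: "class_fun G a" shows "conv G a b = conv G b a"
proof (rule ext)
  fix g
  show "conv G a b g = conv G b a g"
  proof (cases "g \<in> carrier G")
    case True
    have "(\<Sum>x\<in>carrier G. a x * b (inv x \<otimes> g)) = (\<Sum>y\<in>carrier G. a (g \<otimes> inv y) * b y)"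
      by (rule sum.reindex_bij_witness[of _ "\<lambda>y. g \<otimes> inv y" "\<lambda>x. inv x \<otimes> g"])
        (use True in \<open>auto simp: inv_mult_group m_assoc inv_cancel\<close>)
    also have "\<dots> = (\<Sum>y\<in>carrier G. b y * a (inv y \<otimes> g))"
      using True by (intro sum.cong refl) (simp add: class_fun_swap[OF a] mult.commute)
    finally show ?thesis using True by (simp add: conv_def)
  qed (simp add: conv_def)
qed

lemma pow_card: "g \<in> carrier G \<Longrightarrow> g [^] card (carrier G) = \<one>"
  using pow_order_eq_1[of g] by (simp add: Coset.order_def)

lemma pow_dvd: "g \<in> carrier G \<Longrightarrow> card (carrier G) dvd n \<Longrightarrow> g [^] n = \<one>"
  by (elim dvdE) (simp add: nat_pow_pow[symmetric] pow_card)

lemma bij_pow: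
  assumes "coprime s (card (carrier G))" "s > 0" shows "bij_betw (\<lambda>g. g [^] (s::nat)) (carrier G) (carrier G)"
proof -
  obtain t w where "s * t = card (carrier G) * w + gcd s (card (carrier G))"
    using bezout_nat[of s "card (carrier G)"] assms(2) by blast
  then have tw: "s * t = card (carrier G) * w + 1" using assms(1) by simp
  have inv: "(g [^] s) [^] t = g" if "g \<in> carrier G" for g
    using that by (simp add: nat_pow_pow tw nat_pow_mult[symmetric] pow_dvd)
  have "inj_on (\<lambda>g. g [^] s) (carrier G)" by (rule inj_on_inverseI[of _ "\<lambda>g. g [^] t"]) (rule inv)
  moreover have "(\<lambda>g. g [^] s) ` carrier G \<subseteq> carrier G" by auto
  ultimately show ?thesis using endo_inj_surj[OF fin] by (simp add: bij_betw_def)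
qed

lemma conj_pow:
  assumes "x \<in> carrier G" "g \<in> carrier G"
  shows "(x \<otimes> g \<otimes> inv x) [^] (s::nat) = x \<otimes> g [^] s \<otimes> inv x"
proof (induction s)
  case (Suc s)
  have "x \<otimes> g [^] s \<otimes> inv x \<otimes> (x \<otimes> g \<otimes> inv x) = x \<otimes> g [^] s \<otimes> (inv x \<otimes> x) \<otimes> g \<otimes> inv x"
    using assms by (simp only: m_assoc m_closed inv_closed nat_pow_closed)
  then show ?case using assms Suc by (simp add: m_assoc)
qed (use assms in simp)

lemma card_conj_class_pow:
  assumes g: "g \<in> carrier G" and s: "coprime s (card (carrier G))" "s > 0"
  shows "card (conj_class G (g [^] s)) = card (conj_class G g)"
proof -
  have "conj_class G (g [^] s) = (\<lambda>u. u [^] s) ` conj_class G g"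
    unfolding conj_class_def Setcompr_eq_image image_image
    by (rule image_cong[OF refl]) (simp add: conj_pow g)
  moreover have "inj_on (\<lambda>u. u [^] s) (conj_class G g)"
    using bij_pow[OF s] conj_class_subset[OF g] by (auto simp: bij_betw_def intro: inj_on_subset)
  ultimately show ?thesis by (simp add: card_image)
qed

lemma conj_class_inv:
  assumes "g \<in> carrier G" "u \<in> carrier G" shows "inv u \<in> conj_class G (inv g) \<longleftrightarrow> u \<in> conj_class G g"
proof -
  have *: "inv u \<in> conj_class G (inv g)" if g: "g \<in> carrier G" and u: "u \<in> conj_class G g" for u g
  proof -
    obtain x where x: "x \<in> carrier G" "u = x \<otimes> g \<otimes> inv x" using u by (auto simp: conj_class_def)
    then have "inv u = x \<otimes> inv g \<otimes> inv x" using g by (simp add: inv_mult_group m_assoc)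
    then show ?thesis using x(1) by (auto simp: conj_class_def)
  qed
  show ?thesis using *[of g u] *[of "inv g" "inv u"] assms by auto
qed

lemma omega_class_sum:
  fixes \<chi> :: "'g \<Rightarrow> 'k::field"
  assumes x: "class_fun G \<chi>" and g: "g \<in> carrier G"
  shows "omega G \<chi> (class_sum (conj_class G g)) = of_nat (card (conj_class G g)) * \<chi> g / \<chi> \<one>"
proof -
  have "(\<Sum>y\<in>carrier G. class_sum (conj_class G g) y * \<chi> y) = (\<Sum>y\<in>conj_class G g. \<chi> y)"
    using fin conj_class_subset[OF g] by (intro sum.mono_neutral_cong_right) (auto simp: class_sum_def)
  also have "\<dots> = (\<Sum>y\<in>conj_class G g. \<chi> g)" by (intro sum.cong refl) (rule class_fun_conj_class[OF x g])
  finally show ?thesis by (simp add: omega_def)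
qed

text \<open>Multiplication by a class sum has a matrix with entries 0 and 1 on the group algebra, and
  the idempotent of \<open>\<chi>\<close>, that is the vector of values of \<open>\<chi>\<close> at inverses, is an eigenvector of
  it.\<close>

lemma omega_class_integral:
  fixes \<chi> :: "'g \<Rightarrow> 'k::{alg_closed_field, field_char_0}"
  assumes x: "\<chi> \<in> Irr G" and C: "C \<in> conj_classes G"
  shows "integral_over \<int> (omega G \<chi> (class_sum C))"
proof -
  obtain n where n: "\<chi> \<one> = of_nat n" "n > 0" by (rule IrrE[OF x])
  have Z: "is_subring (\<int> :: 'k set)" by (auto simp: is_subring_def)
  have cf: "class_fun G (class_sum C :: 'g \<Rightarrow> 'k)" by (rule class_fun_class[OF C])
  have e1: "(of_nat n / of_nat (card (carrier G)) :: 'k) \<noteq> 0" using n card_pos by simp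
  show ?thesis
  proof (rule integral_over_eigen[where I = "carrier G" and v = "\<lambda>g. \<chi> (inv g)" and ?i0.0 = \<one>
        and M = "\<lambda>g y. class_sum C (g \<otimes> inv y)", OF Z fin one_closed])
    fix g assume g: "g \<in> carrier G"
    have "of_nat n / of_nat (card (carrier G)) * (omega G \<chi> (class_sum C) * \<chi> (inv g)) = conv G (class_sum C) (eidem G \<chi>) g"
      unfolding conv_eidem[OF x cf] using g n by (simp add: eidem_def)
    also have "\<dots> = (\<Sum>y\<in>carrier G. class_sum C y * eidem G \<chi> (inv y \<otimes> g))" using g by (simp add: conv_def)
    also have "\<dots> = (\<Sum>y\<in>carrier G. class_sum C (g \<otimes> inv y) * eidem G \<chi> y)"
      by (rule sum.reindex_bij_witness[of _ "\<lambda>y. g \<otimes> inv y" "\<lambda>x. inv x \<otimes> g"])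
        (use g in \<open>auto simp: inv_mult_group m_assoc inv_cancel\<close>)
    also have "\<dots> = of_nat n / of_nat (card (carrier G)) * (\<Sum>y\<in>carrier G. class_sum C (g \<otimes> inv y) * \<chi> (inv y))"
      unfolding sum_distrib_left by (intro sum.cong refl) (simp add: eidem_def n)
    finally show "omega G \<chi> (class_sum C) * \<chi> (inv g) = (\<Sum>y\<in>carrier G. class_sum C (g \<otimes> inv y) * \<chi> (inv y))"
      using e1 by (metis mult_left_cancel)
  qed (use n in \<open>auto simp: class_sum_def\<close>)
qed

end

section \<open>Isomorphisms between centers\<close>

text \<open>The properties of the primitive central idempotents that determine them. They are stated for
  any field because they survive every field extension.\<close>

definition orth_system :: "('g, 'm) monoid_scheme \<Rightarrow> 'x set \<Rightarrow> ('x \<Rightarrow> 'g \<Rightarrow> 'k::field) \<Rightarrow> bool" where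
  "orth_system G I e \<longleftrightarrow> finite I \<and> (\<forall>x\<in>I. class_fun G (e x) \<and> e x \<noteq> (\<lambda>_. 0)) \<and>
     (\<forall>x\<in>I. \<forall>y\<in>I. conv G (e x) (e y) = (if x = y then e x else (\<lambda>_. 0))) \<and>
     (\<lambda>g. \<Sum>x\<in>I. e x g) = delta1 G \<and>
     (\<forall>x\<in>I. \<forall>z. class_fun G z \<longrightarrow> (\<exists>c. conv G z (e x) = (\<lambda>g. c * e x g)))"

lemma conv_smult: "conv G (\<lambda>g. c * a g) (\<lambda>g. d * b g) = (\<lambda>g. c * d * conv G a b g)"
  by (rule ext) (auto simp: conv_def sum_distrib_left mult_ac intro!: sum.cong)

context fin_group begin

lemma orth_system_Irr:
  "orth_system G (Irr G) (eidem G :: ('g \<Rightarrow> 'k::{alg_closed_field, field_char_0}) \<Rightarrow> 'g \<Rightarrow> 'k)"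
  unfolding orth_system_def
proof (intro conjI ballI allI impI)
  show "finite (Irr G :: ('g \<Rightarrow> 'k) set)" by (rule finite_Irr)
  show "(\<lambda>g. \<Sum>\<chi>\<in>Irr G. eidem G \<chi> g) = (delta1 G :: 'g \<Rightarrow> 'k)" by (rule sum_eidem)
  fix \<chi> :: "'g \<Rightarrow> 'k" assume x: "\<chi> \<in> Irr G"
  obtain n where n: "\<chi> \<one> = of_nat n" "n > 0" by (rule IrrE[OF x])
  show "class_fun G (eidem G \<chi>)" by (rule eidem_class_fun[OF Irr_class_fun[OF x]])
  have "eidem G \<chi> \<one> \<noteq> 0" using n card_pos by (simp add: eidem_def)
  then show "eidem G \<chi> \<noteq> (\<lambda>_. 0)" by auto
  show "\<exists>c. conv G z (eidem G \<chi>) = (\<lambda>g. c * eidem G \<chi> g)" if "class_fun G z" for z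
    using conv_eidem[OF x that] by blast
  fix \<eta> :: "'g \<Rightarrow> 'k" assume y: "\<eta> \<in> Irr G"
  show "conv G (eidem G \<chi>) (eidem G \<eta>) = (if \<chi> = \<eta> then eidem G \<chi> else (\<lambda>_. 0))"
    unfolding conv_eidem[OF y eidem_class_fun[OF Irr_class_fun[OF x]]] omega_eidem[OF y x] by auto
qed

lemma char_power_poly:
  fixes \<chi> :: "'g \<Rightarrow> 'k::{alg_closed_field, field_char_0}"
  assumes x: "\<chi> \<in> Irr G" and g: "g \<in> carrier G" and z: "primroot n \<zeta>" and n: "card (carrier G) dvd n"
  shows "\<exists>P. \<forall>s. \<chi> (g [^] (s::nat)) = rpoly P (\<zeta> ^ s)"
proof -
  obtain t :: "nat \<Rightarrow> nat" where t: "\<And>s. \<chi> (g [^] s) = (\<Sum>m<n. of_nat (t m) * \<zeta> ^ (m * s))"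
    using char_power_values[OF x g z pow_dvd[OF g n]] by blast
  have "rpoly (\<Sum>m<n. monom (of_nat (t m)) m) (\<zeta> ^ s) = \<chi> (g [^] s)" for s
    unfolding t rpoly_sum by (intro sum.cong refl) (simp add: rpoly_monom power_mult[symmetric] mult.commute)
  then show ?thesis by metis
qed

lemma root_of_unity_integral:
  fixes z :: "'k::field"
  assumes "z ^ n = 1" "n > 0" shows "integral_over \<int> z"
proof -
  have "integral_over \<int> z \<longleftrightarrow> (\<exists>p. (\<forall>i. coeff p i \<in> \<int>) \<and> lead_coeff p = 1 \<and> poly p z = 0)" by (rule integral_over_def)
  moreover have "degree (monom 1 n + [:-1:] :: 'k poly) = n"
    using assms(2) by (subst degree_add_eq_left) (auto simp: degree_monom_eq)
  then have "(\<forall>i. coeff (monom 1 n + [:-1:] :: 'k poly) i \<in> \<int>) \<and> lead_coeff (monom 1 n + [:-1:] :: 'k poly) = 1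
      \<and> poly (monom 1 n + [:-1:]) z = 0"
    using assms by (auto simp: poly_monom coeff_pCons split: nat.splits)
  ultimately show ?thesis by blast
qed

text \<open>A character value is a sum of roots of unity.\<close>

lemma char_integral:
  fixes \<chi> :: "'g \<Rightarrow> 'k::{alg_closed_field, field_char_0}"
  assumes x: "\<chi> \<in> Irr G" and g: "g \<in> carrier G"
  shows "integral_over \<int> (\<chi> g)"
proof -
  obtain \<zeta> :: 'k where z: "primroot (card (carrier G)) \<zeta>" using exists_primroot[OF card_pos] by blast
  have Z: "is_subring (\<int> :: 'k set)" by (auto simp: is_subring_def)
  note ZZ = is_subring_integral_closure[OF Z]
  have zi: "\<zeta> \<in> {x. integral_over \<int> x}" using root_of_unity_integral[of \<zeta> "card (carrier G)"] z by (auto simp: primroot_def)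
  obtain t :: "nat \<Rightarrow> nat" where t: "\<And>s. \<chi> (g [^] s) = (\<Sum>m<card (carrier G). of_nat (t m) * \<zeta> ^ (m * s))"
    using char_power_values[OF x g z pow_dvd[OF g dvd_refl]] by blast
  have "\<chi> g = (\<Sum>m<card (carrier G). of_nat (t m) * \<zeta> ^ m)" using t[of 1] g by simp
  also have "\<dots> \<in> {x. integral_over \<int> x}"
    by (intro is_subring_sum[OF ZZ] is_subringD(4)[OF ZZ] is_subring_power[OF ZZ] is_subring_of_nat[OF ZZ] zi)
  finally show ?thesis by simp
qed

lemma pow_inverse:
  assumes "x \<in> carrier G" "x [^] n = \<one>" "n > 0" shows "x [^] (s * (n - 1)) = inv (x [^] (s::nat))"
proof -
  have "s + s * (n - 1) = n * s" using assms(3) by (cases n) auto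
  then have "x [^] s \<otimes> x [^] (s * (n - 1)) = (x [^] n) [^] s" using assms(1) by (simp add: nat_pow_mult nat_pow_pow)
  then have "x [^] s \<otimes> x [^] (s * (n - 1)) = \<one>" using assms by simp
  then have "x [^] (s * (n - 1)) \<otimes> x [^] s = \<one>" using assms(1) by (simp add: nat_pow_mult add.commute)
  then show ?thesis using assms(1) inv_equality by simp
qed

end

text \<open>Isomorphisms of centers as maps between class functions. The isomorphism goes from \<open>H\<close> to
  \<open>G\<close>, since the inverse of the given one is the object of study.\<close>

locale center_iso = G: fin_group G + H: fin_group H
  for G :: "('g, 'm) monoid_scheme" and H :: "('h, 'n) monoid_scheme" +
  fixes \<phi> :: "('h \<Rightarrow> 'k::comm_ring_1) \<Rightarrow> ('g \<Rightarrow> 'k)"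
  assumes phi_class: "class_fun H a \<Longrightarrow> class_fun G (\<phi> a)"
    and phi_lin: "class_fun H a \<Longrightarrow> class_fun H b \<Longrightarrow> \<phi> (\<lambda>h. c * a h + b h) = (\<lambda>g. c * \<phi> a g + \<phi> b g)"
    and phi_conv: "class_fun H a \<Longrightarrow> class_fun H b \<Longrightarrow> \<phi> (conv H a b) = conv G (\<phi> a) (\<phi> b)"
    and phi_one: "\<phi> (delta1 H) = delta1 G"
    and phi_inj: "class_fun H a \<Longrightarrow> class_fun H b \<Longrightarrow> \<phi> a = \<phi> b \<Longrightarrow> a = b"
    and phi_surj: "class_fun G w \<Longrightarrow> \<exists>z. class_fun H z \<and> \<phi> z = w"
begin

lemma class_fun_zero: "class_fun H (\<lambda>_. 0)" by (simp add: class_fun_def)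

lemma phi_zero: "\<phi> (\<lambda>_. 0) = (\<lambda>_. 0)"
  using phi_lin[OF class_fun_zero class_fun_zero, of "-1"] by simp

lemma phi_smult: "class_fun H a \<Longrightarrow> \<phi> (\<lambda>h. c * a h) = (\<lambda>g. c * \<phi> a g)"
  using phi_lin[OF _ class_fun_zero, of a c] by (simp add: phi_zero)

lemma phi_sum:
  assumes "finite I" "\<And>i. i \<in> I \<Longrightarrow> class_fun H (a i)"
  shows "\<phi> (\<lambda>h. \<Sum>i\<in>I. c i * a i h) = (\<lambda>g. \<Sum>i\<in>I. c i * \<phi> (a i) g)"
  using assms
proof (induction I rule: finite_induct)
  case (insert x F)
  have "class_fun H (\<lambda>h. \<Sum>i\<in>F. c i * a i h)" by (intro H.class_fun_sum H.class_fun_smult) (use insert in auto)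
  then show ?case using insert phi_lin[of "a x" "\<lambda>h. \<Sum>i\<in>F. c i * a i h" "c x"] by simp
qed (simp add: phi_zero)

end

locale center_iso_field = center_iso G H \<phi>
  for G :: "('g, 'm) monoid_scheme" and H :: "('h, 'n) monoid_scheme"
    and \<phi> :: "('h \<Rightarrow> 'k::field) \<Rightarrow> ('g \<Rightarrow> 'k)"
begin

text \<open>The image of a primitive idempotent meets some primitive idempotent of the other side; each
  is a multiple of the product, so they are proportional, and idempotency makes the factor 1.\<close>

lemma idempotent_bijection:
  assumes e: "orth_system H I e" and e': "orth_system G J e'"
  shows "\<exists>f. bij_betw f I J \<and> (\<forall>x\<in>I. \<phi> (e x) = e' (f x))"
proof -
  have I: "finite I" and ec: "\<And>x. x \<in> I \<Longrightarrow> class_fun H (e x)" and e0: "\<And>x. x \<in> I \<Longrightarrow> e x \<noteq> (\<lambda>_. 0)"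
    and eo: "\<And>x y. x \<in> I \<Longrightarrow> y \<in> I \<Longrightarrow> conv H (e x) (e y) = (if x = y then e x else (\<lambda>_. 0))"
    and es: "(\<lambda>g. \<Sum>x\<in>I. e x g) = delta1 H"
    and ez: "\<And>x z. x \<in> I \<Longrightarrow> class_fun H z \<Longrightarrow> \<exists>c. conv H z (e x) = (\<lambda>g. c * e x g)"
    using e unfolding orth_system_def by blast+
  have J: "finite J" and ec': "\<And>x. x \<in> J \<Longrightarrow> class_fun G (e' x)" and e0': "\<And>x. x \<in> J \<Longrightarrow> e' x \<noteq> (\<lambda>_. 0)"
    and eo': "\<And>x y. x \<in> J \<Longrightarrow> y \<in> J \<Longrightarrow> conv G (e' x) (e' y) = (if x = y then e' x else (\<lambda>_. 0))"
    and es': "(\<lambda>g. \<Sum>x\<in>J. e' x g) = delta1 G"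
    and ez': "\<And>x z. x \<in> J \<Longrightarrow> class_fun G z \<Longrightarrow> \<exists>c. conv G z (e' x) = (\<lambda>g. c * e' x g)"
    using e' unfolding orth_system_def by blast+
  have "\<exists>y\<in>J. \<phi> (e x) = e' y" if x: "x \<in> I" for x
  proof -
    define a where "a = \<phi> (e x)"
    have ac: "class_fun G a" unfolding a_def by (rule phi_class[OF ec[OF x]])
    have a0: "a \<noteq> (\<lambda>_. 0)" using phi_inj[OF ec[OF x] class_fun_zero] e0[OF x] by (auto simp: a_def phi_zero)
    have aa: "conv G a a = a" unfolding a_def using phi_conv[OF ec[OF x] ec[OF x]] eo[OF x x] by simp
    have "a = (\<lambda>g. \<Sum>y\<in>J. conv G a (e' y) g)"
      unfolding G.conv_sum_right[symmetric] es' by (rule G.conv_delta1[OF ac, symmetric])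
    then obtain y where y: "y \<in> J" "conv G a (e' y) \<noteq> (\<lambda>_. 0)"
      using a0 by (metis (no_types, lifting) sum.neutral)
    obtain c where c: "conv G a (e' y) = (\<lambda>g. c * e' y g)" using ez'[OF y(1) ac] by blast
    obtain z where z: "class_fun H z" "\<phi> z = e' y" using phi_surj[OF ec'[OF y(1)]] by blast
    obtain d where d: "conv H z (e x) = (\<lambda>h. d * e x h)" using ez[OF x z(1)] by blast
    have "conv G (e' y) a = (\<lambda>g. d * a g)"
      using phi_conv[OF z(1) ec[OF x]] phi_smult[OF ec[OF x], of d] unfolding d z(2) a_def by simp
    (* The product of a with e' y, evaluated in both groups. *)
    then have cd: "c * e' y g = d * a g" for g
      using G.conv_commute[OF ac] c by (metis (no_types, lifting))
    have d0: "d \<noteq> 0"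
    proof
      assume "d = 0"
      then have "c * e' y g = 0" for g using cd by simp
      then show False using y(2) c by auto
    qed
    define k where "k = c / d"
    have ak: "a = (\<lambda>g. k * e' y g)" using cd d0 by (auto simp: k_def field_simps)
    have "conv G a a = (\<lambda>g. k * k * e' y g)" unfolding ak conv_smult eo'[OF y(1) y(1)] by simp
    then have kk: "k * k * e' y g = k * e' y g" for g using aa ak by metis
    obtain g where g: "e' y g \<noteq> 0" using e0'[OF y(1)] by auto
    have k0: "k \<noteq> 0" using a0 ak by auto
    have "k = 1" using kk[of g] g k0 by simp
    then have "a = e' y" using ak by simp
    then have "\<phi> (e x) = e' y" by (simp only: a_def)
    then show ?thesis using y(1) by (rule bexI)
  qed
  then obtain f where f: "\<And>x. x \<in> I \<Longrightarrow> f x \<in> J" "\<And>x. x \<in> I \<Longrightarrow> \<phi> (e x) = e' (f x)" by metis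
  have "inj_on f I"
  proof (rule inj_onI, rule ccontr)
    fix x y assume xy: "x \<in> I" "y \<in> I" "f x = f y" "x \<noteq> y"
    then have "e x = e y" using phi_inj[OF ec ec, of x y] f by simp
    then have "e x = conv H (e x) (e y)" using eo[OF xy(1) xy(1)] by simp
    then show False using eo[OF xy(1,2)] xy(4) e0[OF xy(1)] by simp
  qed
  moreover have "f ` I = J"
  proof (rule ccontr)
    assume "f ` I \<noteq> J"
    then obtain y where y: "y \<in> J" "y \<notin> f ` I" using f(1) by blast
    have "delta1 G = (\<lambda>g. \<Sum>x\<in>I. \<phi> (e x) g)"
      using phi_sum[where a = e and c = "\<lambda>_. 1", OF I ec] unfolding mult_1 es phi_one .
    then have "e' y = conv G (e' y) (\<lambda>g. \<Sum>x\<in>I. \<phi> (e x) g)" using G.conv_delta1[OF ec'[OF y(1)]] by metis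
    also have "\<dots> = (\<lambda>g. \<Sum>x\<in>I. conv G (e' y) (e' (f x)) g)"
      unfolding G.conv_sum_right using f by (intro ext sum.cong refl) simp
    also have "\<dots> = (\<lambda>_. 0)"
    proof (rule ext, rule sum.neutral, rule ballI)
      fix g x assume "x \<in> I"
      then show "conv G (e' y) (e' (f x)) g = 0" using eo'[OF y(1) f(1)] y(2) by auto
    qed
    finally show False using e0'[OF y(1)] by simp
  qed
  ultimately show ?thesis using f by (auto simp: bij_betw_def)
qed

end

locale center_iso_ac = center_iso_field G H \<phi>
  for G :: "('g, 'm) monoid_scheme" and H :: "('h, 'n) monoid_scheme"
    and \<phi> :: "('h \<Rightarrow> 'k::{alg_closed_field, field_char_0}) \<Rightarrow> ('g \<Rightarrow> 'k)"
begin

lemma char_bijection: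
  obtains f where "bij_betw f (Irr H) (Irr G)" "\<And>\<eta>. \<eta> \<in> Irr H \<Longrightarrow> \<phi> (eidem H \<eta>) = eidem G (f \<eta>)"
    "\<And>\<eta> z. \<eta> \<in> Irr H \<Longrightarrow> class_fun H z \<Longrightarrow> omega G (f \<eta>) (\<phi> z) = omega H \<eta> z"
    "\<And>z. class_fun H z \<Longrightarrow> \<phi> z = (\<lambda>g. \<Sum>\<eta>\<in>Irr H. omega H \<eta> z * eidem G (f \<eta>) g)"
proof -
  obtain f where f: "bij_betw f (Irr H) (Irr G)" "\<And>\<eta>. \<eta> \<in> Irr H \<Longrightarrow> \<phi> (eidem H \<eta>) = eidem G (f \<eta>)"
    using idempotent_bijection[OF H.orth_system_Irr G.orth_system_Irr] by blast
  have fI: "f \<eta> \<in> Irr G" if "\<eta> \<in> Irr H" for \<eta> using f(1) that by (auto simp: bij_betw_def)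
  have om: "omega G (f \<eta>) (\<phi> z) = omega H \<eta> z" if e: "\<eta> \<in> Irr H" and z: "class_fun H z" for \<eta> z
  proof -
    have ec: "class_fun H (eidem H \<eta>)" by (rule H.eidem_class_fun[OF H.Irr_class_fun[OF e]])
    have "(\<lambda>g. omega G (f \<eta>) (\<phi> z) * eidem G (f \<eta>) g) = conv G (\<phi> z) (\<phi> (eidem H \<eta>))"
      unfolding f(2)[OF e] by (rule G.conv_eidem[OF fI[OF e] phi_class[OF z], symmetric])
    also have "\<dots> = \<phi> (conv H z (eidem H \<eta>))" by (rule phi_conv[OF z ec, symmetric])
    also have "\<dots> = (\<lambda>g. omega H \<eta> z * eidem G (f \<eta>) g)"
      unfolding H.conv_eidem[OF e z] phi_smult[OF ec] f(2)[OF e] ..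
    finally have *: "omega G (f \<eta>) (\<phi> z) * eidem G (f \<eta>) g = omega H \<eta> z * eidem G (f \<eta>) g" for g by metis
    have "eidem G (f \<eta>) \<noteq> (\<lambda>_. 0)" using G.orth_system_Irr fI[OF e] unfolding orth_system_def by blast
    then obtain g where "eidem G (f \<eta>) g \<noteq> 0" by auto
    then show ?thesis using *[of g] by simp
  qed
  have "\<phi> z = (\<lambda>g. \<Sum>\<eta>\<in>Irr H. omega H \<eta> z * eidem G (f \<eta>) g)" if z: "class_fun H z" for z
  proof -
    have "\<phi> z = \<phi> (\<lambda>h. \<Sum>\<eta>\<in>Irr H. omega H \<eta> z * eidem H \<eta> h)" using H.class_fun_expand[OF z] by simp
    also have "\<dots> = (\<lambda>g. \<Sum>\<eta>\<in>Irr H. omega H \<eta> z * \<phi> (eidem H \<eta>) g)"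
      by (rule phi_sum[OF H.finite_Irr]) (rule H.eidem_class_fun[OF H.Irr_class_fun])
    also have "\<dots> = (\<lambda>g. \<Sum>\<eta>\<in>Irr H. omega H \<eta> z * eidem G (f \<eta>) g)" by (intro ext sum.cong refl) (simp add: f(2))
    finally show ?thesis .
  qed
  with f om show thesis by (rule that)
qed

text \<open>An entry is a sum of products of character values, with factors that do not change along the
  powers prime to the group orders. This is the action of the Galois group of the cyclotomic
  field on the entries.\<close>

lemma entries_along_powers:
  assumes h: "h \<in> carrier H" and g: "g \<in> carrier G" and z: "primroot n \<zeta>"
    and n: "card (carrier G) dvd n" "card (carrier H) dvd n"
  shows "\<exists>Q. \<forall>s. coprime s n \<longrightarrow> s > 0 \<longrightarrow>
    \<phi> (class_sum (conj_class H (h [^]\<^bsub>H\<^esub> (s::nat)))) (g [^]\<^bsub>G\<^esub> s) = rpoly Q (\<zeta> ^ s)"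
proof -
  obtain f where f: "bij_betw f (Irr H) (Irr G)"
    "\<And>z. class_fun H z \<Longrightarrow> \<phi> z = (\<lambda>g. \<Sum>\<eta>\<in>Irr H. omega H \<eta> z * eidem G (f \<eta>) g)"
    by (rule char_bijection) blast
  have fI: "f \<eta> \<in> Irr G" if "\<eta> \<in> Irr H" for \<eta> using f(1) that by (auto simp: bij_betw_def)
  have "\<exists>Q. \<forall>s. coprime s n \<longrightarrow> s > 0 \<longrightarrow> omega H \<eta> (class_sum (conj_class H (h [^]\<^bsub>H\<^esub> (s::nat)))) * eidem G (f \<eta>) (g [^]\<^bsub>G\<^esub> s) = rpoly Q (\<zeta> ^ s)"
    if e: "\<eta> \<in> Irr H" for \<eta>
  proof -
    obtain d where d: "\<eta> \<one>\<^bsub>H\<^esub> = of_nat d" by (rule H.IrrE[OF e])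
    obtain d' where d': "f \<eta> \<one>\<^bsub>G\<^esub> = of_nat d'" by (rule G.IrrE[OF fI[OF e]])
    obtain P where P: "\<And>s. \<eta> (h [^]\<^bsub>H\<^esub> (s::nat)) = rpoly P (\<zeta> ^ s)" using H.char_power_poly[OF e h z n(2)] by blast
    obtain P' where P': "\<And>s. f \<eta> ((inv\<^bsub>G\<^esub> g) [^]\<^bsub>G\<^esub> (s::nat)) = rpoly P' (\<zeta> ^ s)"
      using G.char_power_poly[OF fI[OF e] G.inv_closed[OF g] z n(1)] by blast
    define c :: rat where "c = of_nat (card (conj_class H h)) / of_nat d * (of_nat d' / of_nat (card (carrier G)))"
    have "omega H \<eta> (class_sum (conj_class H (h [^]\<^bsub>H\<^esub> s))) * eidem G (f \<eta>) (g [^]\<^bsub>G\<^esub> s) = rpoly ([:c:] * P * P') (\<zeta> ^ s)"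
      if s: "coprime s n" "s > 0" for s
    proof -
      have sH: "coprime s (card (carrier H))" by (rule coprime_divisors[OF dvd_refl n(2) s(1)])
      have "omega H \<eta> (class_sum (conj_class H (h [^]\<^bsub>H\<^esub> s))) = of_nat (card (conj_class H h)) * rpoly P (\<zeta> ^ s) / of_nat d"
        using H.omega_class_sum[OF H.Irr_class_fun[OF e], of "h [^]\<^bsub>H\<^esub> s"] h
        by (simp add: H.card_conj_class_pow[OF h sH s(2)] P d)
      moreover have "eidem G (f \<eta>) (g [^]\<^bsub>G\<^esub> s) = of_nat d' / of_nat (card (carrier G)) * rpoly P' (\<zeta> ^ s)"
        using g by (simp add: eidem_def d' P'[symmetric] G.nat_pow_inv)
      ultimately show ?thesis
        unfolding rpoly_mult rpoly_const c_def of_rat_mult of_rat_divide of_rat_of_nat_eq by (simp add: mult_ac)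
    qed
    then show ?thesis by blast
  qed
  then obtain Q where Q: "\<And>\<eta> s. \<eta> \<in> Irr H \<Longrightarrow> coprime s n \<Longrightarrow> s > 0 \<Longrightarrow>
     omega H \<eta> (class_sum (conj_class H (h [^]\<^bsub>H\<^esub> (s::nat)))) * eidem G (f \<eta>) (g [^]\<^bsub>G\<^esub> s) = rpoly (Q \<eta>) (\<zeta> ^ s)" by metis
  have "\<phi> (class_sum (conj_class H (h [^]\<^bsub>H\<^esub> (s::nat)))) (g [^]\<^bsub>G\<^esub> s) = rpoly (\<Sum>\<eta>\<in>Irr H. Q \<eta>) (\<zeta> ^ s)"
    if s: "coprime s n" "s > 0" for s
  proof -
    have "class_fun H (class_sum (conj_class H (h [^]\<^bsub>H\<^esub> s)) :: 'h \<Rightarrow> 'k)" using h by (intro H.class_fun_class H.conj_class_in) simp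
    from f(2)[OF this] show ?thesis unfolding rpoly_sum by (simp only:) (intro sum.cong refl Q s)
  qed
  then show ?thesis by blast
qed

text \<open>Clearing the denominator of the idempotents leaves values of characters and central
  characters, which are integral.\<close>

lemma entries_integral:
  assumes h: "h \<in> carrier H" and g: "g \<in> carrier G"
  shows "integral_over \<int> (of_nat (card (carrier G)) * \<phi> (class_sum (conj_class H h)) g)"
proof -
  obtain f where f: "bij_betw f (Irr H) (Irr G)"
    "\<And>z. class_fun H z \<Longrightarrow> \<phi> z = (\<lambda>g. \<Sum>\<eta>\<in>Irr H. omega H \<eta> z * eidem G (f \<eta>) g)"
    by (rule char_bijection) blast
  have fI: "f \<eta> \<in> Irr G" if "\<eta> \<in> Irr H" for \<eta> using f(1) that by (auto simp: bij_betw_def)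
  have C: "conj_class H h \<in> conj_classes H" by (rule H.conj_class_in[OF h])
  have Z: "is_subring (\<int> :: 'k set)" by (auto simp: is_subring_def)
  note ZZ = is_subring_integral_closure[OF Z]
  have "of_nat (card (carrier G)) * \<phi> (class_sum (conj_class H h)) g =
      (\<Sum>\<eta>\<in>Irr H. omega H \<eta> (class_sum (conj_class H h)) * (f \<eta> \<one>\<^bsub>G\<^esub> * f \<eta> (inv\<^bsub>G\<^esub> g)))"
    unfolding f(2)[OF H.class_fun_class[OF C]] sum_distrib_left
    using g G.card_pos by (intro sum.cong refl) (simp add: eidem_def)
  also have "\<dots> \<in> {x. integral_over \<int> x}"
    by (intro is_subring_sum[OF ZZ] is_subringD(4)[OF ZZ])
      (use H.omega_class_integral[OF _ C] G.char_integral[OF fI] g in auto)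
  finally show ?thesis by simp
qed

end

section \<open>Class sums with image entries 0 and 1\<close>

lemma (in fin_group) lower_central_normal:
  "normal (lower_central_series G i) G"
proof (induction i)
  case 0
  show ?case by (simp add: normal_inv_iff subgroup_self)
next
  case (Suc i)
  let ?L = "lower_central_series G i"
  have sub: "?L \<subseteq> carrier G" using normal_imp_subgroup[OF Suc] subgroup.subset by blast
  have cl: "c \<otimes> x \<otimes> inv c \<in> ?L" if "x \<in> ?L" "c \<in> carrier G" for x c
    using Suc that by (simp add: normal_inv_iff)
  show ?case unfolding lower_central_series.simps
  proof (rule normal_generateI)
    show "{x \<otimes> y \<otimes> inv x \<otimes> inv y | x y. x \<in> ?L \<and> y \<in> carrier G} \<subseteq> carrier G" using sub by auto
    fix u c assume u: "u \<in> {x \<otimes> y \<otimes> inv x \<otimes> inv y | x y. x \<in> ?L \<and> y \<in> carrier G}" and c: "c \<in> carrier G"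
    obtain x y where xy: "u = x \<otimes> y \<otimes> inv x \<otimes> inv y" "x \<in> ?L" "y \<in> carrier G" using u by blast
    have x: "x \<in> carrier G" using xy sub by blast
    have "c \<otimes> u \<otimes> inv c = (c \<otimes> x \<otimes> inv c) \<otimes> (c \<otimes> y \<otimes> inv c) \<otimes> inv (c \<otimes> x \<otimes> inv c) \<otimes> inv (c \<otimes> y \<otimes> inv c)"
      unfolding xy(1) using x xy(3) c by (simp add: inv_mult_group m_assoc inv_cancel)
    then show "c \<otimes> u \<otimes> inv c \<in> {x \<otimes> y \<otimes> inv x \<otimes> inv y | x y. x \<in> ?L \<and> y \<in> carrier G}"
      using cl[OF xy(2) c] xy(3) c by blast
  qed
qed

lemma (in fin_group) lower_central_commutator:
  assumes h: "h \<in> lower_central_series G i" and x: "x \<in> carrier G"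
  shows "x \<otimes> h \<otimes> inv x \<otimes> inv h \<in> lower_central_series G (Suc i)"
proof -
  have hG: "h \<in> carrier G" using h normal_imp_subgroup[OF lower_central_normal] subgroup.subset by blast
  have "h \<otimes> x \<otimes> inv h \<otimes> inv x \<in> lower_central_series G (Suc i)"
    unfolding lower_central_series.simps by (rule generate.incl) (use h x in blast)
  then have "inv (h \<otimes> x \<otimes> inv h \<otimes> inv x) \<in> lower_central_series G (Suc i)"
    using subgroup.m_inv_closed[OF normal_imp_subgroup[OF lower_central_normal]] by blast
  moreover have "inv (h \<otimes> x \<otimes> inv h \<otimes> inv x) = x \<otimes> h \<otimes> inv x \<otimes> inv h"
    using x hG by (simp add: inv_mult_group m_assoc)
  ultimately show ?thesis by simp
qed

lemma (in fin_group) class_sum_union: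
  assumes U: "U \<subseteq> carrier G" "\<And>x u. x \<in> carrier G \<Longrightarrow> u \<in> U \<Longrightarrow> x \<otimes> u \<otimes> inv x \<in> U"
  shows "(class_sum U :: 'g \<Rightarrow> 'a::comm_ring_1) = (\<lambda>g. \<Sum>C\<in>{C \<in> conj_classes G. C \<subseteq> U}. 1 * class_sum C g)"
proof (rule ext)
  fix g
  have "(\<Sum>C\<in>{C \<in> conj_classes G. C \<subseteq> U}. 1 * class_sum C g :: 'a) = (\<Sum>C\<in>{C \<in> conj_classes G. C \<subseteq> U}. if C = conj_class G g \<and> g \<in> U then 1 else 0)"
  proof (intro sum.cong refl)
    fix C assume C: "C \<in> {C \<in> conj_classes G. C \<subseteq> U}"
    have "g \<in> C \<longleftrightarrow> C = conj_class G g \<and> g \<in> U"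
      using C conj_class_eqI[of C g] conj_class_self[of g] U(1) by blast
    then show "1 * class_sum C g = (if C = conj_class G g \<and> g \<in> U then 1 else (0::'a))" by (simp add: class_sum_def)
  qed
  also have "\<dots> = class_sum U g"
  proof (cases "g \<in> U")
    case True
    then have "conj_class G g \<in> {C \<in> conj_classes G. C \<subseteq> U}"
      using U by (auto simp: conj_class_def intro!: conj_class_in[unfolded conj_class_def])
    then show ?thesis using True finite_conj_classes by (simp add: class_sum_def)
  qed (simp add: class_sum_def)
  finally show "class_sum U g = (\<Sum>C\<in>{C \<in> conj_classes G. C \<subseteq> U}. 1 * class_sum C g :: 'a)" by simp
qed

text \<open>Over a ring without inverses of the prime divisors of the group order, and normalized by the
  augmentation.\<close>

locale center_iso_int = center_iso_ac G H \<phi>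
  for G :: "('g, 'm) monoid_scheme" and H :: "('h, 'n) monoid_scheme"
    and \<phi> :: "('h \<Rightarrow> 'k::{alg_closed_field, field_char_0}) \<Rightarrow> ('g \<Rightarrow> 'k)" +
  fixes R :: "'k set"
  assumes R: "is_subring R"
    and no_inverse: "Factorial_Ring.prime p \<Longrightarrow> p dvd card (carrier G) \<Longrightarrow> inverse (of_nat p) \<notin> R"
    and entries: "h \<in> carrier H \<Longrightarrow> g \<in> carrier G \<Longrightarrow> \<phi> (class_sum (conj_class H h)) g \<in> R"
    and augmentation: "class_fun H z \<Longrightarrow> (\<Sum>g\<in>carrier G. \<phi> z g) = (\<Sum>h\<in>carrier H. z h)"
begin

abbreviation clsum :: "'h \<Rightarrow> 'h \<Rightarrow> 'k" where "clsum h \<equiv> class_sum (conj_class H h)"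

lemma clsum_class_fun: "h \<in> carrier H \<Longrightarrow> class_fun H (clsum h)"
  by (rule H.class_fun_class[OF H.conj_class_in])

lemma sum_class_sum: "U \<subseteq> carrier H \<Longrightarrow> (\<Sum>h\<in>carrier H. class_sum U h) = (of_nat (card U) :: 'k)"
proof -
  assume "U \<subseteq> carrier H"
  then have "(\<Sum>h\<in>carrier H. class_sum U h) = (\<Sum>h\<in>U. 1 :: 'k)"
    by (intro sum.mono_neutral_cong_right) (auto simp: class_sum_def H.fin)
  then show ?thesis by simp
qed

text \<open>Squared norm and augmentation of the image both equal the length of the class, for the class
  of \<open>h\<close> and those of its powers, so the arithmetic criterion applies to the entries.\<close>

lemma entries_01:
  assumes h: "h \<in> carrier H"
    and norm: "\<And>s::nat. (\<Sum>g\<in>carrier G. \<phi> (clsum (h [^]\<^bsub>H\<^esub> s)) g * \<phi> (clsum (inv\<^bsub>H\<^esub> (h [^]\<^bsub>H\<^esub> s))) (inv\<^bsub>G\<^esub> g))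
        = of_nat (card (conj_class H (h [^]\<^bsub>H\<^esub> s)))"
    and g: "g \<in> carrier G"
  shows "\<phi> (clsum h) g \<in> {0, 1}" "\<phi> (clsum (inv\<^bsub>H\<^esub> h)) (inv\<^bsub>G\<^esub> g) = \<phi> (clsum h) g"
proof -
  (* The factor 2 keeps n above 1 for trivial groups. *)
  define n where "n = 2 * card (carrier G) * card (carrier H)"
  have nG: "card (carrier G) dvd n" and nH: "card (carrier H) dvd n" by (auto simp: n_def)
  have n1: "n > 1"
  proof -
    have "0 < card (carrier G) * card (carrier H)" using G.card_pos H.card_pos by simp
    then show ?thesis unfolding n_def mult.assoc by linarith
  qed
  obtain \<zeta> :: 'k where z: "primroot n \<zeta>" using exists_primroot[of n] n1 by auto
  have "\<forall>g\<in>carrier G. \<exists>Q. \<forall>s. coprime s n \<longrightarrow> s > 0 \<longrightarrow>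
      \<phi> (clsum (h [^]\<^bsub>H\<^esub> (s::nat))) (g [^]\<^bsub>G\<^esub> s) = rpoly Q (\<zeta> ^ s)"
    using entries_along_powers[OF h _ z nG nH] by blast
  then obtain Q where "\<forall>g\<in>carrier G. \<forall>s. coprime s n \<longrightarrow> s > 0 \<longrightarrow>
      \<phi> (clsum (h [^]\<^bsub>H\<^esub> (s::nat))) (g [^]\<^bsub>G\<^esub> s) = rpoly (Q g) (\<zeta> ^ s)" by (rule bchoice[THEN exE])
  then have Q: "rpoly (Q g) (\<zeta> ^ s) = \<phi> (clsum (h [^]\<^bsub>H\<^esub> s)) (g [^]\<^bsub>G\<^esub> s)"
    if "g \<in> carrier G" "coprime s n" "s > 0" for g and s :: nat using that by simp
  have units: "coprime s n" "s > 0" if "s \<in> units_mod n" for s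
    using that n1 by (auto simp: units_mod_def intro!: gr0I)
  have n1': "coprime (n - 1) n" "n - 1 > 0" using n1 by (cases n; simp)+
  have units': "coprime (s * (n - 1)) n" "s * (n - 1) > 0" if "s \<in> units_mod n" for s
    using units[OF that] n1' by auto
  have powH: "h [^]\<^bsub>H\<^esub> (s * (n - 1)) = inv\<^bsub>H\<^esub> (h [^]\<^bsub>H\<^esub> s)" for s :: nat
    by (rule H.pow_inverse[OF h H.pow_dvd[OF h nH]]) (use n1 in simp)
  have powG: "g [^]\<^bsub>G\<^esub> (s * (n - 1)) = inv\<^bsub>G\<^esub> (g [^]\<^bsub>G\<^esub> s)" if "g \<in> carrier G" for g and s :: nat
    by (rule G.pow_inverse[OF that G.pow_dvd[OF that nG]]) (use n1 in simp)
  have cop: "coprime s (card (carrier G))" if "coprime s n" for s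
    by (rule coprime_divisors[OF dvd_refl nG that])
  have eq: "(\<Sum>g\<in>carrier G. rpoly (Q g) (\<zeta> ^ s) * rpoly (Q g) (\<zeta> ^ (s * (n - 1)))) = (\<Sum>g\<in>carrier G. rpoly (Q g) (\<zeta> ^ s))"
    if s: "s \<in> units_mod n" for s
  proof -
    let ?h = "h [^]\<^bsub>H\<^esub> s"
    have hs: "?h \<in> carrier H" using h by simp
    note bij = G.bij_pow[OF cop[OF units(1)[OF s]] units(2)[OF s]]
    have "(\<Sum>g\<in>carrier G. rpoly (Q g) (\<zeta> ^ s) * rpoly (Q g) (\<zeta> ^ (s * (n - 1)))) =
        (\<Sum>g\<in>carrier G. \<phi> (clsum ?h) (g [^]\<^bsub>G\<^esub> s) * \<phi> (clsum (inv\<^bsub>H\<^esub> ?h)) (inv\<^bsub>G\<^esub> (g [^]\<^bsub>G\<^esub> s)))"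
      by (intro sum.cong refl) (simp only: Q units[OF s] units'[OF s] powH powG)
    also have "\<dots> = (\<Sum>g\<in>carrier G. \<phi> (clsum ?h) g * \<phi> (clsum (inv\<^bsub>H\<^esub> ?h)) (inv\<^bsub>G\<^esub> g))"
      by (rule sum.reindex_bij_betw[OF bij])
    also have "\<dots> = of_nat (card (conj_class H ?h))" by (rule norm)
    also have "\<dots> = (\<Sum>y\<in>carrier H. clsum ?h y)" by (rule sum_class_sum[OF H.conj_class_subset[OF hs], symmetric])
    also have "\<dots> = (\<Sum>g\<in>carrier G. \<phi> (clsum ?h) g)" by (rule augmentation[OF clsum_class_fun[OF hs], symmetric])
    also have "\<dots> = (\<Sum>g\<in>carrier G. \<phi> (clsum ?h) (g [^]\<^bsub>G\<^esub> s))" by (rule sum.reindex_bij_betw[OF bij, symmetric])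
    also have "\<dots> = (\<Sum>g\<in>carrier G. rpoly (Q g) (\<zeta> ^ s))"
      by (intro sum.cong refl) (simp only: Q units[OF s])
    finally show ?thesis .
  qed
  have inR: "rpoly (Q g) (\<zeta> ^ s) \<in> R" if "g \<in> carrier G" "s \<in> units_mod n" for g s
    using Q[OF that(1) units[OF that(2)]] entries h that by simp
  have int: "integral_over \<int> (of_nat (card (carrier G)) * rpoly (Q g) (\<zeta> ^ s))" if "g \<in> carrier G" "s \<in> units_mod n" for g s
    using Q[OF that(1) units[OF that(2)]] entries_integral h that by simp
  note res = rational_family_01[OF z n1 R G.card_pos no_inverse G.fin inR int eq g]
  have one: "rpoly (Q g) \<zeta> = \<phi> (clsum h) g" using Q[OF g, of 1] h g by simp
  have "rpoly (Q g) (\<zeta> ^ (1 * (n - 1))) = \<phi> (clsum (h [^]\<^bsub>H\<^esub> (1 * (n - 1)))) (g [^]\<^bsub>G\<^esub> (1 * (n - 1)))"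
    by (rule Q[OF g]) (use n1' in auto)
  then have two: "rpoly (Q g) (\<zeta> ^ (n - 1)) = \<phi> (clsum (inv\<^bsub>H\<^esub> h)) (inv\<^bsub>G\<^esub> g)"
    unfolding powH powG[OF g] using h g by simp
  show "\<phi> (clsum h) g \<in> {0, 1}" using res(1) by (simp only: one)
  show "\<phi> (clsum (inv\<^bsub>H\<^esub> h)) (inv\<^bsub>G\<^esub> g) = \<phi> (clsum h) g" using res(2) by (simp only: one two)
qed

section \<open>Induction along the lower central series\<close>

text \<open>Evaluation at the identity commutes with \<open>\<phi>\<close> on the central elements supported on \<open>N\<close>; it is
  enough to ask this of class sums.\<close>

definition unit_coeff_kept :: "'h set \<Rightarrow> bool" where
  "unit_coeff_kept N \<longleftrightarrow> (\<forall>h\<in>N. \<phi> (clsum h) \<one>\<^bsub>G\<^esub> = (if h = \<one>\<^bsub>H\<^esub> then 1 else 0))"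

lemma unit_coeff_keptD:
  assumes N: "unit_coeff_kept N" "N \<subseteq> carrier H" and z: "class_fun H z" and supp: "\<And>h. z h \<noteq> 0 \<Longrightarrow> h \<in> N"
  shows "\<phi> z \<one>\<^bsub>G\<^esub> = z \<one>\<^bsub>H\<^esub>"
proof -
  have "\<phi> z = \<phi> (\<lambda>h. \<Sum>C\<in>conj_classes H. z (H.crep C) * class_sum C h)" using H.class_fun_decomp[OF z] by simp
  also have "\<dots> = (\<lambda>g. \<Sum>C\<in>conj_classes H. z (H.crep C) * \<phi> (class_sum C) g)"
    by (rule phi_sum[OF H.finite_conj_classes H.class_fun_class])
  finally have "\<phi> z \<one>\<^bsub>G\<^esub> = (\<Sum>C\<in>conj_classes H. z (H.crep C) * \<phi> (class_sum C) \<one>\<^bsub>G\<^esub>)" by simp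
  also have "\<dots> = (\<Sum>C\<in>conj_classes H. if C = {\<one>\<^bsub>H\<^esub>} then z \<one>\<^bsub>H\<^esub> else 0)"
  proof (intro sum.cong refl)
    fix C assume C: "C \<in> conj_classes H"
    let ?c = "H.crep C"
    have c: "?c \<in> C" by (rule H.crep_in[OF C])
    then have cC: "C = conj_class H ?c" by (rule H.conj_class_eqI[OF C])
    have c1: "?c = \<one>\<^bsub>H\<^esub> \<longleftrightarrow> C = {\<one>\<^bsub>H\<^esub>}" using cC c H.conj_class_one by auto
    show "z ?c * \<phi> (class_sum C) \<one>\<^bsub>G\<^esub> = (if C = {\<one>\<^bsub>H\<^esub>} then z \<one>\<^bsub>H\<^esub> else 0)"
    proof (cases "z ?c = 0")
      case True
      then show ?thesis using c1 by auto
    next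
      case False
      then have "?c \<in> N" by (rule supp)
      then have "\<phi> (clsum ?c) \<one>\<^bsub>G\<^esub> = (if ?c = \<one>\<^bsub>H\<^esub> then 1 else 0)" using N(1) unfolding unit_coeff_kept_def by blast
      then have "\<phi> (class_sum C) \<one>\<^bsub>G\<^esub> = (if C = {\<one>\<^bsub>H\<^esub>} then 1 else 0)" unfolding cC[symmetric] c1 .
      then show ?thesis using c1 by auto
    qed
  qed
  also have "\<dots> = z \<one>\<^bsub>H\<^esub>"
    using H.finite_conj_classes H.conj_class_in[OF H.one_closed] by (simp add: H.conj_class_one)
  finally show ?thesis .
qed

text \<open>The left-hand side is the coefficient at the identity of the image of a product of two
  indicator functions, whose support lies in \<open>N\<close>.\<close>

lemma norm_of_subset:
  assumes N: "unit_coeff_kept N" "N \<subseteq> carrier H"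
    and U: "U \<subseteq> carrier H" "\<And>x u. x \<in> carrier H \<Longrightarrow> u \<in> U \<Longrightarrow> x \<otimes>\<^bsub>H\<^esub> u \<otimes>\<^bsub>H\<^esub> inv\<^bsub>H\<^esub> x \<in> U"
    and V: "V \<subseteq> carrier H" "\<And>x u. x \<in> carrier H \<Longrightarrow> u \<in> V \<Longrightarrow> x \<otimes>\<^bsub>H\<^esub> u \<otimes>\<^bsub>H\<^esub> inv\<^bsub>H\<^esub> x \<in> V"
    and UV: "\<And>u v. u \<in> U \<Longrightarrow> v \<in> V \<Longrightarrow> u \<otimes>\<^bsub>H\<^esub> v \<in> N"
  shows "(\<Sum>g\<in>carrier G. \<phi> (class_sum U) g * \<phi> (class_sum V) (inv\<^bsub>G\<^esub> g)) = of_nat (card {u \<in> U. inv\<^bsub>H\<^esub> u \<in> V})"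
proof -
  have cU: "class_fun H (class_sum U :: 'h \<Rightarrow> 'k)" and cV: "class_fun H (class_sum V :: 'h \<Rightarrow> 'k)"
    using H.class_sum_class_fun U V by blast+
  define z :: "'h \<Rightarrow> 'k" where "z = conv H (class_sum U) (class_sum V)"
  have cz: "class_fun H z" unfolding z_def by (rule H.conv_class_fun[OF cU cV])
  have "y \<in> N" if "z y \<noteq> 0" for y
  proof -
    have y: "y \<in> carrier H" using that cz by (auto simp: class_fun_def)
    then have "(\<Sum>x\<in>carrier H. class_sum U x * class_sum V (inv\<^bsub>H\<^esub> x \<otimes>\<^bsub>H\<^esub> y) :: 'k) \<noteq> 0"
      using that by (simp add: z_def conv_def)
    then obtain x where x: "x \<in> carrier H" "class_sum U x * class_sum V (inv\<^bsub>H\<^esub> x \<otimes>\<^bsub>H\<^esub> y) \<noteq> (0::'k)"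
      by (meson sum.neutral)
    then have "x \<in> U" "inv\<^bsub>H\<^esub> x \<otimes>\<^bsub>H\<^esub> y \<in> V" by (auto simp: class_sum_def split: if_splits)
    then have "x \<otimes>\<^bsub>H\<^esub> (inv\<^bsub>H\<^esub> x \<otimes>\<^bsub>H\<^esub> y) \<in> N" by (rule UV)
    then show ?thesis using x y by (simp add: H.inv_cancel)
  qed
  then have "\<phi> z \<one>\<^bsub>G\<^esub> = z \<one>\<^bsub>H\<^esub>" by (rule unit_coeff_keptD[OF N cz])
  also have "z \<one>\<^bsub>H\<^esub> = (\<Sum>x\<in>carrier H. class_sum U x * class_sum V (inv\<^bsub>H\<^esub> x))"
    unfolding z_def by (rule H.conv_at_one)
  also have "\<dots> = (\<Sum>x\<in>{u \<in> U. inv\<^bsub>H\<^esub> u \<in> V}. 1)"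
    using U(1) by (intro sum.mono_neutral_cong_right) (auto simp: class_sum_def H.fin)
  finally have "\<phi> z \<one>\<^bsub>G\<^esub> = of_nat (card {u \<in> U. inv\<^bsub>H\<^esub> u \<in> V})" by simp
  moreover have "\<phi> z = conv G (\<phi> (class_sum U)) (\<phi> (class_sum V))" unfolding z_def by (rule phi_conv[OF cU cV])
  ultimately have "conv G (\<phi> (class_sum U)) (\<phi> (class_sum V)) \<one>\<^bsub>G\<^esub> = of_nat (card {u \<in> U. inv\<^bsub>H\<^esub> u \<in> V})" by simp
  then show ?thesis by (simp only: G.conv_at_one)
qed

text \<open>The second condition is what complex conjugation says about a real entry: conjugation
  replaces both group elements by their inverses.\<close>

definition zero_one :: "'h set \<Rightarrow> bool" where
  "zero_one N \<longleftrightarrow> (\<forall>h\<in>N. \<forall>g\<in>carrier G. \<phi> (clsum h) g \<in> {0, 1} \<and> \<phi> (clsum (inv\<^bsub>H\<^esub> h)) (inv\<^bsub>G\<^esub> g) = \<phi> (clsum h) g)"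

text \<open>Modulo \<open>N\<close> the element \<open>h\<close> is central, so its conjugates cancel against those of its
  inverse.\<close>

lemma class_inverse_product:
  assumes N: "normal N H" and h: "h \<in> carrier H"
    and comm: "\<And>x. x \<in> carrier H \<Longrightarrow> x \<otimes>\<^bsub>H\<^esub> h \<otimes>\<^bsub>H\<^esub> inv\<^bsub>H\<^esub> x \<otimes>\<^bsub>H\<^esub> inv\<^bsub>H\<^esub> h \<in> N"
    and u: "u \<in> conj_class H h" and v: "v \<in> conj_class H (inv\<^bsub>H\<^esub> h)"
  shows "u \<otimes>\<^bsub>H\<^esub> v \<in> N"
proof -
  note sg = normal_imp_subgroup[OF N]
  obtain x where x: "x \<in> carrier H" "u = x \<otimes>\<^bsub>H\<^esub> h \<otimes>\<^bsub>H\<^esub> inv\<^bsub>H\<^esub> x" using u by (auto simp: conj_class_def)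
  obtain y where y: "y \<in> carrier H" "v = y \<otimes>\<^bsub>H\<^esub> inv\<^bsub>H\<^esub> h \<otimes>\<^bsub>H\<^esub> inv\<^bsub>H\<^esub> y" using v by (auto simp: conj_class_def)
  have "(x \<otimes>\<^bsub>H\<^esub> h \<otimes>\<^bsub>H\<^esub> inv\<^bsub>H\<^esub> x \<otimes>\<^bsub>H\<^esub> inv\<^bsub>H\<^esub> h) \<otimes>\<^bsub>H\<^esub> inv\<^bsub>H\<^esub> (y \<otimes>\<^bsub>H\<^esub> h \<otimes>\<^bsub>H\<^esub> inv\<^bsub>H\<^esub> y \<otimes>\<^bsub>H\<^esub> inv\<^bsub>H\<^esub> h) \<in> N"
    by (intro subgroup.m_closed[OF sg] subgroup.m_inv_closed[OF sg] comm x y)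
  moreover have "(x \<otimes>\<^bsub>H\<^esub> h \<otimes>\<^bsub>H\<^esub> inv\<^bsub>H\<^esub> x \<otimes>\<^bsub>H\<^esub> inv\<^bsub>H\<^esub> h) \<otimes>\<^bsub>H\<^esub> inv\<^bsub>H\<^esub> (y \<otimes>\<^bsub>H\<^esub> h \<otimes>\<^bsub>H\<^esub> inv\<^bsub>H\<^esub> y \<otimes>\<^bsub>H\<^esub> inv\<^bsub>H\<^esub> h) = u \<otimes>\<^bsub>H\<^esub> v"
    using x y h by (simp add: H.inv_mult_group H.m_assoc H.inv_cancel)
  ultimately show ?thesis by simp
qed

text \<open>The product of the class sums of \<open>h\<close> and its inverse is supported on \<open>N\<close>. The same holds for
  all powers of \<open>h\<close>, which provide the Galois conjugates.\<close>

lemma zero_one_step: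
  assumes N: "normal N H" "unit_coeff_kept N" and M: "subgroup M H"
    and comm: "\<And>x h. x \<in> carrier H \<Longrightarrow> h \<in> M \<Longrightarrow> x \<otimes>\<^bsub>H\<^esub> h \<otimes>\<^bsub>H\<^esub> inv\<^bsub>H\<^esub> x \<otimes>\<^bsub>H\<^esub> inv\<^bsub>H\<^esub> h \<in> N"
  shows "zero_one M"
  unfolding zero_one_def
proof (intro ballI)
  fix h g assume hM: "h \<in> M" and g: "g \<in> carrier G"
  note Nsub = subgroup.subset[OF normal_imp_subgroup[OF N(1)]]
  have MH: "M \<subseteq> carrier H" by (rule subgroup.subset[OF M])
  have h: "h \<in> carrier H" using hM MH by blast
  have "(\<Sum>g\<in>carrier G. \<phi> (clsum (h [^]\<^bsub>H\<^esub> s)) g * \<phi> (clsum (inv\<^bsub>H\<^esub> (h [^]\<^bsub>H\<^esub> s))) (inv\<^bsub>G\<^esub> g))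
        = of_nat (card (conj_class H (h [^]\<^bsub>H\<^esub> s)))" for s :: nat
  proof -
    let ?h = "h [^]\<^bsub>H\<^esub> s"
    have hs: "?h \<in> carrier H" using h by simp
    have hsM: "?h \<in> M"
    proof (induction s)
      case 0
      show ?case using subgroup.one_closed[OF M] by simp
    next
      case (Suc s)
      then show ?case using subgroup.m_closed[OF M _ hM] by simp
    qed
    have "(\<Sum>g\<in>carrier G. \<phi> (clsum ?h) g * \<phi> (clsum (inv\<^bsub>H\<^esub> ?h)) (inv\<^bsub>G\<^esub> g))
        = of_nat (card {u \<in> conj_class H ?h. inv\<^bsub>H\<^esub> u \<in> conj_class H (inv\<^bsub>H\<^esub> ?h)})"
      by (rule norm_of_subset[OF N(2) Nsub])
        (use hs H.conj_class_subset H.conj_class_closed class_inverse_product[OF N(1) hs comm[OF _ hsM]] in \<open>auto dest: subsetD[OF H.conj_class_subset]\<close>)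
    also have "{u \<in> conj_class H ?h. inv\<^bsub>H\<^esub> u \<in> conj_class H (inv\<^bsub>H\<^esub> ?h)} = conj_class H ?h"
      using H.conj_class_inv[OF hs] H.conj_class_subset[OF hs] by blast
    finally show ?thesis .
  qed
  from entries_01[OF h this g]
  show "\<phi> (clsum h) g \<in> {0, 1} \<and> \<phi> (clsum (inv\<^bsub>H\<^esub> h)) (inv\<^bsub>G\<^esub> g) = \<phi> (clsum h) g" by blast
qed

lemma phi_class_sum_union:
  assumes U: "U \<subseteq> carrier H" "\<And>x u. x \<in> carrier H \<Longrightarrow> u \<in> U \<Longrightarrow> x \<otimes>\<^bsub>H\<^esub> u \<otimes>\<^bsub>H\<^esub> inv\<^bsub>H\<^esub> x \<in> U"
  shows "\<phi> (class_sum U) g = (\<Sum>C\<in>{C \<in> conj_classes H. C \<subseteq> U}. \<phi> (class_sum C) g)"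
proof -
  have "\<phi> (class_sum U) = \<phi> (\<lambda>g. \<Sum>C\<in>{C \<in> conj_classes H. C \<subseteq> U}. 1 * class_sum C g)"
    by (rule arg_cong[OF H.class_sum_union[OF U]])
  also have "\<dots> = (\<lambda>g. \<Sum>C\<in>{C \<in> conj_classes H. C \<subseteq> U}. 1 * \<phi> (class_sum C) g)"
    by (rule phi_sum) (use H.finite_conj_classes H.class_fun_class in auto)
  finally show ?thesis by simp
qed

text \<open>A sum of vectors with entries 0 and 1 cannot cancel: this gives the last claim.\<close>

lemma union_nat_valued:
  assumes ZM: "zero_one M" and MH: "M \<subseteq> carrier H" and U: "U \<subseteq> M" "\<And>x u. x \<in> carrier H \<Longrightarrow> u \<in> U \<Longrightarrow> x \<otimes>\<^bsub>H\<^esub> u \<otimes>\<^bsub>H\<^esub> inv\<^bsub>H\<^esub> x \<in> U"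
    and g: "g \<in> carrier G"
  shows "\<phi> (class_sum U) g \<in> \<nat>"
    and "\<phi> (class_sum (m_inv H ` U)) (inv\<^bsub>G\<^esub> g) = \<phi> (class_sum U) g"
    and "\<phi> (class_sum U) g = 0 \<Longrightarrow> h \<in> U \<Longrightarrow> \<phi> (clsum h) g = 0"
proof -
  have UH: "U \<subseteq> carrier H" using U MH by blast
  let ?S = "{C \<in> conj_classes H. C \<subseteq> U}"
  have finS: "finite ?S" using H.finite_conj_classes by simp
  have C: "\<phi> (class_sum C) g \<in> {0, 1}" "\<phi> (class_sum (m_inv H ` C)) (inv\<^bsub>G\<^esub> g) = \<phi> (class_sum C) g" if C: "C \<in> ?S" for C
  proof -
    have c: "H.crep C \<in> C" using C H.crep_in by blast
    then have cM: "H.crep C \<in> M" and cH: "H.crep C \<in> carrier H" using C U MH by blast+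
    have e: "C = conj_class H (H.crep C)" using C c H.conj_class_eqI by blast
    have "m_inv H ` conj_class H (H.crep C) = conj_class H (inv\<^bsub>H\<^esub> (H.crep C))"
    proof (intro equalityI subsetI)
      fix u assume "u \<in> m_inv H ` conj_class H (H.crep C)"
      then show "u \<in> conj_class H (inv\<^bsub>H\<^esub> (H.crep C))" using H.conj_class_inv[OF cH] H.conj_class_subset[OF cH] by blast
    next
      fix u assume u: "u \<in> conj_class H (inv\<^bsub>H\<^esub> (H.crep C))"
      then have uH: "u \<in> carrier H" using H.conj_class_subset[OF H.inv_closed[OF cH]] by blast
      then have "inv\<^bsub>H\<^esub> u \<in> conj_class H (H.crep C)" using H.conj_class_inv[OF cH, of "inv\<^bsub>H\<^esub> u"] u by simp
      then show "u \<in> m_inv H ` conj_class H (H.crep C)" using uH by (intro image_eqI[of _ _ "inv\<^bsub>H\<^esub> u"]) auto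
    qed
    then show "\<phi> (class_sum C) g \<in> {0, 1}" "\<phi> (class_sum (m_inv H ` C)) (inv\<^bsub>G\<^esub> g) = \<phi> (class_sum C) g"
      using ZM cM g e unfolding zero_one_def by metis+
  qed
  have eU: "\<phi> (class_sum U) g = (\<Sum>C\<in>?S. \<phi> (class_sum C) g)" by (rule phi_class_sum_union[OF UH U(2)])
  have nat: "\<phi> (class_sum C) g = of_nat (if \<phi> (class_sum C) g = 0 then 0 else 1)" if "C \<in> ?S" for C using C(1)[OF that] by auto
  have eN: "\<phi> (class_sum U) g = of_nat (\<Sum>C\<in>?S. if \<phi> (class_sum C) g = 0 then 0 else 1)"
    unfolding eU of_nat_sum by (rule sum.cong[OF refl nat])
  show "\<phi> (class_sum U) g \<in> \<nat>" unfolding eN by (rule of_nat_in_Nats)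
  show "\<phi> (clsum h) g = 0" if z: "\<phi> (class_sum U) g = 0" and h: "h \<in> U"
  proof -
    have "(\<Sum>C\<in>?S. if \<phi> (class_sum C) g = 0 then 0 else 1 :: nat) = 0" using z unfolding eN of_nat_eq_0_iff .
    moreover have "conj_class H h \<subseteq> U" using h U(2) by (auto simp: conj_class_def)
    then have "conj_class H h \<in> ?S" using h UH H.conj_class_in by blast
    ultimately have "(if \<phi> (clsum h) g = 0 then 0 else 1 :: nat) = 0" unfolding sum_eq_0_iff[OF finS] by (rule bspec)
    then show ?thesis by (simp split: if_splits)
  qed
  have invU: "m_inv H ` U \<subseteq> carrier H" using UH by auto
  have invU': "x \<otimes>\<^bsub>H\<^esub> u \<otimes>\<^bsub>H\<^esub> inv\<^bsub>H\<^esub> x \<in> m_inv H ` U" if x: "x \<in> carrier H" and u: "u \<in> m_inv H ` U" for x u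
  proof -
    obtain v where v: "v \<in> U" "u = inv\<^bsub>H\<^esub> v" using u by blast
    then have vH: "v \<in> carrier H" using UH by blast
    have "x \<otimes>\<^bsub>H\<^esub> u \<otimes>\<^bsub>H\<^esub> inv\<^bsub>H\<^esub> x = inv\<^bsub>H\<^esub> (x \<otimes>\<^bsub>H\<^esub> v \<otimes>\<^bsub>H\<^esub> inv\<^bsub>H\<^esub> x)"
      unfolding v(2) using vH x by (simp add: H.inv_mult_group H.m_assoc)
    then show ?thesis using U(2)[OF x v(1)] by simp
  qed
  have cinv: "m_inv H ` C \<in> conj_classes H" if CC: "C \<in> conj_classes H" for C
  proof -
    obtain a where a: "a \<in> carrier H" "C = conj_class H a" using CC by (rule H.conj_classesE)
    have "m_inv H ` C = conj_class H (inv\<^bsub>H\<^esub> a)"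
    proof (intro equalityI subsetI)
      fix u assume "u \<in> m_inv H ` C"
      then show "u \<in> conj_class H (inv\<^bsub>H\<^esub> a)" using a H.conj_class_inv[OF a(1)] H.conj_class_subset[OF a(1)] by blast
    next
      fix u assume u: "u \<in> conj_class H (inv\<^bsub>H\<^esub> a)"
      then have uH: "u \<in> carrier H" using H.conj_class_subset[OF H.inv_closed[OF a(1)]] by blast
      then have "inv\<^bsub>H\<^esub> u \<in> C" using a H.conj_class_inv[OF a(1), of "inv\<^bsub>H\<^esub> u"] u by simp
      then show "u \<in> m_inv H ` C" using uH by (intro image_eqI[of _ _ "inv\<^bsub>H\<^esub> u"]) auto
    qed
    then show ?thesis using a H.conj_class_in by simp
  qed
  have invinv: "m_inv H ` (m_inv H ` C) = C" if "C \<subseteq> carrier H" for C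
    unfolding image_image using that by (auto simp: image_iff subset_iff)
  have sub: "C \<subseteq> carrier H" if "C \<in> conj_classes H" for C using that H.conj_class_carrier by blast
  have "\<phi> (class_sum (m_inv H ` U)) (inv\<^bsub>G\<^esub> g) = (\<Sum>C\<in>{C \<in> conj_classes H. C \<subseteq> m_inv H ` U}. \<phi> (class_sum C) (inv\<^bsub>G\<^esub> g))"
    by (rule phi_class_sum_union[OF invU invU'])
  also have "\<dots> = (\<Sum>C\<in>?S. \<phi> (class_sum (m_inv H ` C)) (inv\<^bsub>G\<^esub> g))"
  proof (rule sum.reindex_bij_witness[of _ "\<lambda>C. m_inv H ` C" "\<lambda>C. m_inv H ` C"])
    fix C assume C: "C \<in> {C \<in> conj_classes H. C \<subseteq> m_inv H ` U}"
    then show "m_inv H ` (m_inv H ` C) = C" using invinv sub by blast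
    then show "\<phi> (class_sum (m_inv H ` (m_inv H ` C))) (inv\<^bsub>G\<^esub> g) = \<phi> (class_sum C) (inv\<^bsub>G\<^esub> g)" by simp
    have "m_inv H ` C \<subseteq> m_inv H ` (m_inv H ` U)" using C by (intro image_mono) simp
    then show "m_inv H ` C \<in> ?S" using C cinv invinv[OF UH] by simp
  next
    fix C assume C: "C \<in> ?S"
    then show "m_inv H ` (m_inv H ` C) = C" using invinv sub by blast
    show "m_inv H ` C \<in> {C \<in> conj_classes H. C \<subseteq> m_inv H ` U}" using C cinv by auto
  qed
  also have "\<dots> = (\<Sum>C\<in>?S. \<phi> (class_sum C) g)" by (rule sum.cong[OF refl C(2)])
  finally show "\<phi> (class_sum (m_inv H ` U)) (inv\<^bsub>G\<^esub> g) = \<phi> (class_sum U) g" using eU by simp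
qed

text \<open>With \<open>u\<close> and \<open>t\<close> the images of the sums over the coset \<open>N h\<close> and over \<open>N\<close>, the norm of \<open>u -
  t\<close> is \<open>2 |N| (1 - u(1))\<close>. As \<open>u(1)\<close> is a natural number and \<open>u \<noteq> t\<close>, it vanishes.\<close>

lemma unit_coeff_kept_step:
  assumes N: "normal N H" "unit_coeff_kept N" and M: "subgroup M H" "N \<subseteq> M"
    and comm: "\<And>x h. x \<in> carrier H \<Longrightarrow> h \<in> M \<Longrightarrow> x \<otimes>\<^bsub>H\<^esub> h \<otimes>\<^bsub>H\<^esub> inv\<^bsub>H\<^esub> x \<otimes>\<^bsub>H\<^esub> inv\<^bsub>H\<^esub> h \<in> N"
  shows "unit_coeff_kept M"
  unfolding unit_coeff_kept_def
proof (intro ballI)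
  fix h assume hM: "h \<in> M"
  note ZM = zero_one_step[OF N M(1) comm]
  note sg = normal_imp_subgroup[OF N(1)]
  have NH: "N \<subseteq> carrier H" by (rule subgroup.subset[OF sg])
  have MH: "M \<subseteq> carrier H" by (rule subgroup.subset[OF M(1)])
  have h: "h \<in> carrier H" using hM MH by blast
  note Nconj = normal.inv_op_closed2[OF N(1)]
  show "\<phi> (clsum h) \<one>\<^bsub>G\<^esub> = (if h = \<one>\<^bsub>H\<^esub> then 1 else 0)"
  proof (cases "h \<in> N")
    case True
    then show ?thesis using N(2) by (simp add: unit_coeff_kept_def)
  next
    case False
    have h1: "h \<noteq> \<one>\<^bsub>H\<^esub>" using False subgroup.one_closed[OF sg] by blast
    define U where "U = {y \<in> carrier H. y \<otimes>\<^bsub>H\<^esub> inv\<^bsub>H\<^esub> h \<in> N}"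
    have UH: "U \<subseteq> carrier H" by (auto simp: U_def)
    have hU: "h \<in> U" using h subgroup.one_closed[OF sg] by (simp add: U_def)
    have UM: "U \<subseteq> M"
    proof
      fix y assume y: "y \<in> U"
      then have "y \<otimes>\<^bsub>H\<^esub> inv\<^bsub>H\<^esub> h \<in> M" using M(2) by (auto simp: U_def)
      from subgroup.m_closed[OF M(1) this hM]
      have "y \<otimes>\<^bsub>H\<^esub> inv\<^bsub>H\<^esub> h \<otimes>\<^bsub>H\<^esub> h \<in> M" .
      then show "y \<in> M" using y h by (simp add: U_def H.inv_cancel)
    qed
    have Ucl: "x \<otimes>\<^bsub>H\<^esub> u \<otimes>\<^bsub>H\<^esub> inv\<^bsub>H\<^esub> x \<in> U" if x: "x \<in> carrier H" and u: "u \<in> U" for x u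
    proof -
      have uH: "u \<in> carrier H" and uN: "u \<otimes>\<^bsub>H\<^esub> inv\<^bsub>H\<^esub> h \<in> N" using u by (auto simp: U_def)
      have "(x \<otimes>\<^bsub>H\<^esub> (u \<otimes>\<^bsub>H\<^esub> inv\<^bsub>H\<^esub> h) \<otimes>\<^bsub>H\<^esub> inv\<^bsub>H\<^esub> x) \<otimes>\<^bsub>H\<^esub> (x \<otimes>\<^bsub>H\<^esub> h \<otimes>\<^bsub>H\<^esub> inv\<^bsub>H\<^esub> x \<otimes>\<^bsub>H\<^esub> inv\<^bsub>H\<^esub> h) \<in> N"
        by (rule subgroup.m_closed[OF sg Nconj[OF x uN] comm[OF x hM]])
      moreover have "(x \<otimes>\<^bsub>H\<^esub> (u \<otimes>\<^bsub>H\<^esub> inv\<^bsub>H\<^esub> h) \<otimes>\<^bsub>H\<^esub> inv\<^bsub>H\<^esub> x) \<otimes>\<^bsub>H\<^esub> (x \<otimes>\<^bsub>H\<^esub> h \<otimes>\<^bsub>H\<^esub> inv\<^bsub>H\<^esub> x \<otimes>\<^bsub>H\<^esub> inv\<^bsub>H\<^esub> h)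
          = x \<otimes>\<^bsub>H\<^esub> u \<otimes>\<^bsub>H\<^esub> inv\<^bsub>H\<^esub> x \<otimes>\<^bsub>H\<^esub> inv\<^bsub>H\<^esub> h"
        using x uH h by (simp add: H.m_assoc H.inv_cancel)
      ultimately show ?thesis using x uH by (simp add: U_def)
    qed
    have Ncl: "x \<otimes>\<^bsub>H\<^esub> u \<otimes>\<^bsub>H\<^esub> inv\<^bsub>H\<^esub> x \<in> N" if "x \<in> carrier H" "u \<in> N" for x u using Nconj that by blast
    have uv: "u \<otimes>\<^bsub>H\<^esub> inv\<^bsub>H\<^esub> v \<in> N" if "u \<in> U" "v \<in> U" for u v
    proof -
      have un: "u \<otimes>\<^bsub>H\<^esub> inv\<^bsub>H\<^esub> h \<in> N" and vn: "v \<otimes>\<^bsub>H\<^esub> inv\<^bsub>H\<^esub> h \<in> N" using that by (simp_all add: U_def)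
      note subgroup.m_closed[OF sg un subgroup.m_inv_closed[OF sg vn]]
      moreover have "(u \<otimes>\<^bsub>H\<^esub> inv\<^bsub>H\<^esub> h) \<otimes>\<^bsub>H\<^esub> inv\<^bsub>H\<^esub> (v \<otimes>\<^bsub>H\<^esub> inv\<^bsub>H\<^esub> h) = u \<otimes>\<^bsub>H\<^esub> inv\<^bsub>H\<^esub> v"
        using that UH h by (simp add: H.inv_mult_group H.m_assoc H.inv_cancel subsetD)
      ultimately show ?thesis by simp
    qed
    have cardU: "card U = card N"
    proof -
      have "U = (\<lambda>y. y \<otimes>\<^bsub>H\<^esub> h) ` N"
      proof (intro equalityI subsetI)
        fix y assume "y \<in> U"
        then show "y \<in> (\<lambda>y. y \<otimes>\<^bsub>H\<^esub> h) ` N" using h by (intro image_eqI[of _ _ "y \<otimes>\<^bsub>H\<^esub> inv\<^bsub>H\<^esub> h"]) (auto simp: U_def H.inv_cancel)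
      next
        fix y assume "y \<in> (\<lambda>y. y \<otimes>\<^bsub>H\<^esub> h) ` N"
        then show "y \<in> U" using h NH by (auto simp: U_def H.inv_cancel subsetD)
      qed
      moreover have "inj_on (\<lambda>y. y \<otimes>\<^bsub>H\<^esub> h) N"
        using NH h by (intro inj_onI) (metis H.r_cancel subsetD)
      ultimately show ?thesis by (simp add: card_image)
    qed
    have invN: "m_inv H ` N = N"
      using NH subgroup.m_inv_closed[OF sg] by (auto simp: image_iff) (metis H.inv_inv subsetD)
    let ?u = "\<phi> (class_sum U)" and ?t = "\<phi> (class_sum N)"
    have cU: "class_fun H (class_sum U :: 'h \<Rightarrow> 'k)" by (rule H.class_sum_class_fun[OF UH Ucl])
    have cN: "class_fun H (class_sum N :: 'h \<Rightarrow> 'k)" by (rule H.class_sum_class_fun[OF NH Ncl])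
    have natU: "?u g \<in> \<nat>" "\<phi> (class_sum (m_inv H ` U)) (inv\<^bsub>G\<^esub> g) = ?u g"
      "?u g = 0 \<Longrightarrow> h' \<in> U \<Longrightarrow> \<phi> (clsum h') g = 0" if "g \<in> carrier G" for g h'
      using union_nat_valued[OF ZM MH UM _ that] Ucl by blast+
    have natN: "?t g \<in> \<nat>" "\<phi> (class_sum (m_inv H ` N)) (inv\<^bsub>G\<^esub> g) = ?t g" if "g \<in> carrier G" for g
      using union_nat_valued[OF ZM MH M(2) _ that] Ncl by blast+
    have uu: "(\<Sum>g\<in>carrier G. ?u g * ?u g) = of_nat (card N)"
    proof -
      have invU: "m_inv H ` U \<subseteq> carrier H" using UH by auto
      have invUcl: "x \<otimes>\<^bsub>H\<^esub> u \<otimes>\<^bsub>H\<^esub> inv\<^bsub>H\<^esub> x \<in> m_inv H ` U" if x: "x \<in> carrier H" and u: "u \<in> m_inv H ` U" for x u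
      proof -
        obtain v where v: "v \<in> U" "u = inv\<^bsub>H\<^esub> v" using u by blast
        then have vH: "v \<in> carrier H" using UH by blast
        have "x \<otimes>\<^bsub>H\<^esub> u \<otimes>\<^bsub>H\<^esub> inv\<^bsub>H\<^esub> x = inv\<^bsub>H\<^esub> (x \<otimes>\<^bsub>H\<^esub> v \<otimes>\<^bsub>H\<^esub> inv\<^bsub>H\<^esub> x)"
          unfolding v(2) using vH x by (simp add: H.inv_mult_group H.m_assoc)
        then show ?thesis using Ucl[OF x v(1)] by simp
      qed
      have "(\<Sum>g\<in>carrier G. ?u g * ?u g) = (\<Sum>g\<in>carrier G. ?u g * \<phi> (class_sum (m_inv H ` U)) (inv\<^bsub>G\<^esub> g))"
        by (intro sum.cong refl) (simp only: natU(2))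
      also have "\<dots> = of_nat (card {u \<in> U. inv\<^bsub>H\<^esub> u \<in> m_inv H ` U})"
        by (rule norm_of_subset[OF N(2) NH UH Ucl invU invUcl]) (use uv in auto)
      also have "{u \<in> U. inv\<^bsub>H\<^esub> u \<in> m_inv H ` U} = U" by auto
      finally show ?thesis by (simp add: cardU)
    qed
    have tinv: "?t (inv\<^bsub>G\<^esub> g) = ?t g" if "g \<in> carrier G" for g using natN(2)[OF that] by (simp only: invN)
    have tt: "(\<Sum>g\<in>carrier G. ?t g * ?t g) = of_nat (card N)"
    proof -
      have "(\<Sum>g\<in>carrier G. ?t g * ?t g) = (\<Sum>g\<in>carrier G. ?t g * ?t (inv\<^bsub>G\<^esub> g))"
        by (intro sum.cong refl) (simp only: tinv)
      also have "\<dots> = of_nat (card {u \<in> N. inv\<^bsub>H\<^esub> u \<in> N})"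
        by (rule norm_of_subset[OF N(2) NH NH Ncl NH Ncl subgroup.m_closed[OF sg]])
      also have "{u \<in> N. inv\<^bsub>H\<^esub> u \<in> N} = N" using subgroup.m_inv_closed[OF sg] by blast
      finally show ?thesis .
    qed
    have ut: "(\<Sum>g\<in>carrier G. ?u g * ?t g) = of_nat (card N) * ?u \<one>\<^bsub>G\<^esub>"
    proof -
      have UN: "conv H (class_sum U) (class_sum N) = (\<lambda>y. of_nat (card N) * class_sum U y :: 'k)"
      proof (rule ext)
        fix y
        show "conv H (class_sum U) (class_sum N) y = (of_nat (card N) * class_sum U y :: 'k)"
        proof (cases "y \<in> carrier H")
          case True
          have iff: "inv\<^bsub>H\<^esub> x \<otimes>\<^bsub>H\<^esub> y \<in> N \<longleftrightarrow> y \<in> U" if x: "x \<in> U" for x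
          proof -
            have xH: "x \<in> carrier H" using x UH by blast
            have swap: "x \<otimes>\<^bsub>H\<^esub> (inv\<^bsub>H\<^esub> x \<otimes>\<^bsub>H\<^esub> y) \<otimes>\<^bsub>H\<^esub> inv\<^bsub>H\<^esub> x = y \<otimes>\<^bsub>H\<^esub> inv\<^bsub>H\<^esub> x"
              "inv\<^bsub>H\<^esub> x \<otimes>\<^bsub>H\<^esub> (y \<otimes>\<^bsub>H\<^esub> inv\<^bsub>H\<^esub> x) \<otimes>\<^bsub>H\<^esub> inv\<^bsub>H\<^esub> (inv\<^bsub>H\<^esub> x) = inv\<^bsub>H\<^esub> x \<otimes>\<^bsub>H\<^esub> y"
              using xH True by (simp_all add: H.m_assoc H.inv_cancel)
            have "inv\<^bsub>H\<^esub> x \<otimes>\<^bsub>H\<^esub> y \<in> N \<longleftrightarrow> y \<otimes>\<^bsub>H\<^esub> inv\<^bsub>H\<^esub> x \<in> N"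
              using Ncl[OF xH, of "inv\<^bsub>H\<^esub> x \<otimes>\<^bsub>H\<^esub> y"] Ncl[OF H.inv_closed[OF xH], of "y \<otimes>\<^bsub>H\<^esub> inv\<^bsub>H\<^esub> x"]
              unfolding swap by blast
            also have "\<dots> \<longleftrightarrow> y \<in> U"
            proof
              assume a: "y \<otimes>\<^bsub>H\<^esub> inv\<^bsub>H\<^esub> x \<in> N"
              have "x \<otimes>\<^bsub>H\<^esub> inv\<^bsub>H\<^esub> h \<in> N" using x by (simp add: U_def)
              from subgroup.m_closed[OF sg a this]
              have "y \<otimes>\<^bsub>H\<^esub> inv\<^bsub>H\<^esub> h \<in> N" using xH True h by (simp add: H.m_assoc H.inv_cancel)
              then show "y \<in> U" using True by (simp add: U_def)
            qed (use uv x in blast)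
            finally show ?thesis .
          qed
          have "conv H (class_sum U) (class_sum N) y = (\<Sum>x\<in>carrier H. class_sum U x * (class_sum U y :: 'k))"
            using True by (auto simp: conv_def class_sum_def iff intro!: sum.cong)
          also have "\<dots> = of_nat (card U) * class_sum U y" unfolding sum_distrib_right[symmetric] sum_class_sum[OF UH] ..
          finally show ?thesis by (simp add: cardU)
        next
          case False
          then show ?thesis using UH by (auto simp: conv_def class_sum_def)
        qed
      qed
      have "(\<Sum>g\<in>carrier G. ?u g * ?t g) = (\<Sum>g\<in>carrier G. ?u g * ?t (inv\<^bsub>G\<^esub> g))"
        by (intro sum.cong refl) (simp only: tinv)
      also have "\<dots> = conv G ?u ?t \<one>\<^bsub>G\<^esub>" by (rule G.conv_at_one[symmetric])
      also have "conv G ?u ?t = \<phi> (conv H (class_sum U) (class_sum N))" by (rule phi_conv[OF cU cN, symmetric])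
      also have "\<phi> (conv H (class_sum U) (class_sum N)) = (\<lambda>g. of_nat (card N) * ?u g)" unfolding UN by (rule phi_smult[OF cU])
      finally show ?thesis .
    qed
    have "\<forall>g\<in>carrier G. \<exists>m. ?u g = of_nat m" using natU(1) by (auto elim!: Nats_cases)
    then obtain p where p: "\<And>g. g \<in> carrier G \<Longrightarrow> ?u g = of_nat (p g)" by metis
    have "\<forall>g\<in>carrier G. \<exists>m. ?t g = of_nat m" using natN(1) by (auto elim!: Nats_cases)
    then obtain q where q: "\<And>g. g \<in> carrier G \<Longrightarrow> ?t g = of_nat (q g)" by metis
    have "(of_nat (\<Sum>g\<in>carrier G. p g * p g) :: 'k) = of_nat (card N)" unfolding uu[symmetric] of_nat_sum
      by (intro sum.cong refl) (simp add: p)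
    then have pp: "(\<Sum>g\<in>carrier G. p g * p g) = card N" by (simp only: of_nat_eq_iff)
    have "(of_nat (\<Sum>g\<in>carrier G. q g * q g) :: 'k) = of_nat (card N)" unfolding tt[symmetric] of_nat_sum
      by (intro sum.cong refl) (simp add: q)
    then have qq: "(\<Sum>g\<in>carrier G. q g * q g) = card N" by (simp only: of_nat_eq_iff)
    have "(of_nat (\<Sum>g\<in>carrier G. p g * q g) :: 'k) = of_nat (card N * p \<one>\<^bsub>G\<^esub>)"
      unfolding of_nat_mult p[OF G.one_closed, symmetric] ut[symmetric] of_nat_sum
      by (intro sum.cong refl) (simp add: p q)
    then have pq: "(\<Sum>g\<in>carrier G. p g * q g) = card N * p \<one>\<^bsub>G\<^esub>" by (simp only: of_nat_eq_iff)
    have "p \<one>\<^bsub>G\<^esub> = 0"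
    proof (rule ccontr)
      assume "p \<one>\<^bsub>G\<^esub> \<noteq> 0"
      then have "card N * 1 \<le> card N * p \<one>\<^bsub>G\<^esub>" by (intro mult_le_mono) auto
      then have le: "int (card N) \<le> (\<Sum>g\<in>carrier G. int (p g) * int (q g))" using pq by (simp add: of_nat_sum[symmetric] of_nat_mult[symmetric] del: of_nat_sum of_nat_mult)
      have "(\<Sum>g\<in>carrier G. (int (p g) - int (q g))\<^sup>2) =
         (\<Sum>g\<in>carrier G. int (p g) * int (p g)) + (\<Sum>g\<in>carrier G. int (q g) * int (q g)) - 2 * (\<Sum>g\<in>carrier G. int (p g) * int (q g))"
        by (simp add: power2_eq_square algebra_simps sum.distrib sum_subtractf sum_distrib_left)
      also have "(\<Sum>g\<in>carrier G. int (p g) * int (p g)) = int (card N)" unfolding pp[symmetric] of_nat_sum of_nat_mult ..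
      also have "(\<Sum>g\<in>carrier G. int (q g) * int (q g)) = int (card N)" unfolding qq[symmetric] of_nat_sum of_nat_mult ..
      finally have "(\<Sum>g\<in>carrier G. (int (p g) - int (q g))\<^sup>2) \<le> 0" using le by linarith
      then have "(\<Sum>g\<in>carrier G. (int (p g) - int (q g))\<^sup>2) = 0" by (meson order_antisym sum_nonneg zero_le_power2)
      then have "\<forall>g\<in>carrier G. (int (p g) - int (q g))\<^sup>2 = 0" using G.fin by (subst (asm) sum_nonneg_eq_0_iff) auto
      then have "?u g = ?t g" if "g \<in> carrier G" for g using that p q by simp
      moreover have "class_fun G ?u" "class_fun G ?t"
        by (rule phi_class[OF cU], rule phi_class[OF cN])
      ultimately have "?u = ?t" unfolding class_fun_def by (intro ext) metis
      then have "(class_sum U :: 'h \<Rightarrow> 'k) = class_sum N"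
        by (rule phi_inj[OF cU cN])
      then have "class_sum U h = (class_sum N h :: 'k)" by simp
      then show False using hU False by (simp add: class_sum_def)
    qed
    then have "?u \<one>\<^bsub>G\<^esub> = 0" using p[OF G.one_closed] by simp
    then show ?thesis using natU(3)[OF G.one_closed _ hU] h1 by simp
  qed
qed

lemma nilpotent_unit_coeff_kept:
  assumes nil: "nilpotent_group H"
  shows "unit_coeff_kept (carrier H)" "zero_one (carrier H)"
proof -
  obtain n where n: "lower_central_series H n = {\<one>\<^bsub>H\<^esub>}" using nil by (auto simp: nilpotent_group_def)
  have one: "unit_coeff_kept {\<one>\<^bsub>H\<^esub>}"
  proof -
    have "clsum \<one>\<^bsub>H\<^esub> = delta1 H" unfolding H.conj_class_one by (auto simp: class_sum_def delta1_def)
    then have "\<phi> (clsum \<one>\<^bsub>H\<^esub>) = delta1 G" using phi_one by simp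
    then show ?thesis by (simp add: unit_coeff_kept_def delta1_def)
  qed
  have sub: "lower_central_series H (Suc i) \<subseteq> lower_central_series H i" for i
  proof -
    note sg = normal_imp_subgroup[OF H.lower_central_normal[of i]]
    have "{x \<otimes>\<^bsub>H\<^esub> y \<otimes>\<^bsub>H\<^esub> inv\<^bsub>H\<^esub> x \<otimes>\<^bsub>H\<^esub> inv\<^bsub>H\<^esub> y | x y. x \<in> lower_central_series H i \<and> y \<in> carrier H} \<subseteq> lower_central_series H i"
    proof
      fix u assume "u \<in> {x \<otimes>\<^bsub>H\<^esub> y \<otimes>\<^bsub>H\<^esub> inv\<^bsub>H\<^esub> x \<otimes>\<^bsub>H\<^esub> inv\<^bsub>H\<^esub> y | x y. x \<in> lower_central_series H i \<and> y \<in> carrier H}"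
      then obtain x y where xy: "u = x \<otimes>\<^bsub>H\<^esub> y \<otimes>\<^bsub>H\<^esub> inv\<^bsub>H\<^esub> x \<otimes>\<^bsub>H\<^esub> inv\<^bsub>H\<^esub> y" "x \<in> lower_central_series H i" "y \<in> carrier H" by blast
      have x: "x \<in> carrier H" using xy(2) subgroup.subset[OF sg] by blast
      have "x \<otimes>\<^bsub>H\<^esub> (y \<otimes>\<^bsub>H\<^esub> inv\<^bsub>H\<^esub> x \<otimes>\<^bsub>H\<^esub> inv\<^bsub>H\<^esub> y) \<in> lower_central_series H i"
        by (intro subgroup.m_closed[OF sg] xy(2) normal.inv_op_closed2[OF H.lower_central_normal xy(3)] subgroup.m_inv_closed[OF sg])
      then show "u \<in> lower_central_series H i" unfolding xy(1) using x xy(3) by (simp add: H.m_assoc)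
    qed
    then show ?thesis unfolding lower_central_series.simps by (rule H.generate_subgroup_incl[OF _ sg])
  qed
  have step: "unit_coeff_kept (lower_central_series H i)" if "unit_coeff_kept (lower_central_series H (Suc i))" for i
    by (rule unit_coeff_kept_step[OF H.lower_central_normal that normal_imp_subgroup[OF H.lower_central_normal] sub H.lower_central_commutator])
  have "unit_coeff_kept (lower_central_series H (n - k))" if "k \<le> n" for k
    using that
  proof (induction k)
    case 0
    then show ?case using n one by simp
  next
    case (Suc k)
    then have "Suc (n - Suc k) = n - k" by simp
    then show ?case using step[of "n - Suc k"] Suc by simp
  qed
  from this[of n] show good: "unit_coeff_kept (carrier H)" by simp
  have "normal (carrier H) H" using H.lower_central_normal[of 0] by simp
  then show "zero_one (carrier H)"
    by (rule zero_one_step[OF _ good H.subgroup_self]) auto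
qed

text \<open>Images of class sums are indicator functions of sets that are disjoint for different
  classes. A class sum of \<open>G\<close> is a combination of these, so it is constant on each of them; an
  image set that meets the class therefore lies in it, and it is closed under conjugation.\<close>

theorem classes_to_classes:
  assumes nil: "nilpotent_group H"
  obtains \<pi> where "bij_betw \<pi> (conj_classes H) (conj_classes G)"
    "\<And>C. C \<in> conj_classes H \<Longrightarrow> \<phi> (class_sum C) = class_sum (\<pi> C)"
    "\<And>C. C \<in> conj_classes H \<Longrightarrow> card (\<pi> C) = card C"
proof -
  note good = nilpotent_unit_coeff_kept[OF nil]
  define A where "A C = {g \<in> carrier G. \<phi> (class_sum C) g = 1}" for C
  have subH: "C \<subseteq> carrier H" if "C \<in> conj_classes H" for C using that H.conj_class_carrier by blast
  have A01: "\<phi> (class_sum C) g \<in> {0, 1}" if "C \<in> conj_classes H" "g \<in> carrier G" for C g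
    using that good(2) unfolding zero_one_def by (auto elim!: H.conj_classesE)
  have pA: "\<phi> (class_sum C) = class_sum (A C)" if C: "C \<in> conj_classes H" for C
  proof (rule ext)
    fix g
    show "\<phi> (class_sum C) g = class_sum (A C) g"
    proof (cases "g \<in> carrier G")
      case True
      then show ?thesis using A01[OF C True] by (auto simp: A_def class_sum_def)
    next
      case False
      then show ?thesis using phi_class[OF H.class_fun_class[OF C]] by (simp add: A_def class_sum_def class_fun_def)
    qed
  qed
  have cardA: "card (A C) = card C" if C: "C \<in> conj_classes H" for C
  proof -
    have "(\<Sum>g\<in>carrier G. \<phi> (class_sum C) g) = (\<Sum>g\<in>A C. 1)"
      unfolding pA[OF C] using G.fin by (intro sum.mono_neutral_cong_right) (auto simp: class_sum_def A_def)
    then have "(of_nat (card (A C)) :: 'k) = of_nat (card C)"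
      using augmentation[OF H.class_fun_class[OF C]] sum_class_sum[OF subH[OF C]] by simp
    then show ?thesis by (simp only: of_nat_eq_iff)
  qed
  have disj: "A C \<inter> A D = {}" if C: "C \<in> conj_classes H" and D: "D \<in> conj_classes H" and ne: "C \<noteq> D" for C D
  proof -
    obtain c where c: "c \<in> carrier H" "C = conj_class H c" using C by (rule H.conj_classesE)
    obtain d where d: "d \<in> carrier H" "D = conj_class H d" using D by (rule H.conj_classesE)
    have "(\<Sum>g\<in>carrier G. \<phi> (class_sum C) g * \<phi> (class_sum D) g) =
        (\<Sum>g\<in>carrier G. \<phi> (class_sum C) g * \<phi> (clsum (inv\<^bsub>H\<^esub> d)) (inv\<^bsub>G\<^esub> g))"
      using good(2) d unfolding zero_one_def by (intro sum.cong refl) simp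
    also have "\<dots> = of_nat (card {u \<in> C. inv\<^bsub>H\<^esub> u \<in> conj_class H (inv\<^bsub>H\<^esub> d)})"
      using c d subH[OF C] H.conj_class_subset[OF H.inv_closed[OF d(1)]]
      by (intro norm_of_subset[OF good(1)]) (auto intro: H.conj_class_closed)
    also have "{u \<in> C. inv\<^bsub>H\<^esub> u \<in> conj_class H (inv\<^bsub>H\<^esub> d)} = {}"
      using H.conj_class_inv[OF d(1)] subH[OF C] d H.conj_class_eqI[OF C] H.conj_class_eqI[OF D] ne by blast
    finally have "(\<Sum>g\<in>carrier G. \<phi> (class_sum C) g * \<phi> (class_sum D) g) = 0" by simp
    moreover have "(\<Sum>g\<in>carrier G. \<phi> (class_sum C) g * \<phi> (class_sum D) g) = (\<Sum>g\<in>A C \<inter> A D. 1)"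
      unfolding pA[OF C] pA[OF D] using G.fin
      by (intro sum.mono_neutral_cong_right) (auto simp: class_sum_def A_def)
    ultimately have "card (A C \<inter> A D) = 0" by simp
    moreover have "finite (A C \<inter> A D)" using G.fin by (simp add: A_def)
    ultimately show ?thesis by simp
  qed
  have hit: "\<exists>C\<in>conj_classes H. A C = E" if E: "E \<in> conj_classes G" for E
  proof -
    obtain e where e: "e \<in> E" using G.crep_in[OF E] by blast
    have eG: "e \<in> carrier G" and Ee: "E = conj_class G e" using G.conj_class_carrier[OF E e] G.conj_class_eqI[OF E e] .
    obtain z where z: "class_fun H z" "\<phi> z = (class_sum E :: 'g \<Rightarrow> 'k)" using phi_surj[OF G.class_fun_class[OF E]] by blast
    have "\<phi> z = \<phi> (\<lambda>h. \<Sum>C\<in>conj_classes H. z (H.crep C) * class_sum C h)" using H.class_fun_decomp[OF z(1)] by simp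
    also have "\<dots> = (\<lambda>g. \<Sum>C\<in>conj_classes H. z (H.crep C) * \<phi> (class_sum C) g)"
      by (rule phi_sum[OF H.finite_conj_classes H.class_fun_class])
    finally have dec: "class_sum E g = (\<Sum>C\<in>conj_classes H. z (H.crep C) * class_sum (A C) g)" for g
      unfolding z(2) by (auto simp: pA intro: sum.cong)
    have val: "class_sum E g = z (H.crep C)" if C: "C \<in> conj_classes H" and g: "g \<in> A C" for C g
    proof -
      have "(\<Sum>D\<in>conj_classes H. z (H.crep D) * class_sum (A D) g) = (\<Sum>D\<in>conj_classes H. if D = C then z (H.crep C) else 0)"
        using disj[OF C] g by (intro sum.cong refl) (auto simp: class_sum_def)
      also have "\<dots> = z (H.crep C)" using C H.finite_conj_classes by simp
      finally show ?thesis by (simp only: dec)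
    qed
    have "(\<Sum>C\<in>conj_classes H. z (H.crep C) * class_sum (A C) e) \<noteq> 0" using dec[of e] e by (simp add: class_sum_def)
    then obtain C where C: "C \<in> conj_classes H" "z (H.crep C) * class_sum (A C) e \<noteq> 0" by (meson sum.neutral)
    then have eA: "e \<in> A C" by (auto simp: class_sum_def split: if_splits)
    have z0: "z (H.crep C) = 1" using val[OF C(1) eA] e by (simp add: class_sum_def)
    have "A C \<subseteq> E"
    proof
      fix x assume "x \<in> A C"
      then have "class_sum E x = (1 :: 'k)" using val[OF C(1)] z0 by simp
      then show "x \<in> E" by (simp add: class_sum_def split: if_splits)
    qed
    moreover have "E \<subseteq> A C"
    proof
      fix x assume x: "x \<in> E"
      then have "\<phi> (class_sum C) x = \<phi> (class_sum C) e"
        using G.class_fun_conj_class[OF phi_class[OF H.class_fun_class[OF C(1)]] eG] Ee by blast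
      then show "x \<in> A C" using eA G.conj_class_carrier[OF E x] by (simp add: A_def)
    qed
    ultimately show ?thesis using C(1) by blast
  qed
  have inj: "C = D" if C: "C \<in> conj_classes H" and D: "D \<in> conj_classes H" and g: "g \<in> A C" "g \<in> A D" for C D g
    using disj[OF C D] g by blast
  have ne: "A C \<noteq> {}" if C: "C \<in> conj_classes H" for C
  proof -
    have "finite C" using subH[OF C] H.fin finite_subset by blast
    then have "card C \<noteq> 0" using H.crep_in[OF C] by auto
    then show ?thesis using cardA[OF C] by auto
  qed
  have cls: "A C \<in> conj_classes G" if C: "C \<in> conj_classes H" for C
  proof -
    obtain g where g: "g \<in> A C" using ne[OF C] by blast
    then have gG: "g \<in> carrier G" by (simp add: A_def)
    obtain D where D: "D \<in> conj_classes H" "A D = conj_class G g" using hit[OF G.conj_class_in[OF gG]] by blast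
    then have "C = D" using inj[OF C D(1) g] G.conj_class_self[OF gG] by blast
    then show ?thesis using D G.conj_class_in[OF gG] by simp
  qed
  have "bij_betw A (conj_classes H) (conj_classes G)" unfolding bij_betw_def
  proof
    show "inj_on A (conj_classes H)"
    proof (rule inj_onI)
      fix C D assume CD: "C \<in> conj_classes H" "D \<in> conj_classes H" "A C = A D"
      obtain g where "g \<in> A C" using ne[OF CD(1)] by blast
      then show "C = D" using inj[OF CD(1,2)] CD(3) by blast
    qed
    show "A ` conj_classes H = conj_classes G" using hit cls by blast
  qed
  then show thesis using that pA cardA by blast
qed

end

section \<open>Degrees and linear characters\<close>

context fin_group begin

text \<open>The quotient \<open>|G| / d\<close> is rational, and by orthogonality it is a sum of products of integral
  elements: values of the central character times values of \<open>\<chi>\<close>.\<close>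

lemma degree_dvd_order:
  fixes \<chi> :: "'g \<Rightarrow> 'k::{alg_closed_field, field_char_0}"
  assumes x: "\<chi> \<in> Irr G" and d: "\<chi> \<one> = of_nat d" shows "d dvd card (carrier G)"
proof -
  obtain d' where d': "\<chi> \<one> = of_nat d'" "d' > 0" by (rule IrrE[OF x])
  have d0: "d > 0" using d d' by (metis of_nat_eq_iff)
  note ZZ = is_subring_integral_closure[OF is_subring_Ints, where ?'a = 'k]
  have cf: "class_fun G (\<lambda>g. if g \<in> carrier G then \<chi> (inv g) else 0)"
    using eidem_class_fun[OF Irr_class_fun[OF x]] d d0 card_pos
    unfolding eidem_def class_fun_def by (auto split: if_splits)
  have "of_nat (card (carrier G)) / of_nat d = (\<Sum>g\<in>carrier G. \<chi> g * \<chi> (inv g)) / of_nat d"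
    unfolding Irr_orthogonal[OF x x] by simp
  also have "\<dots> = (\<Sum>C\<in>conj_classes G. omega G \<chi> (class_sum C) * \<chi> (inv (crep C)))"
  proof -
    have "(\<Sum>g\<in>C. \<chi> g * \<chi> (inv g)) / of_nat d = omega G \<chi> (class_sum C) * \<chi> (inv (crep C))" if C: "C \<in> conj_classes G" for C
    proof -
      note c = crep_in[OF C] note cG = conj_class_carrier[OF C c] note e = conj_class_eqI[OF C c]
      have "\<chi> g * \<chi> (inv g) = \<chi> (crep C) * \<chi> (inv (crep C))" if g: "g \<in> C" for g
      proof -
        have "g \<in> conj_class G (crep C)" using g e by simp
        then show ?thesis
          using class_fun_conj_class[OF Irr_class_fun[OF x] cG] class_fun_conj_class[OF cf cG] conj_class_carrier[OF C g] cG by fastforce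
      qed
      then have "(\<Sum>g\<in>C. \<chi> g * \<chi> (inv g)) = of_nat (card C) * (\<chi> (crep C) * \<chi> (inv (crep C)))" by simp
      moreover have "omega G \<chi> (class_sum C) = of_nat (card C) * \<chi> (crep C) / of_nat d"
        using omega_class_sum[OF Irr_class_fun[OF x] cG] unfolding e[symmetric] d .
      ultimately show ?thesis by simp
    qed
    then show ?thesis unfolding sum_over_classes sum_divide_distrib by (intro sum.cong refl)
  qed
  also have "\<dots> \<in> {x. integral_over \<int> x}"
    by (intro is_subring_sum[OF ZZ] is_subringD(4)[OF ZZ])
      (use omega_class_integral[OF x] char_integral[OF x] conj_class_carrier crep_in in auto)
  finally have "of_nat (card (carrier G)) / of_nat d \<in> (\<int> :: 'k set)"
    using rational_integral_is_integer[of "of_nat (card (carrier G)) / of_nat d :: 'k"] by auto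
  then obtain m where "of_nat (card (carrier G)) / of_nat d = (of_int m :: 'k)" by (auto elim: Ints_cases)
  then have "(of_nat (card (carrier G)) :: 'k) = of_int m * of_nat d" using d0 by (simp add: field_simps)
  then have "(of_int (int (card (carrier G))) :: 'k) = of_int (m * int d)" by simp
  then have "int (card (carrier G)) = m * int d" by (simp only: of_int_eq_iff)
  then have "int d dvd int (card (carrier G))" by simp
  then show ?thesis by (simp only: int_dvd_int_iff)
qed

definition principal_char :: "'g \<Rightarrow> 'k::field" where "principal_char = (\<lambda>g. if g \<in> carrier G then 1 else 0)"

lemma principal_char_Irr: "(principal_char :: 'g \<Rightarrow> 'k::field) \<in> Irr G"
proof -
  define \<rho> :: "'g \<Rightarrow> 'k mat" where "\<rho> = (\<lambda>_. 1\<^sub>m 1)"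
  have m: "mat_rep G 1 \<rho>" by (simp add: mat_rep_def \<rho>_def)
  have "W = {0\<^sub>v 1} \<or> W = carrier_vec 1" if W: "lin_subspace 1 W" for W :: "'k vec set"
  proof (cases "W \<subseteq> {0\<^sub>v 1}")
    case True
    then show ?thesis using W by (auto simp: lin_subspace_def)
  next
    case False
    then obtain w where w: "w \<in> W" "w \<noteq> 0\<^sub>v 1" by blast
    then have wc: "w \<in> carrier_vec 1" using W by (auto simp: lin_subspace_def)
    have w0: "vec_index w 0 \<noteq> 0"
    proof
      assume "vec_index w 0 = 0"
      then have "w = 0\<^sub>v 1" using wc by (intro eq_vecI) auto
      then show False using w by simp
    qed
    have "v \<in> W" if v: "v \<in> carrier_vec 1" for v
    proof -
      have "v = (vec_index v 0 / vec_index w 0) \<cdot>\<^sub>v w" using v wc w0 by (intro eq_vecI) auto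
      moreover have "(vec_index v 0 / vec_index w 0) \<cdot>\<^sub>v w \<in> W" using W w(1) by (simp add: lin_subspace_def)
      ultimately show ?thesis by simp
    qed
    then show ?thesis using W by (auto simp: lin_subspace_def)
  qed
  then have "irr_rep G 1 \<rho>" using m by (simp add: irr_rep_def)
  moreover have "principal_char = rep_char G 1 \<rho>" by (rule ext) (simp add: principal_char_def rep_char_def \<rho>_def)
  ultimately show ?thesis unfolding Irr_def by blast
qed

lemma omega_principal_char: "omega G principal_char z = (\<Sum>g\<in>carrier G. z g)"
  by (simp add: omega_def principal_char_def)

lemma linear_char_mult:
  assumes x: "\<chi> \<in> Irr G" and d: "\<chi> \<one> = (1 :: 'k::field_char_0)" and g: "g \<in> carrier G" and h: "h \<in> carrier G"
  shows "\<chi> (g \<otimes> h) = \<chi> g * \<chi> h"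
proof -
  obtain n \<rho> where r: "irr_rep G n \<rho>" and c: "\<chi> = rep_char G n \<rho>" and n: "\<chi> \<one> = of_nat n" by (rule IrrE[OF x])
  have "(of_nat n :: 'k) = of_nat 1" using n d by simp
  then have n1: "n = 1" by (simp only: of_nat_eq_iff)
  have "\<rho> (g \<otimes> h) $$ (0,0) = (\<Sum>l<n. \<rho> g $$ (0,l) * \<rho> h $$ (l,0))"
    by (rule mat_rep_entry[OF irr_repD(1)[OF r] g h]) (use n1 in auto)
  then show ?thesis using g h by (simp add: c rep_char_def n1)
qed

lemma linear_char_inv:
  assumes x: "\<chi> \<in> Irr G" and d: "\<chi> \<one> = (1 :: 'k::field_char_0)" and g: "g \<in> carrier G"
  shows "\<chi> g * \<chi> (inv g) = 1"
  using linear_char_mult[OF x d g inv_closed[OF g]] g d by simp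

lemma linear_char_pow:
  assumes x: "\<chi> \<in> Irr G" and d: "\<chi> \<one> = (1 :: 'k::field_char_0)" and g: "g \<in> carrier G"
  shows "\<chi> (g [^] (s::nat)) = \<chi> g ^ s"
  by (induction s) (use linear_char_mult[OF x d _ g] g d in auto)

end

section \<open>Twisting an isomorphism to preserve augmentations\<close>

lemma (in center_iso_ac) phi_values_in_subring:
  assumes R: "is_subring R"
    and entries: "\<And>h g. h \<in> carrier H \<Longrightarrow> g \<in> carrier G \<Longrightarrow> \<phi> (class_sum (conj_class H h)) g \<in> R"
    and z: "class_fun H z" "\<And>h. h \<in> carrier H \<Longrightarrow> z h \<in> R" and g: "g \<in> carrier G"
  shows "\<phi> z g \<in> R"
proof -
  have "\<phi> z = \<phi> (\<lambda>h. \<Sum>C\<in>conj_classes H. z (H.crep C) * class_sum C h)" using H.class_fun_decomp[OF z(1)] by simp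
  also have "\<dots> = (\<lambda>g. \<Sum>C\<in>conj_classes H. z (H.crep C) * \<phi> (class_sum C) g)"
    by (rule phi_sum[OF H.finite_conj_classes H.class_fun_class])
  finally have "\<phi> z g = (\<Sum>C\<in>conj_classes H. z (H.crep C) * \<phi> (class_sum C) g)" by simp
  also have "\<dots> \<in> R"
    using entries z(2) g H.crep_in H.conj_class_carrier
    by (intro is_subring_sum[OF R] is_subringD(4)[OF R]) (auto elim!: H.conj_classesE)
  finally show ?thesis .
qed

text \<open>With \<open>c = |G| / d\<close>, the multiple of the idempotent of \<open>\<chi>\<close> by \<open>c\<close> has the integral
  coefficients \<open>\<chi>(g\<^sup>-\<^sup>1)\<close>, so its image has coefficients in \<open>R\<close>; that image is \<open>c\<close> times the
  idempotent of the principal character, with coefficient \<open>c / |H|\<close>.\<close>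

lemma (in center_iso_ac) trivial_degree_in_subring:
  fixes \<phi>' :: "('g \<Rightarrow> 'k) \<Rightarrow> ('h \<Rightarrow> 'k)"
  assumes iso': "center_iso_ac H G \<phi>'" and inv: "\<And>z. class_fun H z \<Longrightarrow> \<phi>' (\<phi> z) = z"
    and R: "is_subring R" and ZR: "\<And>x. integral_over \<int> x \<Longrightarrow> x \<in> R"
    and entries': "\<And>g h. g \<in> carrier G \<Longrightarrow> h \<in> carrier H \<Longrightarrow> \<phi>' (class_sum (conj_class G g)) h \<in> R"
  obtains \<chi> d where "\<chi> \<in> Irr G" "\<chi> \<one>\<^bsub>G\<^esub> = of_nat d" "d > 0" "\<And>z. class_fun H z \<Longrightarrow> omega G \<chi> (\<phi> z) = (\<Sum>h\<in>carrier H. z h)"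
    "of_nat (card (carrier G)) / (of_nat d * of_nat (card (carrier H))) \<in> R"
proof -
  interpret I: center_iso_ac H G \<phi>' by (rule iso')
  obtain f where f: "bij_betw f (Irr H) (Irr G)" "\<And>\<eta>. \<eta> \<in> Irr H \<Longrightarrow> \<phi> (eidem H \<eta>) = eidem G (f \<eta>)"
    "\<And>\<eta> z. \<eta> \<in> Irr H \<Longrightarrow> class_fun H z \<Longrightarrow> omega G (f \<eta>) (\<phi> z) = omega H \<eta> z"
    by (rule char_bijection) blast
  define \<chi> where "\<chi> = f H.principal_char"
  have x: "\<chi> \<in> Irr G" using f(1) H.principal_char_Irr by (auto simp: \<chi>_def bij_betw_def)
  obtain d where d: "\<chi> \<one>\<^bsub>G\<^esub> = of_nat d" "d > 0" by (rule G.IrrE[OF x])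
  have aug: "omega G \<chi> (\<phi> z) = (\<Sum>h\<in>carrier H. z h)" if "class_fun H z" for z
    using f(3)[OF H.principal_char_Irr that] by (simp add: \<chi>_def H.omega_principal_char)
  define c :: 'k where "c = of_nat (card (carrier G)) / of_nat d"
  have ex: "class_fun G (eidem G \<chi>)" by (rule G.eidem_class_fun[OF G.Irr_class_fun[OF x]])
  have eh: "class_fun H (eidem H H.principal_char :: 'h \<Rightarrow> 'k)" by (rule H.eidem_class_fun[OF H.Irr_class_fun[OF H.principal_char_Irr]])
  have "\<phi>' (\<lambda>g. c * eidem G \<chi> g) \<one>\<^bsub>H\<^esub> \<in> R"
  proof (rule I.phi_values_in_subring[OF R entries' G.class_fun_smult[OF ex]])
    fix g assume g: "g \<in> carrier G"
    then have "c * eidem G \<chi> g = \<chi> (inv\<^bsub>G\<^esub> g)" using d G.card_pos by (simp add: c_def eidem_def)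
    then show "c * eidem G \<chi> g \<in> R" using ZR G.char_integral[OF x] g by simp
  qed auto
  also have "\<phi>' (\<lambda>g. c * eidem G \<chi> g) = (\<lambda>h. c * \<phi>' (eidem G \<chi>) h)" by (rule I.phi_smult[OF ex])
  also have "\<phi>' (eidem G \<chi>) = eidem H H.principal_char"
    using inv[OF eh] f(2)[OF H.principal_char_Irr] by (simp add: \<chi>_def)
  also have "c * eidem H H.principal_char \<one>\<^bsub>H\<^esub> = of_nat (card (carrier G)) / (of_nat d * of_nat (card (carrier H)))"
    by (simp add: c_def eidem_def H.principal_char_def)
  finally show thesis by (intro that[OF x d aug])
qed

text \<open>An isomorphism and its inverse, both with entries in \<open>R\<close>: the two directions together bound
  the degree of the character that corresponds to the principal one.\<close>

locale center_iso_pair = center_iso_ac G H \<phi>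
  for G :: "('g, 'm) monoid_scheme" and H :: "('h, 'n) monoid_scheme"
    and \<phi> :: "('h \<Rightarrow> 'k::{alg_closed_field, field_char_0}) \<Rightarrow> ('g \<Rightarrow> 'k)" +
  fixes \<phi>' :: "('g \<Rightarrow> 'k) \<Rightarrow> ('h \<Rightarrow> 'k)" and R :: "'k set"
  assumes iso': "center_iso_ac H G \<phi>'"
    and inv1: "class_fun H z \<Longrightarrow> \<phi>' (\<phi> z) = z" and inv2: "class_fun G w \<Longrightarrow> \<phi> (\<phi>' w) = w"
    and R: "is_subring R" and ZR: "integral_over \<int> x \<Longrightarrow> x \<in> R"
    and no_inverse: "Factorial_Ring.prime p \<Longrightarrow> p dvd card (carrier G) \<Longrightarrow> inverse (of_nat p) \<notin> R"
    and entries: "h \<in> carrier H \<Longrightarrow> g \<in> carrier G \<Longrightarrow> \<phi> (class_sum (conj_class H h)) g \<in> R"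
    and entries': "g \<in> carrier G \<Longrightarrow> h \<in> carrier H \<Longrightarrow> \<phi>' (class_sum (conj_class G g)) h \<in> R"
begin

text \<open>Applying the degree condition to both directions and multiplying cancels the group orders
  and leaves \<open>1 / (d e)\<close> in \<open>R\<close>, with \<open>e\<close> the degree for the other direction. A prime divisor of \<open>d\<close> would divide the group order and be
  invertible.\<close>

lemma augmentation_linear_char:
  obtains \<chi> where "\<chi> \<in> Irr G" "\<chi> \<one>\<^bsub>G\<^esub> = 1" "\<And>z. class_fun H z \<Longrightarrow> omega G \<chi> (\<phi> z) = (\<Sum>h\<in>carrier H. z h)"
proof -
  interpret I: center_iso_ac H G \<phi>' by (rule iso')
  obtain \<chi> d where x: "\<chi> \<in> Irr G" "\<chi> \<one>\<^bsub>G\<^esub> = of_nat d" "d > 0" "\<And>z. class_fun H z \<Longrightarrow> omega G \<chi> (\<phi> z) = (\<Sum>h\<in>carrier H. z h)"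
    "of_nat (card (carrier G)) / (of_nat d * of_nat (card (carrier H))) \<in> R"
    by (rule trivial_degree_in_subring[OF iso' inv1 R ZR entries']) (assumption | rule that)+
  obtain e where y: "e > 0" "of_nat (card (carrier H)) / (of_nat e * of_nat (card (carrier G))) \<in> R"
    by (rule I.trivial_degree_in_subring[OF center_iso_ac_axioms inv2 R ZR entries]) (assumption | rule that)+
  have "of_nat (card (carrier G)) / (of_nat d * of_nat (card (carrier H))) * (of_nat (card (carrier H)) / (of_nat e * of_nat (card (carrier G)))) \<in> R"
    by (rule is_subringD(4)[OF R x(5) y(2)])
  also have "of_nat (card (carrier G)) / (of_nat d * of_nat (card (carrier H))) * (of_nat (card (carrier H)) / (of_nat e * of_nat (card (carrier G))))
     = (1 / (of_nat d * of_nat e) :: 'k)" using G.card_pos H.card_pos by simp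
  finally have de: "1 / (of_nat d * of_nat e) \<in> R" .
  have "d = 1"
  proof (rule ccontr)
    assume "d \<noteq> 1"
    then obtain p where p: "Factorial_Ring.prime p" "p dvd d" using prime_factor_nat by blast
    obtain m where m: "d = p * m" using p(2) by blast
    have p0: "p > 0" using p(1) prime_gt_0_nat by blast
    have "m > 0" using m x(3) by (cases m) auto
    then have "inverse (of_nat p :: 'k) = of_nat (m * e) * (1 / (of_nat d * of_nat e))"
      using y(1) p0 by (simp add: m field_simps)
    also have "\<dots> \<in> R" by (intro is_subringD(4)[OF R de] is_subring_of_nat[OF R] is_subringD(4)[OF R _ de])
    finally have "inverse (of_nat p) \<in> R" .
    moreover have "p dvd card (carrier G)" using G.degree_dvd_order[OF x(1,2)] p(2) dvd_trans by blast
    ultimately show False using no_inverse[OF p(1)] by blast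
  qed
  then show thesis using that[OF x(1) _ x(4)] x(2) by simp
qed

text \<open>Multiplication by the values of a linear character is an automorphism of the center, and it
  turns the central character of \<open>\<chi>\<close> into the augmentation.\<close>

theorem classes_to_class_multiples:
  assumes nil: "nilpotent_group H"
  obtains \<chi> \<pi> where "\<chi> \<in> Irr G" "\<chi> \<one>\<^bsub>G\<^esub> = 1" "bij_betw \<pi> (conj_classes H) (conj_classes G)"
    "\<And>C g. C \<in> conj_classes H \<Longrightarrow> g \<in> carrier G \<Longrightarrow> \<phi> (class_sum C) g = \<chi> (inv\<^bsub>G\<^esub> g) * class_sum (\<pi> C) g"
    "\<And>C. C \<in> conj_classes H \<Longrightarrow> card (\<pi> C) = card C"
proof -
  obtain \<chi> where x: "\<chi> \<in> Irr G" "\<chi> \<one>\<^bsub>G\<^esub> = 1" and aug: "\<And>z. class_fun H z \<Longrightarrow> omega G \<chi> (\<phi> z) = (\<Sum>h\<in>carrier H. z h)"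
    by (rule augmentation_linear_char) blast
  note mult = G.linear_char_mult[OF x] and xinv = G.linear_char_inv[OF x]
  have xc: "class_fun G \<chi>" by (rule G.Irr_class_fun[OF x(1)])
  (* The twisted isomorphism. *)
  define T where "T z = (\<lambda>g. \<chi> g * \<phi> z g)" for z
  have convT: "conv G (\<lambda>g. \<chi> g * a g) (\<lambda>g. \<chi> g * b g) = (\<lambda>g. \<chi> g * conv G a b g)" for a b
  proof (rule ext)
    fix g
    show "conv G (\<lambda>g. \<chi> g * a g) (\<lambda>g. \<chi> g * b g) g = \<chi> g * conv G a b g"
    proof (cases "g \<in> carrier G")
      case True
      have "\<chi> y * \<chi> (inv\<^bsub>G\<^esub> y \<otimes>\<^bsub>G\<^esub> g) = \<chi> g" if y: "y \<in> carrier G" for y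
        using mult[OF y, of "inv\<^bsub>G\<^esub> y \<otimes>\<^bsub>G\<^esub> g"] y True by (simp add: G.inv_cancel)
      note key = this
      have *: "(\<chi> y * a y) * (\<chi> (inv\<^bsub>G\<^esub> y \<otimes>\<^bsub>G\<^esub> g) * b (inv\<^bsub>G\<^esub> y \<otimes>\<^bsub>G\<^esub> g)) = \<chi> g * (a y * b (inv\<^bsub>G\<^esub> y \<otimes>\<^bsub>G\<^esub> g))"
        if "y \<in> carrier G" for y
      proof -
        have "(\<chi> y * a y) * (\<chi> (inv\<^bsub>G\<^esub> y \<otimes>\<^bsub>G\<^esub> g) * b (inv\<^bsub>G\<^esub> y \<otimes>\<^bsub>G\<^esub> g)) =
            (\<chi> y * \<chi> (inv\<^bsub>G\<^esub> y \<otimes>\<^bsub>G\<^esub> g)) * (a y * b (inv\<^bsub>G\<^esub> y \<otimes>\<^bsub>G\<^esub> g))" by (simp only: mult_ac)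
        then show ?thesis by (simp only: key[OF that])
      qed
      have "(\<Sum>y\<in>carrier G. (\<chi> y * a y) * (\<chi> (inv\<^bsub>G\<^esub> y \<otimes>\<^bsub>G\<^esub> g) * b (inv\<^bsub>G\<^esub> y \<otimes>\<^bsub>G\<^esub> g))) =
          (\<Sum>y\<in>carrier G. \<chi> g * (a y * b (inv\<^bsub>G\<^esub> y \<otimes>\<^bsub>G\<^esub> g)))"
        by (rule sum.cong[OF refl *])
      then show ?thesis using True unfolding conv_def by (simp only: if_True sum_distrib_left)
    qed (simp add: conv_def)
  qed
  have classT: "class_fun G (\<lambda>g. \<chi> g * a g)" if "class_fun G a" for a
    using xc that by (simp add: class_fun_def)
  interpret T: center_iso_int G H T R
  proof unfold_locales
    show "class_fun G (T a)" if "class_fun H a" for a unfolding T_def by (rule classT[OF phi_class[OF that]])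
    show "T (\<lambda>h. c * a h + b h) = (\<lambda>g. c * T a g + T b g)" if "class_fun H a" "class_fun H b" for a b c
      unfolding T_def phi_lin[OF that] by (simp add: algebra_simps)
    show "T (conv H a b) = conv G (T a) (T b)" if "class_fun H a" "class_fun H b" for a b
      unfolding T_def convT phi_conv[OF that] ..
    show "T (delta1 H) = delta1 G"
      unfolding T_def phi_one by (rule ext) (simp add: delta1_def x(2))
    show "a = b" if ab: "class_fun H a" "class_fun H b" "T a = T b" for a b
    proof (rule phi_inj[OF ab(1,2)], rule ext)
      fix g
      show "\<phi> a g = \<phi> b g"
      proof (cases "g \<in> carrier G")
        case True
        then have "\<chi> g \<noteq> 0" using xinv[OF True] by auto
        moreover have "\<chi> g * \<phi> a g = \<chi> g * \<phi> b g" using ab(3) unfolding T_def by metis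
        ultimately show ?thesis by simp
      next
        case False
        then show ?thesis using phi_class[OF ab(1)] phi_class[OF ab(2)] by (simp add: class_fun_def)
      qed
    qed
    show "\<exists>z. class_fun H z \<and> T z = w" if w: "class_fun G w" for w
    proof -
      have "class_fun G (\<lambda>g. (if g \<in> carrier G then \<chi> (inv\<^bsub>G\<^esub> g) else 0))"
        using G.eidem_class_fun[OF xc] G.card_pos unfolding eidem_def class_fun_def x(2) by (auto split: if_splits)
      then have "class_fun G (\<lambda>g. (if g \<in> carrier G then \<chi> (inv\<^bsub>G\<^esub> g) else 0) * w g)" using w by (simp add: class_fun_def)
      then obtain z where z: "class_fun H z" "\<phi> z = (\<lambda>g. (if g \<in> carrier G then \<chi> (inv\<^bsub>G\<^esub> g) else 0) * w g)" using phi_surj by blast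
      have "T z = w"
      proof (rule ext)
        fix g
        show "T z g = w g"
        proof (cases "g \<in> carrier G")
          case True
          then show ?thesis using xinv[OF True] by (simp add: T_def z(2) mult.assoc[symmetric])
        next
          case False
          then show ?thesis using w by (simp add: T_def z(2) class_fun_def)
        qed
      qed
      then show ?thesis using z(1) by blast
    qed
    show "is_subring R" by (rule R)
    show "inverse (of_nat p) \<notin> R" if "Factorial_Ring.prime p" "p dvd card (carrier G)" for p by (rule no_inverse[OF that])
    show "T (class_sum (conj_class H h)) g \<in> R" if "h \<in> carrier H" "g \<in> carrier G" for h g
      unfolding T_def by (rule is_subringD(4)[OF R ZR[OF G.char_integral[OF x(1) that(2)]] entries[OF that]])
    show "(\<Sum>g\<in>carrier G. T z g) = (\<Sum>h\<in>carrier H. z h)" if "class_fun H z" for z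
      using aug[OF that] by (simp add: omega_def T_def x(2) mult.commute)
  qed
  obtain \<pi> where \<pi>: "bij_betw \<pi> (conj_classes H) (conj_classes G)"
    "\<And>C. C \<in> conj_classes H \<Longrightarrow> T (class_sum C) = class_sum (\<pi> C)"
    "\<And>C. C \<in> conj_classes H \<Longrightarrow> card (\<pi> C) = card C"
    by (rule T.classes_to_classes[OF nil]) blast
  have "\<phi> (class_sum C) g = \<chi> (inv\<^bsub>G\<^esub> g) * class_sum (\<pi> C) g" if C: "C \<in> conj_classes H" and g: "g \<in> carrier G" for C g
  proof -
    have "\<chi> (inv\<^bsub>G\<^esub> g) * class_sum (\<pi> C) g = (\<chi> g * \<chi> (inv\<^bsub>G\<^esub> g)) * \<phi> (class_sum C) g"
      unfolding \<pi>(2)[OF C, symmetric] T_def by (simp only: mult_ac)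
    then show ?thesis using xinv[OF g] by simp
  qed
  then show thesis using that[OF x \<pi>(1) _ \<pi>(3)] by blast
qed

end

section \<open>The center of the group ring over a domain\<close>

context fin_group begin

text \<open>Commuting with the single group elements already forces constancy on classes.\<close>

lemma central_iff_class_fun:
  fixes z :: "'g \<Rightarrow> 's::comm_ring_1"
  assumes z: "\<And>g. g \<notin> carrier G \<Longrightarrow> z g = 0"
  shows "(\<forall>a. (\<forall>g. g \<notin> carrier G \<longrightarrow> a g = 0) \<longrightarrow> conv G z a = conv G a z) \<longleftrightarrow> class_fun G z"
proof
  assume c: "\<forall>a. (\<forall>g. g \<notin> carrier G \<longrightarrow> a g = 0) \<longrightarrow> conv G z a = conv G a z"
  have "z (x \<otimes> h \<otimes> inv x) = z h" if x: "x \<in> carrier G" and h: "h \<in> carrier G" for x h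
  proof -
    define d :: "'g \<Rightarrow> 's" where "d = (\<lambda>g. if g = x then 1 else 0)"
    have sup: "\<forall>g. g \<notin> carrier G \<longrightarrow> d g = 0" using x by (auto simp: d_def)
    have xh: "x \<otimes> h \<in> carrier G" using x h by simp
    have i1: "inv y \<otimes> (x \<otimes> h) = x \<longleftrightarrow> y = x \<otimes> h \<otimes> inv x" if y: "y \<in> carrier G" for y
    proof
      assume "inv y \<otimes> (x \<otimes> h) = x"
      then have "y \<otimes> (inv y \<otimes> (x \<otimes> h)) \<otimes> inv x = y \<otimes> x \<otimes> inv x" by simp
      then show "y = x \<otimes> h \<otimes> inv x" using x h y by (simp add: inv_cancel)
    next
      assume "y = x \<otimes> h \<otimes> inv x"
      then show "inv y \<otimes> (x \<otimes> h) = x" using x h by (simp add: inv_mult_group m_assoc inv_cancel)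
    qed
    have "conv G z d (x \<otimes> h) = (\<Sum>y\<in>carrier G. if y = x \<otimes> h \<otimes> inv x then z y else 0)"
      unfolding conv_def if_P[OF xh] by (intro sum.cong refl) (simp add: d_def i1)
    also have "\<dots> = z (x \<otimes> h \<otimes> inv x)" using x h fin by simp
    finally have 1: "conv G z d (x \<otimes> h) = z (x \<otimes> h \<otimes> inv x)" .
    have "conv G d z (x \<otimes> h) = (\<Sum>y\<in>carrier G. if y = x then z (inv y \<otimes> (x \<otimes> h)) else 0)"
      unfolding conv_def if_P[OF xh] by (intro sum.cong refl) (simp add: d_def)
    also have "\<dots> = z h" using x h fin by (simp add: inv_cancel)
    finally have 2: "conv G d z (x \<otimes> h) = z h" .
    have "conv G z d = conv G d z" using c sup by blast
    then show ?thesis using 1 2 by simp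
  qed
  then show "class_fun G z" using z by (simp add: class_fun_def)
qed (blast intro: conv_commute)

lemma group_ring_center_simps:
  "carrier (group_ring_center G) = {z :: 'g \<Rightarrow> 's::comm_ring_1. class_fun G z}"
  "monoid.mult (group_ring_center G :: ('g \<Rightarrow> 's) ring) = conv G"
  "monoid.one (group_ring_center G :: ('g \<Rightarrow> 's) ring) = delta1 G"
  "ring.add (group_ring_center G :: ('g \<Rightarrow> 's) ring) = (\<lambda>a b g. a g + b g)"
proof -
  have m: "monoid.mult (group_ring G :: ('g \<Rightarrow> 's) ring) = conv G" by (simp add: group_ring_def conv_def fun_eq_iff)
  have c: "carrier (group_ring G :: ('g \<Rightarrow> 's) ring) = {a. \<forall>g. g \<notin> carrier G \<longrightarrow> a g = 0}" by (simp add: group_ring_def)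
  have "z \<in> carrier (group_ring_center G) \<longleftrightarrow> class_fun G z" for z :: "'g \<Rightarrow> 's"
  proof -
    have "z \<in> carrier (group_ring_center G) \<longleftrightarrow> (\<forall>g. g \<notin> carrier G \<longrightarrow> z g = 0) \<and>
        (\<forall>a. (\<forall>g. g \<notin> carrier G \<longrightarrow> a g = 0) \<longrightarrow> conv G z a = conv G a z)"
      unfolding group_ring_center_def by (simp add: m c)
    also have "\<dots> \<longleftrightarrow> class_fun G z" using central_iff_class_fun[of z] by (auto simp: class_fun_def)
    finally show ?thesis .
  qed
  then show "carrier (group_ring_center G) = {z :: 'g \<Rightarrow> 's. class_fun G z}" by blast
qed (simp_all add: group_ring_center_def group_ring_def conv_def delta1_def fun_eq_iff)

lemma conv_bilinear:
  "conv G (\<lambda>g. \<Sum>i\<in>I. c i * a i g) (\<lambda>g. \<Sum>j\<in>J. d j * b j g) =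
   (\<lambda>g. \<Sum>i\<in>I. \<Sum>j\<in>J. c i * d j * conv G (a i) (b j) g)"
proof (rule ext)
  fix g
  show "conv G (\<lambda>g. \<Sum>i\<in>I. c i * a i g) (\<lambda>g. \<Sum>j\<in>J. d j * b j g) g =
      (\<Sum>i\<in>I. \<Sum>j\<in>J. c i * d j * conv G (a i) (b j) g)"
  proof (cases "g \<in> carrier G")
    case True
    have "(\<Sum>x\<in>carrier G. (\<Sum>i\<in>I. c i * a i x) * (\<Sum>j\<in>J. d j * b j (inv x \<otimes> g))) =
        (\<Sum>x\<in>carrier G. \<Sum>i\<in>I. \<Sum>j\<in>J. c i * d j * (a i x * b j (inv x \<otimes> g)))"
      unfolding sum_product by (rule sum.cong[OF refl], rule sum.cong[OF refl], rule sum.cong[OF refl]) (simp only: mult_ac)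
    also have "\<dots> = (\<Sum>i\<in>I. \<Sum>x\<in>carrier G. \<Sum>j\<in>J. c i * d j * (a i x * b j (inv x \<otimes> g)))" by (rule sum.swap)
    also have "\<dots> = (\<Sum>i\<in>I. \<Sum>j\<in>J. \<Sum>x\<in>carrier G. c i * d j * (a i x * b j (inv x \<otimes> g)))"
      by (rule sum.cong[OF refl]) (rule sum.swap)
    finally show ?thesis unfolding conv_def if_P[OF True] sum_distrib_left .
  qed (simp add: conv_def)
qed

end

lemma center_iso_of_algebra_iso:
  fixes G :: "('g, 'm) monoid_scheme" and G' :: "('h, 'n) monoid_scheme"
    and \<psi> :: "('g \<Rightarrow> 's::comm_ring_1) \<Rightarrow> ('h \<Rightarrow> 's)"
  assumes G: "fin_group G" and G': "fin_group G'" and iso: "center_algebra_iso G G' \<psi>"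
  shows "center_iso G' G \<psi>"
proof -
  interpret G: fin_group G by (rule G)
  interpret G': fin_group G' by (rule G')
  have hom: "\<psi> \<in> Ring.ring_hom (group_ring_center G) (group_ring_center G')"
    and bij: "bij_betw \<psi> {z. class_fun G z} {z. class_fun G' z}"
    and smult: "\<And>s z. class_fun G z \<Longrightarrow> \<psi> (\<lambda>g. s * z g) = (\<lambda>g. s * \<psi> z g)"
    using iso unfolding center_algebra_iso_def ring_iso_def G.group_ring_center_simps G'.group_ring_center_simps by auto
  note homD = hom[unfolded Ring.ring_hom_def G.group_ring_center_simps G'.group_ring_center_simps]
  show ?thesis
  proof unfold_locales
    show "class_fun G' (\<psi> a)" if "class_fun G a" for a using homD that by (auto simp: Pi_iff)
    show "\<psi> (\<lambda>h. c * a h + b h) = (\<lambda>g. c * \<psi> a g + \<psi> b g)" if a: "class_fun G a" and b: "class_fun G b" for a b c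
    proof -
      have add: "\<psi> (\<lambda>g. u g + v g) = (\<lambda>g. \<psi> u g + \<psi> v g)" if "class_fun G u" "class_fun G v" for u v
        using homD that by simp
      show ?thesis unfolding add[OF G.class_fun_smult[OF a] b] smult[OF a] ..
    qed
    show "\<psi> (conv G a b) = conv G' (\<psi> a) (\<psi> b)" if "class_fun G a" "class_fun G b" for a b
      using homD that by simp
    show "\<psi> (delta1 G) = delta1 G'" using homD by simp
    show "a = b" if "class_fun G a" "class_fun G b" "\<psi> a = \<psi> b" for a b
      using bij that by (auto simp: bij_betw_def inj_on_def)
    show "\<exists>z. class_fun G z \<and> \<psi> z = w" if "class_fun G' w" for w
      using bij that unfolding bij_betw_def by (metis (mono_tags, lifting) imageE mem_Collect_eq)
  qed
qed

context center_iso begin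

definition phi_inv :: "('g \<Rightarrow> 'k) \<Rightarrow> ('h \<Rightarrow> 'k)" where
  "phi_inv w = (SOME z. class_fun H z \<and> \<phi> z = w)"

lemma phi_inv:
  assumes "class_fun G w" shows "class_fun H (phi_inv w)" "\<phi> (phi_inv w) = w"
  using someI_ex[OF phi_surj[OF assms]] unfolding phi_inv_def by auto

lemma phi_inv_phi: "class_fun H z \<Longrightarrow> phi_inv (\<phi> z) = z"
  using phi_inv[OF phi_class] phi_inj by metis

lemma center_iso_inverse: "center_iso H G phi_inv"
proof unfold_locales
  show "class_fun H (phi_inv a)" if "class_fun G a" for a by (rule phi_inv[OF that])
  show "phi_inv (\<lambda>h. c * a h + b h) = (\<lambda>g. c * phi_inv a g + phi_inv b g)" if a: "class_fun G a" and b: "class_fun G b" for a b c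
  proof (rule phi_inj)
    show "class_fun H (phi_inv (\<lambda>h. c * a h + b h))" by (rule phi_inv) (use a b in \<open>simp add: class_fun_def\<close>)
    show "class_fun H (\<lambda>g. c * phi_inv a g + phi_inv b g)" using phi_inv(1)[OF a] phi_inv(1)[OF b] by (simp add: class_fun_def)
    show "\<phi> (phi_inv (\<lambda>h. c * a h + b h)) = \<phi> (\<lambda>g. c * phi_inv a g + phi_inv b g)"
      unfolding phi_lin[OF phi_inv(1)[OF a] phi_inv(1)[OF b]] phi_inv(2)[OF a] phi_inv(2)[OF b]
      by (rule phi_inv) (use a b in \<open>simp add: class_fun_def\<close>)
  qed
  show "phi_inv (conv G a b) = conv H (phi_inv a) (phi_inv b)" if a: "class_fun G a" and b: "class_fun G b" for a b
  proof (rule phi_inj)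
    show "\<phi> (phi_inv (conv G a b)) = \<phi> (conv H (phi_inv a) (phi_inv b))"
      unfolding phi_conv[OF phi_inv(1)[OF a] phi_inv(1)[OF b]] phi_inv(2)[OF a] phi_inv(2)[OF b]
      by (rule phi_inv(2)[OF G.conv_class_fun[OF a b]])
  qed (intro phi_inv G.conv_class_fun H.conv_class_fun a b)+
  show "phi_inv (delta1 G) = delta1 H" using phi_inv_phi[OF H.class_fun_delta1] by (simp add: phi_one)
  show "a = b" if "class_fun G a" "class_fun G b" "phi_inv a = phi_inv b" for a b
    using phi_inv(2) that by metis
  show "\<exists>z. class_fun G z \<and> phi_inv z = w" if "class_fun H w" for w
    using phi_inv_phi[OF that] phi_class[OF that] by blast
qed

end

section \<open>Base change to a field\<close>

text \<open>Both the fraction field into an algebraic closure and the two embeddings of the statement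
  are handled by this locale.\<close>

locale ring_embedding =
  fixes j :: "'s::idom \<Rightarrow> 'k::field"
  assumes add: "j (x + y) = j x + j y" and mult: "j (x * y) = j x * j y" and one: "j 1 = 1"
    and inj: "j x = 0 \<Longrightarrow> x = 0"
begin

lemma zero: "j 0 = 0" using add[of 0 0] by (metis add.right_neutral add_left_cancel)

lemma eqD: "j x = j y \<Longrightarrow> x = y"
proof -
  assume e: "j x = j y"
  have "j x = j y + j (x - y)" using add[of y "x - y"] by simp
  then show "x = y" using e inj[of "x - y"] by simp
qed

lemma sum: "j (sum f A) = (\<Sum>x\<in>A. j (f x))"
  by (induction A rule: infinite_finite_induct) (simp_all add: zero add)

lemma of_nat: "j (of_nat n) = of_nat n"
  by (induction n) (simp_all add: zero one add)

lemma power: "j (x ^ n) = j x ^ n"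
  by (induction n) (simp_all add: one mult)

lemma class_sum: "(\<lambda>g. j (class_sum C g)) = class_sum C"
  by (rule ext) (simp add: class_sum_def zero one)

lemma delta1: "(\<lambda>g. j (delta1 G g)) = delta1 G"
  by (rule ext) (simp add: delta1_def zero one)

lemma conv: "conv G (\<lambda>g. j (a g)) (\<lambda>g. j (b g)) = (\<lambda>g. j (conv G a b g))"
  by (rule ext) (simp add: conv_def zero sum mult)

lemma class_fun: "class_fun G a \<Longrightarrow> class_fun G (\<lambda>g. j (a g))"
  by (simp add: class_fun_def zero)

lemma is_subring_range: "is_subring (range j)"
  unfolding is_subring_def
proof (intro conjI ballI)
  show "0 \<in> range j" "1 \<in> range j" using zero one by (metis rangeI)+
  fix x assume "x \<in> range j"
  then obtain u where u: "x = j u" by blast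
  have "- x = j (- u)" using add[of u "- u"] zero u by (simp add: add_eq_0_iff)
  then show "- x \<in> range j" by simp
  fix y assume "y \<in> range j"
  then obtain v where v: "y = j v" by blast
  show "x + y \<in> range j" "x * y \<in> range j" unfolding u v add[symmetric] mult[symmetric] by simp_all
qed

end

text \<open>The linear extension in the basis of class sums. The representative of a class is chosen by
  \<open>SOME\<close> so that \<open>center_extension\<close> is an instance.\<close>

definition center_ext :: "('h, 'n) monoid_scheme \<Rightarrow> ('s::comm_ring_1 \<Rightarrow> 'k::field) \<Rightarrow> (('h \<Rightarrow> 's) \<Rightarrow> ('g \<Rightarrow> 's)) \<Rightarrow> ('h \<Rightarrow> 'k) \<Rightarrow> ('g \<Rightarrow> 'k)" where
  "center_ext H j \<phi> z = (\<lambda>g. \<Sum>C\<in>conj_classes H. z (SOME x. x \<in> C) * j (\<phi> (class_sum C) g))"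

locale center_base_change = center_iso G H \<phi> + j: ring_embedding j
  for G :: "('g, 'm) monoid_scheme" and H :: "('h, 'n) monoid_scheme"
    and \<phi> :: "('h \<Rightarrow> 's::idom) \<Rightarrow> ('g \<Rightarrow> 's)" and j :: "'s \<Rightarrow> 'k::field"
begin

abbreviation "\<Phi> \<equiv> center_ext H j \<phi>"

lemma ext_sum: "\<Phi> (\<lambda>h. \<Sum>i\<in>I. c i * a i h) = (\<lambda>g. \<Sum>i\<in>I. c i * \<Phi> (a i) g)"
  unfolding center_ext_def sum_distrib_left sum_distrib_right
  by (rule ext) (subst sum.swap, simp only: mult_ac)

lemma ext_base: assumes a: "class_fun H a" shows "\<Phi> (\<lambda>h. j (a h)) = (\<lambda>g. j (\<phi> a g))"
proof -
  have "\<phi> a = \<phi> (\<lambda>h. \<Sum>C\<in>conj_classes H. a (H.crep C) * class_sum C h)" using H.class_fun_decomp[OF a] by simp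
  also have "\<dots> = (\<lambda>g. \<Sum>C\<in>conj_classes H. a (H.crep C) * \<phi> (class_sum C) g)"
    by (rule phi_sum[OF H.finite_conj_classes H.class_fun_class])
  finally show ?thesis by (simp add: center_ext_def j.sum j.mult H.crep_def)
qed

lemma ext_class_sum: "C \<in> conj_classes H \<Longrightarrow> \<Phi> (class_sum C) = (\<lambda>g. j (\<phi> (class_sum C) g))"
  using ext_base[OF H.class_fun_class] unfolding j.class_sum .

lemma ext_expand: "\<Phi> z = (\<lambda>g. \<Sum>C\<in>conj_classes H. z (H.crep C) * j (\<phi> (class_sum C) g))"
  by (simp add: center_ext_def H.crep_def)

text \<open>Inverse isomorphisms extend to inverse isomorphisms, which gives bijectivity of extensions.\<close>

lemma ext_inverse:
  assumes iso': "center_base_change H G \<phi>' j" and inv: "\<And>z. class_fun H z \<Longrightarrow> \<phi>' (\<phi> z) = z" and z: "class_fun H z"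
  shows "center_ext G j \<phi>' (\<Phi> z) = z"
proof -
  interpret I: center_base_change H G \<phi>' j by (rule iso')
  have "I.\<Phi> (\<Phi> z) = (\<lambda>h. \<Sum>C\<in>conj_classes H. z (H.crep C) * I.\<Phi> (\<lambda>g. j (\<phi> (class_sum C) g)) h)"
    unfolding ext_expand by (rule I.ext_sum)
  also have "\<dots> = (\<lambda>h. \<Sum>C\<in>conj_classes H. z (H.crep C) * class_sum C h)"
  proof (rule ext, rule sum.cong[OF refl])
    fix h C assume C: "C \<in> conj_classes H"
    have "I.\<Phi> (\<lambda>g. j (\<phi> (class_sum C) g)) = (\<lambda>h. j (\<phi>' (\<phi> (class_sum C)) h))"
      by (rule I.ext_base[OF phi_class[OF H.class_fun_class[OF C]]])
    then show "z (H.crep C) * I.\<Phi> (\<lambda>g. j (\<phi> (class_sum C) g)) h = z (H.crep C) * class_sum C h"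
      unfolding inv[OF H.class_fun_class[OF C]] j.class_sum by simp
  qed
  also have "\<dots> = z" by (rule H.class_fun_decomp[OF z, symmetric])
  finally show ?thesis .
qed

lemma ext_class_fun: "class_fun G (\<Phi> z)"
  unfolding ext_expand by (intro G.class_fun_sum G.class_fun_smult j.class_fun phi_class H.class_fun_class)

lemma ext_center_iso: "center_iso G H \<Phi>"
proof -
  interpret I: center_iso H G phi_inv by (rule center_iso_inverse)
  interpret I: center_base_change H G phi_inv j ..
  have 1: "I.\<Phi> (\<Phi> z) = z" if "class_fun H z" for z
    by (rule ext_inverse[OF I.center_base_change_axioms phi_inv_phi that])
  have 2: "\<Phi> (I.\<Phi> w) = w" if "class_fun G w" for w
    by (rule I.ext_inverse[OF center_base_change_axioms phi_inv(2) that])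
  show ?thesis
  proof unfold_locales
    show "class_fun G (\<Phi> a)" for a by (rule ext_class_fun)
    show "\<Phi> (\<lambda>h. c * a h + b h) = (\<lambda>g. c * \<Phi> a g + \<Phi> b g)" for a b c
      by (simp add: center_ext_def algebra_simps sum.distrib sum_distrib_left)
    show "\<Phi> (conv H a b) = conv G (\<Phi> a) (\<Phi> b)" if a: "class_fun H a" and b: "class_fun H b" for a b
    proof -
      let ?K = "conj_classes H"
      have cc: "\<Phi> (conv H (class_sum C) (class_sum D)) = conv G (\<lambda>g. j (\<phi> (class_sum C) g)) (\<lambda>g. j (\<phi> (class_sum D) g))"
        if C: "C \<in> ?K" and D: "D \<in> ?K" for C D
      proof -
        note c = H.class_fun_class[OF C] and d = H.class_fun_class[OF D]
        have "conv H (class_sum C) (class_sum D) = (\<lambda>h. j (conv H (class_sum C) (class_sum D) h))"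
          unfolding j.conv[symmetric] j.class_sum ..
        then have "\<Phi> (conv H (class_sum C) (class_sum D)) = (\<lambda>g. j (\<phi> (conv H (class_sum C) (class_sum D)) g))"
          using ext_base[OF H.conv_class_fun[OF c d]] by (simp only:)
        then show ?thesis unfolding phi_conv[OF c d] j.conv .
      qed
      have "conv H a b = conv H (\<lambda>h. \<Sum>C\<in>?K. a (H.crep C) * class_sum C h) (\<lambda>h. \<Sum>D\<in>?K. b (H.crep D) * class_sum D h)"
        using H.class_fun_decomp[OF a] H.class_fun_decomp[OF b] by simp
      also have "\<dots> = (\<lambda>h. \<Sum>C\<in>?K. \<Sum>D\<in>?K. a (H.crep C) * b (H.crep D) * conv H (class_sum C) (class_sum D) h)"
        by (rule H.conv_bilinear)
      also have "\<dots> = (\<lambda>h. \<Sum>P\<in>?K\<times>?K. a (H.crep (fst P)) * b (H.crep (snd P)) * conv H (class_sum (fst P)) (class_sum (snd P)) h)"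
        unfolding sum.cartesian_product by (simp add: case_prod_beta)
      finally have "\<Phi> (conv H a b) = (\<lambda>g. \<Sum>P\<in>?K\<times>?K. a (H.crep (fst P)) * b (H.crep (snd P)) * \<Phi> (conv H (class_sum (fst P)) (class_sum (snd P))) g)"
        by (simp only: ext_sum)
      also have "\<dots> = (\<lambda>g. \<Sum>P\<in>?K\<times>?K. a (H.crep (fst P)) * b (H.crep (snd P)) *
          conv G (\<lambda>g. j (\<phi> (class_sum (fst P)) g)) (\<lambda>g. j (\<phi> (class_sum (snd P)) g)) g)"
        by (rule ext, rule sum.cong[OF refl]) (use cc in auto)
      also have "\<dots> = (\<lambda>g. \<Sum>C\<in>?K. \<Sum>D\<in>?K. a (H.crep C) * b (H.crep D) *
          conv G (\<lambda>g. j (\<phi> (class_sum C) g)) (\<lambda>g. j (\<phi> (class_sum D) g)) g)"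
        unfolding sum.cartesian_product by (simp add: case_prod_beta)
      also have "\<dots> = conv G (\<Phi> a) (\<Phi> b)" unfolding ext_expand by (rule G.conv_bilinear[symmetric])
      finally show ?thesis .
    qed
    show "\<Phi> (delta1 H) = delta1 G"
      using ext_base[OF H.class_fun_delta1] unfolding j.delta1 phi_one .
    show "a = b" if "class_fun H a" "class_fun H b" "\<Phi> a = \<Phi> b" for a b using 1 that by metis
    show "\<exists>z. class_fun H z \<and> \<Phi> z = w" if "class_fun G w" for w using 2[OF that] I.ext_class_fun by blast
  qed
qed

end

section \<open>Class sums over an adapted ring\<close>

instance fract :: ("{idom, ring_char_0}") field_char_0
proof
  show "inj (of_nat :: nat \<Rightarrow> 'a fract)"
    by (rule injI) (simp add: of_nat_fract eq_fract)
qed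

lemma ring_embedding_closure: "ring_embedding (\<lambda>s :: 's::idom. to_ac (Fract s 1))"
proof
  show "x = 0" if "to_ac (Fract x 1) = 0" for x :: 's using that by (simp add: Zero_fract_def eq_fract)
qed (simp_all add: One_fract_def[symmetric] flip: to_ac_add to_ac_mult)

text \<open>The results over the algebraic closure of the fraction field are pulled back along the
  embedding. The factors \<open>\<xi>\<close> are values of a linear character that happen to be entries of the
  isomorphism over the domain, so they are roots of unity of the domain itself.\<close>

theorem nilpotent_center_iso_classes:
  fixes G :: "('g, 'm) monoid_scheme" and G' :: "('h, 'n) monoid_scheme"
    and \<psi> :: "('g \<Rightarrow> 's::{idom, ring_char_0}) \<Rightarrow> ('h \<Rightarrow> 's)"
  assumes iso: "center_iso G' G \<psi>" and nil: "nilpotent_group G'" and adapted: "adapted TYPE('s) G"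
  obtains \<pi> \<xi> where "bij_betw \<pi> (conj_classes G) (conj_classes G')"
    "\<And>D. D \<in> conj_classes G' \<Longrightarrow> \<xi> D ^ card (carrier G) = (1 :: 's)"
    "\<And>C. C \<in> conj_classes G \<Longrightarrow> \<psi> (class_sum C) = (\<lambda>g. \<xi> (\<pi> C) ^ (card (carrier G) - 1) * class_sum (\<pi> C) g)"
    "\<And>C. C \<in> conj_classes G \<Longrightarrow> card (\<pi> C) = card C"
proof -
  define j :: "'s \<Rightarrow> 's fract alg_closure" where "j = (\<lambda>s. to_ac (Fract s 1))"
  interpret j: ring_embedding j unfolding j_def by (rule ring_embedding_closure)
  interpret P: center_iso G' G \<psi> by (rule iso)
  interpret P: center_base_change G' G \<psi> j ..
  define \<phi> where "\<phi> = P.phi_inv"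
  interpret F: center_iso G G' \<phi> unfolding \<phi>_def by (rule P.center_iso_inverse)
  interpret F: center_base_change G G' \<phi> j ..
  have \<psi>\<phi>: "\<psi> (\<phi> w) = w" if "class_fun G' w" for w unfolding \<phi>_def by (rule P.phi_inv(2)[OF that])
  have \<phi>\<psi>: "\<phi> (\<psi> z) = z" if "class_fun G z" for z unfolding \<phi>_def by (rule P.phi_inv_phi[OF that])
  interpret X1: center_iso G G' F.\<Phi> by (rule F.ext_center_iso)
  interpret X2: center_iso G' G P.\<Phi> by (rule P.ext_center_iso)
  define R where "R = {x. integral_over (range j) x}"
  interpret W: center_iso_pair G G' F.\<Phi> P.\<Phi> R
  proof unfold_locales
    show "P.\<Phi> (F.\<Phi> z) = z" if "class_fun G' z" for z
      by (rule F.ext_inverse[OF P.center_base_change_axioms \<psi>\<phi> that])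
    show "F.\<Phi> (P.\<Phi> z) = z" if "class_fun G z" for z
      by (rule P.ext_inverse[OF F.center_base_change_axioms \<phi>\<psi> that])
    show "is_subring R" unfolding R_def by (rule is_subring_integral_closure[OF j.is_subring_range])
    show "x \<in> R" if "integral_over \<int> x" for x
      unfolding R_def using integral_over_mono[OF that Ints_subset_subring[OF j.is_subring_range]] by simp
    show "inverse (of_nat p) \<notin> R" if p: "Factorial_Ring.prime p" "p dvd card (carrier G)" for p
    proof
      assume "inverse (of_nat p) \<in> R"
      then have i: "integral_over (range j) (inverse (of_nat p))" by (simp add: R_def)
      have p0: "(of_nat p :: 's fract alg_closure) \<noteq> 0" using p(1) prime_gt_0_nat by fastforce
      have "inverse (of_nat p) \<in> range j"
        by (rule integral_over_inverse[OF j.is_subring_range is_subring_of_nat[OF j.is_subring_range] p0 i])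
      then obtain s where s: "j s = inverse (of_nat p)" by (auto simp: image_iff)
      have "j (of_nat p * s) = j 1" using p0 by (simp add: j.mult j.of_nat j.one s)
      then have "of_nat p * s = 1" by (rule j.eqD)
      then have "(of_nat p :: 's) dvd 1" by (metis dvd_triv_left)
      then show False using adapted p by (auto simp: adapted_def)
    qed
    show "F.\<Phi> (class_sum (conj_class G' h)) g \<in> R" if "h \<in> carrier G'" for h g
      unfolding F.ext_class_sum[OF P.G.conj_class_in[OF that]] R_def
      by (simp add: integral_over_base[OF j.is_subring_range])
    show "P.\<Phi> (class_sum (conj_class G g)) h \<in> R" if "g \<in> carrier G" for g h
      unfolding P.ext_class_sum[OF P.H.conj_class_in[OF that]] R_def
      by (simp add: integral_over_base[OF j.is_subring_range])
  qed
  obtain \<chi> \<pi> where x: "\<chi> \<in> Irr G" "\<chi> \<one>\<^bsub>G\<^esub> = 1" and \<pi>: "bij_betw \<pi> (conj_classes G') (conj_classes G)"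
    and val: "\<And>C g. C \<in> conj_classes G' \<Longrightarrow> g \<in> carrier G \<Longrightarrow> F.\<Phi> (class_sum C) g = \<chi> (inv\<^bsub>G\<^esub> g) * class_sum (\<pi> C) g"
    and crd: "\<And>C. C \<in> conj_classes G' \<Longrightarrow> card (\<pi> C) = card C"
    by (rule W.classes_to_class_multiples[OF nil]) blast
  define n where "n = card (carrier G)"
  have n0: "n > 0" unfolding n_def by (rule P.H.card_pos)
  (* Any element of the class would do, since both sides are constant on it. *)
  define \<xi> where "\<xi> D = \<phi> (class_sum D) (P.H.crep (\<pi> D))" for D
  have \<pi>in: "\<pi> D \<in> conj_classes G" if "D \<in> conj_classes G'" for D using \<pi> that by (auto simp: bij_betw_def)
  have rep: "P.H.crep (\<pi> D) \<in> \<pi> D" "P.H.crep (\<pi> D) \<in> carrier G" if "D \<in> conj_classes G'" for D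
    using P.H.crep_in[OF \<pi>in[OF that]] P.H.conj_class_carrier[OF \<pi>in[OF that]] by auto
  have jval: "j (\<phi> (class_sum D) g) = \<chi> (inv\<^bsub>G\<^esub> g) * class_sum (\<pi> D) g" if "D \<in> conj_classes G'" "g \<in> carrier G" for D g
    using val[OF that] unfolding F.ext_class_sum[OF that(1)] .
  have \<xi>n: "\<xi> D ^ n = 1" if D: "D \<in> conj_classes G'" for D
  proof (rule j.eqD)
    have "j (\<xi> D) = \<chi> (inv\<^bsub>G\<^esub> P.H.crep (\<pi> D))"
      using jval[OF D rep(2)[OF D]] rep(1)[OF D] by (simp add: \<xi>_def class_sum_def)
    then have "j (\<xi> D ^ n) = \<chi> ((inv\<^bsub>G\<^esub> P.H.crep (\<pi> D)) [^]\<^bsub>G\<^esub> n)"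
      using P.H.linear_char_pow[OF x, of "inv\<^bsub>G\<^esub> P.H.crep (\<pi> D)" n] rep(2)[OF D] by (simp add: j.power)
    also have "(inv\<^bsub>G\<^esub> P.H.crep (\<pi> D)) [^]\<^bsub>G\<^esub> n = \<one>\<^bsub>G\<^esub>" unfolding n_def by (rule P.H.pow_card) (use rep(2)[OF D] in simp)
    finally show "j (\<xi> D ^ n) = j 1" by (simp add: x(2) j.one)
  qed
  have \<phi>val: "\<phi> (class_sum D) = (\<lambda>g. \<xi> D * class_sum (\<pi> D) g)" if D: "D \<in> conj_classes G'" for D
  proof (rule ext)
    fix g
    have cf: "class_fun G (\<phi> (class_sum D))" by (rule F.phi_class[OF P.G.class_fun_class[OF D]])
    show "\<phi> (class_sum D) g = \<xi> D * class_sum (\<pi> D) g"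
    proof (cases "g \<in> \<pi> D")
      case True
      then have "g \<in> conj_class G (P.H.crep (\<pi> D))" using P.H.conj_class_eqI[OF \<pi>in[OF D] rep(1)[OF D]] by blast
      from P.H.class_fun_conj_class[OF cf rep(2)[OF D] this] show ?thesis using True by (simp add: \<xi>_def class_sum_def)
    next
      case False
      show ?thesis
      proof (cases "g \<in> carrier G")
        case True
        then have "j (\<phi> (class_sum D) g) = 0" using jval[OF D True] False by (simp add: class_sum_def)
        then show ?thesis using j.inj False by (simp add: class_sum_def)
      next
        case F: False
        then show ?thesis using cf False by (simp add: class_fun_def class_sum_def)
      qed
    qed
  qed
  define \<sigma>' where "\<sigma>' = inv_into (conj_classes G') \<pi>"
  have s1: "bij_betw \<sigma>' (conj_classes G) (conj_classes G')" unfolding \<sigma>'_def by (rule bij_betw_inv_into[OF \<pi>])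
  have s2: "\<sigma>' C \<in> conj_classes G'" "\<pi> (\<sigma>' C) = C" if "C \<in> conj_classes G" for C
    using s1 that bij_betw_inv_into_right[OF \<pi> that] by (auto simp: \<sigma>'_def bij_betw_def)
  show thesis
  proof (rule that[OF s1])
    show "\<xi> D ^ card (carrier G) = 1" if "D \<in> conj_classes G'" for D using \<xi>n[OF that] by (simp only: n_def)
    show "card (\<sigma>' C) = card C" if "C \<in> conj_classes G" for C using crd[OF s2(1)[OF that]] s2(2)[OF that] by simp
    show "\<psi> (class_sum C) = (\<lambda>g. \<xi> (\<sigma>' C) ^ (card (carrier G) - 1) * class_sum (\<sigma>' C) g)" if C: "C \<in> conj_classes G" for C
    proof (rule ext)
      fix g
      have "class_sum (\<sigma>' C) = \<psi> (\<phi> (class_sum (\<sigma>' C)))" by (rule \<psi>\<phi>[OF P.G.class_fun_class[OF s2(1)[OF C]], symmetric])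
      also have "\<dots> = (\<lambda>g. \<xi> (\<sigma>' C) * \<psi> (class_sum C) g)"
        unfolding \<phi>val[OF s2(1)[OF C]] s2(2)[OF C] by (rule P.phi_smult[OF P.H.class_fun_class[OF C]])
      finally have e: "class_sum (\<sigma>' C) g = \<xi> (\<sigma>' C) * \<psi> (class_sum C) g" by metis
      have "\<xi> (\<sigma>' C) ^ (n - 1) * class_sum (\<sigma>' C) g = (\<xi> (\<sigma>' C) ^ (n - 1) * \<xi> (\<sigma>' C)) * \<psi> (class_sum C) g"
        unfolding e by (simp only: mult.assoc)
      also have "\<xi> (\<sigma>' C) ^ (n - 1) * \<xi> (\<sigma>' C) = 1" using \<xi>n[OF s2(1)[OF C]] n0 by (metis power_minus_mult)
      finally show "\<psi> (class_sum C) g = \<xi> (\<sigma>' C) ^ (card (carrier G) - 1) * class_sum (\<sigma>' C) g" by (simp add: n_def)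
    qed
  qed
qed

section \<open>Complex characters and the bijection of characters\<close>

context fin_group begin

lemma representation_iff: "representation G n \<rho> \<longleftrightarrow> mat_rep G n \<rho>"
proof
  have M: "monoid (ring_mat TYPE(complex) n ())" by (rule ring.is_monoid[OF ring_mat])
  assume r: "representation G n \<rho>"
  then have h: "\<rho> \<in> hom G (units_of (ring_mat TYPE(complex) n ()))" by (simp add: representation_def)
  interpret U: group "units_of (ring_mat TYPE(complex) n ())" by (rule monoid.units_group[OF M])
  interpret hom: group_hom G "units_of (ring_mat TYPE(complex) n ())" \<rho> by unfold_locales (rule h)
  show "mat_rep G n \<rho>"
    unfolding mat_rep_def
    using h hom.hom_one hom.hom_mult
    by (auto simp: hom_def units_of_def Units_def ring_mat_simps Pi_iff)
next
  assume r: "mat_rep G n \<rho>"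
  have "\<rho> g \<in> Units (ring_mat TYPE(complex) n ())" if g: "g \<in> carrier G" for g
  proof -
    have "\<rho> g * \<rho> (inv g) = 1\<^sub>m n" "\<rho> (inv g) * \<rho> g = 1\<^sub>m n"
      using mat_repD(2)[OF r g inv_closed[OF g]] mat_repD(2)[OF r inv_closed[OF g] g] mat_repD(3)[OF r] g by auto
    then show ?thesis using mat_repD(1)[OF r g] mat_repD(1)[OF r inv_closed[OF g]]
      by (auto simp: Units_def ring_mat_simps)
  qed
  then show "representation G n \<rho>" using mat_repD(2)[OF r]
    by (auto simp: representation_def hom_def units_of_def ring_mat_simps)
qed

lemma irr_chars_eq_Irr: "irr_chars G = Irr G"
proof -
  have "irreducible_representation G n \<rho> \<longleftrightarrow> irr_rep G n \<rho>" for n \<rho>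
    unfolding irreducible_representation_def irr_rep_def representation_iff lin_subspace_iff ..
  moreover have "character_of G n \<rho> = rep_char G n \<rho>" for n \<rho> by (simp add: character_of_def rep_char_def)
  ultimately show ?thesis by (simp add: irr_chars_def Irr_def)
qed

end

text \<open>Products and sums are compatible with the embedding. A central element over the larger field
  is a combination of class sums, and class sums act on each idempotent by scalars of the
  smaller field.\<close>

lemma orth_system_base_change:
  fixes j :: "'f::field \<Rightarrow> 'k::field" and e :: "'x \<Rightarrow> 'g \<Rightarrow> 'f"
  assumes emb: "ring_embedding j" and G: "fin_group G" and e: "orth_system G I e"
  shows "orth_system G I (\<lambda>x g. j (e x g))"
proof -
  interpret j: ring_embedding j by (rule emb)
  interpret G: fin_group G by (rule G)
  have I: "finite I" and ec: "\<And>x. x \<in> I \<Longrightarrow> class_fun G (e x)" and e0: "\<And>x. x \<in> I \<Longrightarrow> e x \<noteq> (\<lambda>_. 0)"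
    and eo: "\<And>x y. x \<in> I \<Longrightarrow> y \<in> I \<Longrightarrow> conv G (e x) (e y) = (if x = y then e x else (\<lambda>_. 0))"
    and es: "(\<lambda>g. \<Sum>x\<in>I. e x g) = delta1 G"
    and ez: "\<And>x z. x \<in> I \<Longrightarrow> class_fun G z \<Longrightarrow> \<exists>c. conv G z (e x) = (\<lambda>g. c * e x g)"
    using e unfolding orth_system_def by blast+
  show ?thesis
    unfolding orth_system_def
  proof (intro conjI ballI allI impI)
    show "finite I" by (rule I)
    show "(\<lambda>g. \<Sum>x\<in>I. j (e x g)) = delta1 G"
      unfolding j.sum[symmetric] fun_cong[OF es] by (rule j.delta1)
    fix x assume x: "x \<in> I"
    show "class_fun G (\<lambda>g. j (e x g))" by (rule j.class_fun[OF ec[OF x]])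
    obtain g where "e x g \<noteq> 0" using e0[OF x] by auto
    then have "j (e x g) \<noteq> 0" using j.inj by blast
    then show "(\<lambda>g. j (e x g)) \<noteq> (\<lambda>_. 0)" by metis
    show "conv G (\<lambda>g. j (e x g)) (\<lambda>g. j (e y g)) = (if x = y then (\<lambda>g. j (e x g)) else (\<lambda>_. 0))" if y: "y \<in> I" for y
      unfolding j.conv eo[OF x y] by (simp add: j.zero)
    show "\<exists>c. conv G z (\<lambda>g. j (e x g)) = (\<lambda>g. c * j (e x g))" if z: "class_fun G z" for z :: "'g \<Rightarrow> 'k"
    proof -
      have "\<exists>c. conv G (class_sum C) (e x) = (\<lambda>g. c * e x g)" if "C \<in> conj_classes G" for C
        by (rule ez[OF x G.class_fun_class[OF that]])
      then obtain c where c: "\<And>C. C \<in> conj_classes G \<Longrightarrow> conv G (class_sum C) (e x) = (\<lambda>g. c C * e x g)" by metis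
      have "conv G z (\<lambda>g. j (e x g)) = conv G (\<lambda>g. \<Sum>C\<in>conj_classes G. z (G.crep C) * class_sum C g) (\<lambda>g. \<Sum>i\<in>{()}. 1 * j (e x g))"
        using G.class_fun_decomp[OF z] by simp
      also have "\<dots> = (\<lambda>g. \<Sum>C\<in>conj_classes G. \<Sum>i\<in>{()}. z (G.crep C) * 1 * conv G (class_sum C) (\<lambda>g. j (e x g)) g)"
        by (rule G.conv_bilinear)
      also have "\<dots> = (\<lambda>g. (\<Sum>C\<in>conj_classes G. z (G.crep C) * j (c C)) * j (e x g))"
      proof (rule ext)
        fix g
        have "conv G (class_sum C) (\<lambda>g. j (e x g)) g = j (c C) * j (e x g)" if "C \<in> conj_classes G" for C
          unfolding j.class_sum[symmetric] j.conv c[OF that] by (rule j.mult)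
        then show "(\<Sum>C\<in>conj_classes G. \<Sum>i\<in>{()}. z (G.crep C) * 1 * conv G (class_sum C) (\<lambda>g. j (e x g)) g) =
            (\<Sum>C\<in>conj_classes G. z (G.crep C) * j (c C)) * j (e x g)"
          by (simp add: sum_distrib_right mult.assoc)
      qed
      finally show ?thesis by blast
    qed
  qed
qed

lemma ring_embedding_field_hom:
  assumes "field_hom \<iota>" shows "ring_embedding \<iota>"
proof -
  interpret field_hom \<iota> by (rule assms)
  show ?thesis
  proof
    show "x = 0" if "\<iota> x = 0" for x
    proof (rule ccontr)
      assume "x \<noteq> 0"
      then have "\<iota> x * \<iota> (inverse x) = 1" by (simp flip: hom_mult)
      then show False using that by simp
    qed
  qed (simp_all add: hom_add hom_mult)
qed

lemma ring_embedding_fract: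
  assumes "field_hom \<kappa>" shows "ring_embedding (\<lambda>s :: 's::idom. \<kappa> (Fract s 1))"
proof -
  interpret k: ring_embedding \<kappa> by (rule ring_embedding_field_hom[OF assms])
  show ?thesis
  proof
    show "x = 0" if "\<kappa> (Fract x 1) = 0" for x :: 's
      using k.inj[OF that] by (simp add: Zero_fract_def eq_fract)
  qed (simp_all add: One_fract_def[symmetric] k.one flip: k.add k.mult)
qed

lemma Irr_degree_square_inj:
  assumes "fin_group G" "fin_group G'" "\<chi> \<in> Irr G" "\<chi>' \<in> Irr G'" "\<chi> \<one>\<^bsub>G\<^esub> ^ 2 = (\<chi>' \<one>\<^bsub>G'\<^esub> ^ 2 :: 'k::field_char_0)"
  shows "\<chi> \<one>\<^bsub>G\<^esub> = \<chi>' \<one>\<^bsub>G'\<^esub>"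
proof -
  obtain m where m: "\<chi> \<one>\<^bsub>G\<^esub> = of_nat m" by (rule fin_group.IrrE[OF assms(1,3)])
  obtain n where n: "\<chi>' \<one>\<^bsub>G'\<^esub> = of_nat n" by (rule fin_group.IrrE[OF assms(2,4)])
  have "(of_nat (m ^ 2) :: 'k) = of_nat (n ^ 2)" using assms(5) by (simp add: m n)
  then have "m ^ 2 = n ^ 2" by (simp only: of_nat_eq_iff)
  then have "m = n" by simp
  then show ?thesis by (simp add: m n)
qed

context center_base_change begin

text \<open>Class sums other than that of the identity have images that vanish at the identity, because
  only the class of the identity contains the identity.\<close>

lemma ext_at_one:
  assumes \<pi>: "bij_betw \<pi> (conj_classes H) (conj_classes G)"
    and val: "\<And>C. C \<in> conj_classes H \<Longrightarrow> \<phi> (class_sum C) = (\<lambda>g. \<eta> C * class_sum (\<pi> C) g)"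
  shows "\<Phi> z \<one>\<^bsub>G\<^esub> = z \<one>\<^bsub>H\<^esub>"
proof -
  have one: "{\<one>\<^bsub>H\<^esub>} \<in> conj_classes H" using H.conj_class_in[OF H.one_closed] by (simp add: H.conj_class_one)
  have fone: "\<phi> (class_sum {\<one>\<^bsub>H\<^esub>}) \<one>\<^bsub>G\<^esub> = 1"
  proof -
    have "class_sum {\<one>\<^bsub>H\<^esub>} = (delta1 H :: 'h \<Rightarrow> 's)" by (auto simp: class_sum_def delta1_def)
    then show ?thesis by (simp add: phi_one) (simp add: delta1_def)
  qed
  have only: "C = {\<one>\<^bsub>H\<^esub>}" if C: "C \<in> conj_classes H" and 1: "\<one>\<^bsub>G\<^esub> \<in> \<pi> C" for C
  proof -
    have "\<one>\<^bsub>G\<^esub> \<in> \<pi> {\<one>\<^bsub>H\<^esub>}" using fone unfolding val[OF one] by (simp add: class_sum_def split: if_splits)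
    then have "\<pi> C = \<pi> {\<one>\<^bsub>H\<^esub>}"
      using 1 G.conj_class_eqI \<pi> C one unfolding bij_betw_def by (metis image_eqI)
    then show ?thesis using \<pi> C one by (auto simp: bij_betw_def inj_on_def)
  qed
  have "\<Phi> z \<one>\<^bsub>G\<^esub> = (\<Sum>C\<in>conj_classes H. if C = {\<one>\<^bsub>H\<^esub>} then z \<one>\<^bsub>H\<^esub> else 0)"
    unfolding ext_expand
  proof (rule sum.cong[OF refl])
    fix C assume C: "C \<in> conj_classes H"
    show "z (H.crep C) * j (\<phi> (class_sum C) \<one>\<^bsub>G\<^esub>) = (if C = {\<one>\<^bsub>H\<^esub>} then z \<one>\<^bsub>H\<^esub> else 0)"
    proof (cases "C = {\<one>\<^bsub>H\<^esub>}")
      case True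
      then have "H.crep C = \<one>\<^bsub>H\<^esub>" using H.crep_in[OF C] by simp
      then show ?thesis using True by (simp add: fone j.one)
    next
      case False
      then have "\<one>\<^bsub>G\<^esub> \<notin> \<pi> C" using only[OF C] by blast
      then have "\<phi> (class_sum C) \<one>\<^bsub>G\<^esub> = 0" unfolding val[OF C] by (simp add: class_sum_def)
      then show ?thesis using False by (simp add: j.zero)
    qed
  qed
  also have "\<dots> = z \<one>\<^bsub>H\<^esub>" using one H.finite_conj_classes by simp
  finally show ?thesis .
qed

end

section \<open>Monomiality and character degrees\<close>

theorem theorem11:
  fixes G :: "('g, 'm) monoid_scheme" and G' :: "('h, 'n) monoid_scheme"
    and \<psi> :: "('g \<Rightarrow> 's::{idom, ring_char_0}) \<Rightarrow> ('h \<Rightarrow> 's)"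
  assumes "finite (carrier G)" and "nilpotent_group G"
    and "finite (carrier G')" and "nilpotent_group G'"
    and "adapted TYPE('s) G"
    and "center_algebra_iso G G' \<psi>"
  shows "monomial G G' \<psi> \<and>
    (\<forall>(\<iota> :: complex \<Rightarrow> 'k::field) (\<kappa> :: 's fract \<Rightarrow> 'k).
       field_hom \<iota> \<and> field_hom \<kappa> \<longrightarrow> preserves_character_degrees G G' \<iota> \<kappa> \<psi>)"
proof -
  have fG: "fin_group G" and fG': "fin_group G'"
    using assms by (auto simp: fin_group_def fin_group_axioms_def nilpotent_group_def)
  interpret G: fin_group G by (rule fG)
  interpret G': fin_group G' by (rule fG')
  interpret P: center_iso G' G \<psi> by (rule center_iso_of_algebra_iso[OF fG fG' assms(6)])
  obtain \<pi> \<xi> where \<pi>: "bij_betw \<pi> (conj_classes G) (conj_classes G')"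
    and \<xi>: "\<And>D. D \<in> conj_classes G' \<Longrightarrow> \<xi> D ^ card (carrier G) = (1 :: 's)"
    and val: "\<And>C. C \<in> conj_classes G \<Longrightarrow> \<psi> (class_sum C) = (\<lambda>g. \<xi> (\<pi> C) ^ (card (carrier G) - 1) * class_sum (\<pi> C) g)"
    and crd: "\<And>C. C \<in> conj_classes G \<Longrightarrow> card (\<pi> C) = card C"
    by (rule nilpotent_center_iso_classes[OF P.center_iso_axioms assms(4,5)]) blast
  have "monomial G G' \<psi>"
    unfolding monomial_def
  proof (intro exI conjI ballI)
    show "bij_betw \<pi> (conj_classes G) (conj_classes G')" by (rule \<pi>)
    show "\<psi> (class_sum C) = (\<lambda>g. \<xi> (\<pi> C) ^ (card (carrier G) - 1) * class_sum (\<pi> C) g)" if "C \<in> conj_classes G" for C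
      by (rule val[OF that])
    fix D assume D: "D \<in> conj_classes G'"
    show "card (carrier G) > 0" by (rule G.card_pos)
    show "\<xi> D ^ card (carrier G) = 1" by (rule \<xi>[OF D])
    then show "\<xi> D * \<xi> D ^ (card (carrier G) - 1) = 1" using G.card_pos by (simp add: power_eq_if)
  qed
  moreover have "preserves_character_degrees G G' \<iota> \<kappa> \<psi>"
    if i: "field_hom \<iota>" and k: "field_hom \<kappa>" for \<iota> :: "complex \<Rightarrow> 'k" and \<kappa> :: "'s fract \<Rightarrow> 'k"
  proof -
    define j where "j = (\<lambda>s :: 's. \<kappa> (Fract s 1))"
    interpret j: ring_embedding j unfolding j_def by (rule ring_embedding_fract[OF k])
    interpret i: ring_embedding \<iota> by (rule ring_embedding_field_hom[OF i])
    interpret P: center_base_change G' G \<psi> j ..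
    interpret E: center_iso_field G' G P.\<Phi> by (rule center_iso_field.intro[OF P.ext_center_iso])
    have ext: "center_extension G \<kappa> \<psi> = P.\<Phi>"
      by (simp add: fun_eq_iff center_extension_def center_ext_def j_def)
    have idem: "char_idempotent K \<iota> = (\<lambda>\<chi> g. \<iota> (eidem K \<chi> g))" for K :: "('x, 'y) monoid_scheme"
      by (simp add: fun_eq_iff char_idempotent_def eidem_def i.zero)
    obtain f where f: "bij_betw f (Irr G) (Irr G')"
      "\<And>\<chi>. \<chi> \<in> Irr G \<Longrightarrow> P.\<Phi> (char_idempotent G \<iota> \<chi>) = char_idempotent G' \<iota> (f \<chi>)"
      using E.idempotent_bijection[OF
        orth_system_base_change[OF i.ring_embedding_axioms fG G.orth_system_Irr]
        orth_system_base_change[OF i.ring_embedding_axioms fG' G'.orth_system_Irr]]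
      unfolding idem by blast
    have "card (carrier G) = (\<Sum>C\<in>conj_classes G. card C)"
      using G.sum_over_classes[of "\<lambda>_. 1 :: nat"] by simp
    also have "\<dots> = (\<Sum>C\<in>conj_classes G. card (\<pi> C))" by (simp add: crd)
    also have "\<dots> = (\<Sum>D\<in>conj_classes G'. card D)" by (rule sum.reindex_bij_betw[OF \<pi>])
    also have "\<dots> = card (carrier G')" using G'.sum_over_classes[of "\<lambda>_. 1 :: nat"] by simp
    finally have order: "card (carrier G) = card (carrier G')" .
    have "\<chi> \<one>\<^bsub>G\<^esub> = f \<chi> \<one>\<^bsub>G'\<^esub>" if x: "\<chi> \<in> Irr G" for \<chi>
    proof (rule Irr_degree_square_inj[OF fG fG' x])
      show "f \<chi> \<in> Irr G'" using f(1) x by (auto simp: bij_betw_def)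
      have "char_idempotent G \<iota> \<chi> \<one>\<^bsub>G\<^esub> = char_idempotent G' \<iota> (f \<chi>) \<one>\<^bsub>G'\<^esub>"
        unfolding f(2)[OF x, symmetric] by (rule P.ext_at_one[OF \<pi> val, symmetric])
      then have "\<iota> (\<chi> \<one>\<^bsub>G\<^esub> / of_nat (card (carrier G)) * \<chi> \<one>\<^bsub>G\<^esub>) =
          \<iota> (f \<chi> \<one>\<^bsub>G'\<^esub> / of_nat (card (carrier G')) * f \<chi> \<one>\<^bsub>G'\<^esub>)"
        by (simp add: char_idempotent_def)
      then have "\<chi> \<one>\<^bsub>G\<^esub> / of_nat (card (carrier G)) * \<chi> \<one>\<^bsub>G\<^esub> =
          f \<chi> \<one>\<^bsub>G'\<^esub> / of_nat (card (carrier G')) * f \<chi> \<one>\<^bsub>G'\<^esub>" by (rule i.eqD)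
      then show "\<chi> \<one>\<^bsub>G\<^esub> ^ 2 = f \<chi> \<one>\<^bsub>G'\<^esub> ^ 2"
        using G'.card_pos by (simp add: order power2_eq_square)
    qed
    then show ?thesis
      unfolding preserves_character_degrees_def G.irr_chars_eq_Irr G'.irr_chars_eq_Irr ext
      using f by blast
  qed
  ultimately show ?thesis by blast
qed

end
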